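(* Let $s$ be a normalized indeterminate moment sequence which is Stieltjes, with N-extremal solutions $\mu_t$, $t\in\mathbb R\cup\{\infty\}$, and Friedrichs parameter $F(s)$. (a) If $s$ is indet(S), then the measure $(1+x^2)^{-1/2}d\mu_{F(s)}(x)$ is determinate, while the measures $(1+x^2)^{-1/2}d\mu_t(x)$ are indet(S) and N-extremal for $F(s)<t<\infty$. The measure $(1+x^2)^{-1/2}d\mu_K(x)$, where $\mu_K=\mu_\infty$ is the Krein solution, is indeterminate, N-extremal and det(S). (b) If $s$ is det(S), and hence $F(s)=\infty$ with only one Stieltjes solution $\mu=\mu_{F(s)}$, then $(1+x^2)^{-1/2}d\mu(x)$ is determinate. (c) The measures $(1+x^2)^{-1/2}d\mu_t(x)$ are indeterminate and N-extremal for $-\infty<t<F(s)$. In particular $\mu_F\in B(\tfrac12)$, hence $a(\mu_F)\le 1/2$, while $\mu_t\in A(\tfrac12)$, hence $a(\mu_t)\ge 1/2$, for all $t\in(\mathbb R\cup\{\infty\})\setminus\{F(s)\}$.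
   Context: $\mathcal M^*$ denotes the set of positive Borel measures on $\mathbb R$ with infinite support and finite moments of every order. A measure $\mu\in\mathcal M^*$, and its moment sequence $s_n=\int x^n\,d\mu(x)$, $n\ge0$, is determinate if $\mu$ is the only measure in $\mathcal M^*$ with these moments, and indeterminate otherwise. $\mathcal M_d^*$, $\mathcal M_i^*$ are the sets of determinate, resp. indeterminate, measures. $V=V(s)$ is the set of measures in $\mathcal M^*$ with moment sequence $s$; $s$ is normalized if $s_0=1$. Let $s$ be normalized and indeterminate. Let $p_n$ be the orthonormal polynomials (degree $n$, positive leading coefficient) and $q_n(z)=\int\frac{p_n(z)-p_n(x)}{z-x}d\mu(x)$ ($\mu\in V$) the polynomials of the second kind. Define entire functions $A(z)=z\sum q_n(0)q_n(z)$, $B(z)=-1+z\sum q_n(0)p_n(z)$, $C(z)=1+z\sum p_n(0)q_n(z)$, $D(z)=z\sum p_n(0)p_n(z)$ (sums over $n\ge0$). For $t\in\mathbb R\cup\{\infty\}$ the N-extremal solution $\mu_t\in V$ is determined by $$\int\frac{d\mu_t(x)}{x-z}=-\frac{A(z)+tC(z)}{B(z)+tD(z)},\quad z\in\mathbb C\setminus\mathbb R,$$ with right-hand side $-C(z)/D(z)$ for $t=\infty$. For non-normalized measures, N-extremality is defined by rescaling to mass 1; an indeterminate measure $\mu$ is N-extremal iff $\mathbb C[x]$ is dense in $L^2(\mu)$ (M. Riesz). An indeterminate $s$ is Stieltjes if some $\mu\in V$ is supported in $[0,\infty)$; it is det(S) if there is exactly one such $\mu\in V$, and indet(S) if there is more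 than one. A measure supported in $[0,\infty)$ is called det(S)/indet(S) if its moment sequence is. For $s$ indeterminate and Stieltjes put $\alpha(s)=\lim_{n\to\infty}p_n(0)/q_n(0)=\lim_{x\to-\infty}D(x)/B(x)\le 0$; $s$ is det(S) iff $\alpha(s)=0$. The Friedrichs parameter is $F(s)=-1/\alpha(s)$ if $\alpha(s)<0$ and $F(s)=\infty$ if $\alpha(s)=0$. The measure $\mu_t$ is supported in $[0,\infty)$ iff $F(s)\le t\le\infty$. The Friedrichs solution is $\mu_F=\mu_{F(s)}$ and the Krein solution is $\mu_K=\mu_\infty$ (they coincide in the det(S) case). For $0\le\alpha\le1$: $A(\alpha)=\{\mu\in\mathcal M_i^*\mid(1+x^2)^{-\alpha}d\mu(x)\in\mathcal M_i^*\}$ and $B(\alpha)=\{\mu\in\mathcal M_i^*\mid(1+x^2)^{-\alpha}d\mu(x)\in\mathcal M_d^*\}$. For $\mu$ indeterminate and N-extremal, $a(\mu)=\sup\{\alpha\in[0,1]\mid\mu\in A(\alpha)\}=\inf\{\beta\in[0,1]\mid\mu\in B(\beta)\}$. *)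

theory Defs
  imports "HOL-Analysis.Analysis"
begin

definition msupport :: "real measure \<Rightarrow> real set" where
  "msupport \<mu> = {x. \<forall>U. open U \<and> x \<in> U \<longrightarrow> emeasure \<mu> U > 0}"

definition Mstar :: "real measure set" where
  "Mstar = {\<mu>. sets \<mu> = sets borel \<and> infinite (msupport \<mu>) \<and>
                (\<forall>n::nat. integrable \<mu> (\<lambda>x. x ^ n))}"

definition moments :: "real measure \<Rightarrow> nat \<Rightarrow> real" where
  "moments \<mu> n = (LINT x|\<mu>. x ^ n)"

definition V :: "(nat \<Rightarrow> real) \<Rightarrow> real measure set" where
  "V s = {\<mu> \<in> Mstar. moments \<mu> = s}"

definition indeterminate_seq :: "(nat \<Rightarrow> real) \<Rightarrow> bool" where
  "indeterminate_seq s \<longleftrightarrow> V s \<noteq> {} \<and> \<not> (\<exists>!\<mu>. \<mu> \<in> V s)"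

definition M_det :: "real measure set" where
  "M_det = {\<mu> \<in> Mstar. \<forall>\<nu> \<in> Mstar. moments \<nu> = moments \<mu> \<longrightarrow> \<nu> = \<mu>}"

definition M_indet :: "real measure set" where
  "M_indet = Mstar - M_det"

definition orthonormal_poly :: "(nat \<Rightarrow> real) \<Rightarrow> nat \<Rightarrow> real poly" where
  "orthonormal_poly s = (THE P.
     (\<forall>n. degree (P n) = n \<and> lead_coeff (P n) > 0) \<and>
     (\<forall>\<mu> \<in> V s. \<forall>m n. (LINT x|\<mu>. poly (P m) x * poly (P n) x) = (if m = n then 1 else 0)))"

definition pfun :: "(nat \<Rightarrow> real) \<Rightarrow> nat \<Rightarrow> 'a::real_normed_field \<Rightarrow> 'a" where
  "pfun s n z = poly (map_poly of_real (orthonormal_poly s n)) z"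

text \<open>The quotient (p(z) - p(x)) / (z - x) is a polynomial in both variables, so on the
  diagonal it has the value p'(x). This matters when the measure has an atom at z, for
  instance at z = 0.\<close>

definition diff_quot :: "'a::field poly \<Rightarrow> 'a \<Rightarrow> 'a \<Rightarrow> 'a" where
  "diff_quot p z x = (if z = x then poly (pderiv p) x else (poly p z - poly p x) / (z - x))"

text \<open>The integrand is a polynomial in x, so the value is the same for every choice of the
  measure in V s.\<close>

definition qfun ::
  "(nat \<Rightarrow> real) \<Rightarrow> nat \<Rightarrow> 'a::{real_normed_field, banach, second_countable_topology} \<Rightarrow> 'a" where
  "qfun s n z = (LINT x|(SOME \<mu>. \<mu> \<in> V s).
      diff_quot (map_poly of_real (orthonormal_poly s n)) z (of_real x))"

definition nev_A :: "(nat \<Rightarrow> real) \<Rightarrow> complex \<Rightarrow> complex" where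
  "nev_A s z = z * (\<Sum>n. qfun s n 0 * qfun s n z)"

definition nev_B :: "(nat \<Rightarrow> real) \<Rightarrow> complex \<Rightarrow> complex" where
  "nev_B s z = -1 + z * (\<Sum>n. qfun s n 0 * pfun s n z)"

definition nev_C :: "(nat \<Rightarrow> real) \<Rightarrow> complex \<Rightarrow> complex" where
  "nev_C s z = 1 + z * (\<Sum>n. pfun s n 0 * qfun s n z)"

definition nev_D :: "(nat \<Rightarrow> real) \<Rightarrow> complex \<Rightarrow> complex" where
  "nev_D s z = z * (\<Sum>n. pfun s n 0 * pfun s n z)"

text \<open>The parameter set, the real line with one point at infinity added, is represented by the
  extended reals other than \<open>-\<infinity>\<close>.\<close>

definition nev_transform :: "(nat \<Rightarrow> real) \<Rightarrow> ereal \<Rightarrow> complex \<Rightarrow> complex" where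
  "nev_transform s t z =
     (if t = \<infinity> then - (nev_C s z / nev_D s z)
      else - ((nev_A s z + of_real (real_of_ereal t) * nev_C s z) /
              (nev_B s z + of_real (real_of_ereal t) * nev_D s z)))"

definition mu_ext :: "(nat \<Rightarrow> real) \<Rightarrow> ereal \<Rightarrow> real measure" where
  "mu_ext s t = (THE \<mu>. \<mu> \<in> V s \<and>
     (\<forall>z. z \<notin> \<real> \<longrightarrow> (LINT x|\<mu>. 1 / (complex_of_real x - z)) = nev_transform s t z))"

definition normalize_mass :: "real measure \<Rightarrow> real measure" where
  "normalize_mass \<mu> = scale_measure (1 / emeasure \<mu> (space \<mu>)) \<mu>"

definition N_extremal :: "real measure \<Rightarrow> bool" where
  "N_extremal \<mu> \<longleftrightarrow> \<mu> \<in> M_indet \<and>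
     (\<exists>t. t \<noteq> -\<infinity> \<and> normalize_mass \<mu> = mu_ext (moments (normalize_mass \<mu>)) t)"

definition V_Stieltjes :: "(nat \<Rightarrow> real) \<Rightarrow> real measure set" where
  "V_Stieltjes s = {\<mu> \<in> V s. msupport \<mu> \<subseteq> {0..}}"

definition Stieltjes_seq :: "(nat \<Rightarrow> real) \<Rightarrow> bool" where
  "Stieltjes_seq s \<longleftrightarrow> indeterminate_seq s \<and> V_Stieltjes s \<noteq> {}"

definition det_S :: "(nat \<Rightarrow> real) \<Rightarrow> bool" where
  "det_S s \<longleftrightarrow> indeterminate_seq s \<and> (\<exists>!\<mu>. \<mu> \<in> V_Stieltjes s)"

definition indet_S :: "(nat \<Rightarrow> real) \<Rightarrow> bool" where
  "indet_S s \<longleftrightarrow> indeterminate_seq s \<and> (\<exists>\<mu> \<in> V_Stieltjes s. \<exists>\<nu> \<in> V_Stieltjes s. \<mu> \<noteq> \<nu>)"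

definition det_S_measure :: "real measure \<Rightarrow> bool" where
  "det_S_measure \<mu> \<longleftrightarrow> \<mu> \<in> Mstar \<and> msupport \<mu> \<subseteq> {0..} \<and> det_S (moments \<mu>)"

definition indet_S_measure :: "real measure \<Rightarrow> bool" where
  "indet_S_measure \<mu> \<longleftrightarrow> \<mu> \<in> Mstar \<and> msupport \<mu> \<subseteq> {0..} \<and> indet_S (moments \<mu>)"

definition alpha_lim :: "(nat \<Rightarrow> real) \<Rightarrow> real" where
  "alpha_lim s = lim (\<lambda>n. pfun s n 0 / qfun s n 0)"

definition Friedrichs :: "(nat \<Rightarrow> real) \<Rightarrow> ereal" where
  "Friedrichs s = (if alpha_lim s < 0 then ereal (- 1 / alpha_lim s) else \<infinity>)"

definition mu_F :: "(nat \<Rightarrow> real) \<Rightarrow> real measure" where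
  "mu_F s = mu_ext s (Friedrichs s)"

definition mu_K :: "(nat \<Rightarrow> real) \<Rightarrow> real measure" where
  "mu_K s = mu_ext s \<infinity>"

definition weighted :: "real \<Rightarrow> real measure \<Rightarrow> real measure" where
  "weighted \<alpha> \<mu> = density \<mu> (\<lambda>x. ennreal ((1 + x\<^sup>2) powr (- \<alpha>)))"

definition A_class :: "real \<Rightarrow> real measure set" where
  "A_class \<alpha> = {\<mu> \<in> M_indet. weighted \<alpha> \<mu> \<in> M_indet}"

definition B_class :: "real \<Rightarrow> real measure set" where
  "B_class \<alpha> = {\<mu> \<in> M_indet. weighted \<alpha> \<mu> \<in> M_det}"

definition a_index :: "real measure \<Rightarrow> real" where
  "a_index \<mu> = Sup {\<alpha> \<in> {0..1}. \<mu> \<in> A_class \<alpha>}"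

end

theory Submission
  imports Defs "HOL-Probability.Probability" "HOL-Real_Asymp.Real_Asymp"
    "HOL-Computational_Algebra.Fundamental_Theorem_Algebra"
begin

text \<open>
  For finite \<open>t\<close> the measure \<open>\<mu>\<^sub>t\<close> is the solution for which \<open>1/x\<close> lies in the \<open>L\<^sup>2\<close>-closure of the
  polynomials and has integral \<open>t\<close>; for \<open>t = \<infinity>\<close> the indicator of \<open>0\<close> replaces \<open>1/x\<close>.  This property
  determines the Stieltjes transform, it passes to densities bounded by 1 (hence N-extremality of
  the weighted measures), and solutions with this property arise as weak limits of quadrature
  formulas.

  The Friedrichs solution \<open>\<mu>\<^sub>F\<close> is the limit of the Gauss quadratures and uniquely minimises
  \<open>\<integral> d\<mu> / (x + a)\<close> among the solutions supported in some \<open>[c, \<infinity>)\<close> with \<open>c > -a\<close>.  The polynomials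
  \<open>\<pi>\<close> approximating \<open>1 / (x + a)\<close> in \<open>L\<^sup>2((x + a) d\<mu>\<^sub>F)\<close> give polynomials \<open>1 - (x + a) \<pi>\<close> with value
  1 at \<open>-a\<close> that tend to \<open>0\<close> in \<open>L\<^sup>2(d\<mu>\<^sub>F / (x + a))\<close>, so that measure is determinate.  For \<open>t \<noteq> F\<close>
  the integral is larger by some \<open>m > 0\<close>, and \<open>d\<mu>\<^sub>t / (x + a)\<close> has the same moments as
  \<open>d\<mu>\<^sub>F / (x + a) + m \<delta>\<close> with \<open>\<delta>\<close> the unit mass at \<open>-a\<close>, so it is indeterminate.  The Krein solution
  is handled by applying the first argument to \<open>x d\<mu>\<^sub>K\<close>.
\<close>

text \<open>What makes the exponent 1/2 tractable is that on a half-line \<open>wt (1/2) x\<close>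
  is comparable with 1 / (x + a), and that dividing x^n by x + a leaves only the remainder (-a)^n.
  Passing from one solution to another therefore changes all moments of d\<mu> / (x + a) through a
  single number, the difference of the integrals of 1 / (x + a). Comparability requires supports
  bounded below. For t < F the support may reach below 0, but quasi-orthogonality allows at most one
  negative node in each quadrature, and this bound survives in the limit. The obstacle is that
  \<open>mu_ext\<close> is only described by a transform, which shows neither existence nor support
  nor approximability by polynomials. So everything is proved for a constructed weak limit, whose
  nodes reveal the support, and \<open>mu_ext\<close> is then identified with it. Extremality is
  formulated at an arbitrary real point b instead of 0 alone, because equality in the minimum
  property of the Friedrichs solution yields it at -a.\<close>

definition moment_functional :: "(nat \<Rightarrow> real) \<Rightarrow> 'a::real_normed_field poly \<Rightarrow> 'a" where
  "moment_functional s p = (\<Sum>i\<le>degree p. coeff p i * of_real (s i))"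

abbreviation rpoly :: "real poly \<Rightarrow> 'a::real_normed_field poly" where
  "rpoly \<equiv> map_poly of_real"

lemma moment_functional_eq_sum:
  assumes "degree p \<le> n"
  shows "moment_functional s p = (\<Sum>i\<le>n. coeff p i * of_real (s i))"
  unfolding moment_functional_def using assms
  by (intro sum.mono_neutral_left) (auto simp: coeff_eq_0)

lemma moment_functional_add: "moment_functional s (p + q) = moment_functional s p + moment_functional s q"
proof -
  let ?n = "max (degree p) (degree q)"
  show ?thesis
    using degree_add_le_max[of p q]
    by (simp add: moment_functional_eq_sum[of _ ?n] sum.distrib algebra_simps)
qed

lemma moment_functional_smult: "moment_functional s (smult c p) = c * moment_functional s p"
  using degree_smult_le[of c p]
  by (simp add: moment_functional_eq_sum[of _ "degree p"] sum_distrib_left algebra_simps)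

lemma moment_functional_0 [simp]: "moment_functional s 0 = 0"
  by (simp add: moment_functional_def)

lemma moment_functional_const [simp]: "moment_functional s [:c:] = c * of_real (s 0)"
  by (simp add: moment_functional_def)

lemma moment_functional_minus: "moment_functional s (- p) = - moment_functional s p"
  using moment_functional_smult[of s "-1" p] by simp

lemma moment_functional_diff: "moment_functional s (p - q) = moment_functional s p - moment_functional s q"
  using moment_functional_add[of s p "- q"] by (simp add: moment_functional_minus)

lemma moment_functional_sum: "moment_functional s (\<Sum>i\<in>I. f i) = (\<Sum>i\<in>I. moment_functional s (f i))"
  by (induction I rule: infinite_finite_induct) (simp_all add: moment_functional_add)

lemmas moment_functional_linear =
  moment_functional_add moment_functional_diff moment_functional_minus
  moment_functional_smult moment_functional_sum

lemma coeff_rpoly [simp]: "coeff (rpoly p :: 'a::real_normed_field poly) n = of_real (coeff p n)"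
  by (simp add: coeff_map_poly)

lemma degree_rpoly [simp]: "degree (rpoly p :: 'a::real_normed_field poly) = degree p"
  by (rule degree_map_poly) simp

lemma rpoly_eq_0_iff [simp]: "(rpoly p :: 'a::real_normed_field poly) = 0 \<longleftrightarrow> p = 0"
  by (simp add: poly_eq_iff)

lemma rpoly_add: "(rpoly (p + q) :: 'a::real_normed_field poly) = rpoly p + rpoly q"
  by (simp add: poly_eq_iff)

lemma rpoly_smult: "(rpoly (smult c p) :: 'a::real_normed_field poly) = smult (of_real c) (rpoly p)"
  by (simp add: poly_eq_iff)

lemma rpoly_mult: "(rpoly (p * q) :: 'a::real_normed_field poly) = rpoly p * rpoly q"
  by (simp add: poly_eq_iff coeff_mult)

lemma rpoly_sum: "(rpoly (\<Sum>i\<in>I. f i) :: 'a::real_normed_field poly) = (\<Sum>i\<in>I. rpoly (f i))"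
  by (induction I rule: infinite_finite_induct) (simp_all add: rpoly_add)

lemma rpoly_real [simp]: "(rpoly p :: real poly) = p"
  by (simp add: poly_eq_iff)

lemma poly_rpoly [simp]: "poly (rpoly p :: 'a::real_normed_field poly) (of_real x) = of_real (poly p x)"
  by (simp add: poly_altdef)

lemma moment_functional_rpoly [simp]:
  "moment_functional s (rpoly p :: 'a::real_normed_field poly) = of_real (moment_functional s p)"
  by (simp add: moment_functional_def)

section \<open>Divided differences and polynomials of the second kind\<close>

lemma poly_eq_synthetic_div: "poly p x - poly p z = (x - z) * poly (synthetic_div p z) (x::'a::comm_ring_1)"
proof -
  have "poly p x = poly ([:-z, 1:] * synthetic_div p z + [:poly p z:]) x"
    by (subst synthetic_div_correct') simp
  thus ?thesis by (simp add: algebra_simps)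
qed

lemma poly_synthetic_div_diag: "poly (synthetic_div p z) z = poly (pderiv p) (z::'a::idom)"
proof -
  have "pderiv p = pderiv ([:-z, 1:] * synthetic_div p z + [:poly p z:])"
    by (subst synthetic_div_correct') simp
  thus ?thesis by (simp only: pderiv_mult pderiv_add pderiv_pCons poly_add poly_mult) simp
qed

text \<open>The synthetic quotient already has the value p'(x) on the diagonal, so the integrand of
  \<open>qfun\<close> becomes a polynomial in x, whose integral depends on the moments only.\<close>

lemma diff_quot_eq_synthetic_div: "diff_quot p z x = poly (synthetic_div p z) (x::'a::field)"
proof (cases "z = x")
  case True
  thus ?thesis by (simp add: diff_quot_def poly_synthetic_div_diag)
next
  case False
  hence "poly p z - poly p x = (z - x) * poly (synthetic_div p z) x"
    using poly_eq_synthetic_div[of p x z] by (simp add: algebra_simps)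
  with False show ?thesis by (simp add: diff_quot_def)
qed

lemma synthetic_div_eqI:
  assumes "p = [:-z, 1:] * q + [:r:]"
  shows "synthetic_div p (z::'a::comm_ring_1) = q"
proof -
  have "p + smult z q = pCons r q" by (simp add: assms)
  from synthetic_div_unique[OF this] show ?thesis by simp
qed

lemma synthetic_div_add: "synthetic_div (p + q) (z::'a::comm_ring_1) = synthetic_div p z + synthetic_div q z"
proof (rule synthetic_div_eqI[where r = "poly p z + poly q z"])
  have "p + q = ([:-z, 1:] * synthetic_div p z + [:poly p z:]) + ([:-z, 1:] * synthetic_div q z + [:poly q z:])"
    by (subst (1 2) synthetic_div_correct') simp
  also have "\<dots> = [:-z, 1:] * (synthetic_div p z + synthetic_div q z) + ([:poly p z:] + [:poly q z:])"
    by (simp only: distrib_left add_ac)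
  finally show "p + q = [:-z, 1:] * (synthetic_div p z + synthetic_div q z) + [:poly p z + poly q z:]"
    by simp
qed

lemma synthetic_div_smult: "synthetic_div (smult c p) (z::'a::comm_ring_1) = smult c (synthetic_div p z)"
proof (rule synthetic_div_eqI[where r = "c * poly p z"])
  have "smult c p = smult c ([:-z, 1:] * synthetic_div p z + [:poly p z:])"
    by (subst synthetic_div_correct') simp
  thus "smult c p = [:- z, 1:] * smult c (synthetic_div p z) + [:c * poly p z:]"
    by (simp add: smult_add_right)
qed

lemma synthetic_div_sum: "synthetic_div (\<Sum>i\<in>I. f i) (z::'a::comm_ring_1) = (\<Sum>i\<in>I. synthetic_div (f i) z)"
  by (induction I rule: infinite_finite_induct) (simp_all add: synthetic_div_add)

text \<open>The product rule for divided differences. With z moving it yields the shift formula for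
  q_n; at z = b the second term drops out, which makes \<open>qpoly\<close> orthogonal to low
  degrees.\<close>

lemma synthetic_div_linear_mult:
  "synthetic_div ([:-b, 1:] * p) (z::'a::comm_ring_1) = p + smult (z - b) (synthetic_div p z)"
proof (rule synthetic_div_eqI[where r = "(z - b) * poly p z"])
  have "smult (z - b) p = smult (z - b) ([:-z, 1:] * synthetic_div p z + [:poly p z:])"
    by (subst synthetic_div_correct') simp
  hence "smult (z - b) p = [:-z, 1:] * smult (z - b) (synthetic_div p z) + [:(z - b) * poly p z:]"
    by (simp add: smult_add_right)
  thus "[:-b, 1:] * p = [:-z, 1:] * (p + smult (z - b) (synthetic_div p z)) + [:(z - b) * poly p z:]"
    by (simp add: algebra_simps smult_diff_left)
qed

lemma synthetic_div_rpoly: "synthetic_div (rpoly p :: 'a::real_normed_field poly) (of_real b) = rpoly (synthetic_div p b)"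
proof (rule synthetic_div_eqI[where r = "of_real (poly p b)"])
  have "(rpoly p :: 'a poly) = rpoly ([:-b, 1:] * synthetic_div p b + [:poly p b:])"
    by (subst synthetic_div_correct') simp
  thus "(rpoly p :: 'a poly) = [:- of_real b, 1:] * rpoly (synthetic_div p b) + [:of_real (poly p b):]"
    by (simp only: rpoly_add rpoly_mult) (simp add: map_poly_pCons)
qed

text \<open>The q_n are the case p = p_n. The linear extension to all p lets expansions in the p_k
  be carried over to the q_k; the field is left open because z may be complex while the p_n are
  real.\<close>

definition second_kind :: "(nat \<Rightarrow> real) \<Rightarrow> 'a::real_normed_field poly \<Rightarrow> 'a \<Rightarrow> 'a" where
  "second_kind s p z = moment_functional s (synthetic_div p z)"

lemma second_kind_sum: "second_kind s (\<Sum>i\<in>I. f i) z = (\<Sum>i\<in>I. second_kind s (f i) z)"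
  by (simp add: second_kind_def synthetic_div_sum moment_functional_sum)

lemma second_kind_smult: "second_kind s (smult c p) z = c * second_kind s p z"
  by (simp add: second_kind_def synthetic_div_smult moment_functional_smult)

lemma second_kind_linear_mult:
  "second_kind s ([:-b, 1:] * p) z = moment_functional s p + (z - b) * second_kind s p z"
  by (simp only: second_kind_def synthetic_div_linear_mult moment_functional_linear)

lemma second_kind_of_real:
  "second_kind s (rpoly p :: 'a::real_normed_field poly) (of_real b) = of_real (second_kind s p b)"
  by (simp add: second_kind_def synthetic_div_rpoly)

section \<open>Orthonormal polynomials\<close>

text \<open>Infinite support, expressed through the moments alone
  (\<open>Mstar_iff_positive_definite\<close>). Hence any measure having the moments of a member of
  \<open>Mstar\<close> lies in \<open>Mstar\<close> as well.\<close>

definition positive_definite_seq :: "(nat \<Rightarrow> real) \<Rightarrow> bool" where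
  "positive_definite_seq s \<longleftrightarrow> (\<forall>p::real poly. p \<noteq> 0 \<longrightarrow> moment_functional s (p * p) > 0)"

definition orthonormal_system :: "(nat \<Rightarrow> real) \<Rightarrow> (nat \<Rightarrow> real poly) \<Rightarrow> bool" where
  "orthonormal_system s P \<longleftrightarrow> (\<forall>n. degree (P n) = n \<and> coeff (P n) n > 0) \<and>
     (\<forall>m n. moment_functional s (P m * P n) = (if m = n then 1 else 0))"

fun gram_schmidt :: "(nat \<Rightarrow> real) \<Rightarrow> nat \<Rightarrow> real poly" where
  "gram_schmidt s n = (let r = monom 1 n -
      (\<Sum>k<n. smult (moment_functional s (monom 1 n * gram_schmidt s k)) (gram_schmidt s k))
    in smult (1 / sqrt (moment_functional s (r * r))) r)"

declare gram_schmidt.simps [simp del]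

lemma gram_schmidt_orthonormal:
  assumes "positive_definite_seq s"
  shows "degree (gram_schmidt s n) = n \<and> coeff (gram_schmidt s n) n > 0 \<and>
    (\<forall>m<n. moment_functional s (gram_schmidt s m * gram_schmidt s n) = 0) \<and>
    moment_functional s (gram_schmidt s n * gram_schmidt s n) = 1"
proof (induction n rule: less_induct)
  case (less n)
  let ?g = "gram_schmidt s" and ?L = "moment_functional s"
  define t where "t = (\<Sum>k<n. smult (?L (monom 1 n * ?g k)) (?g k))"
  define r where "r = monom 1 n - t"
  define c where "c = 1 / sqrt (?L (r * r))"
  have g: "?g n = smult c r"
    unfolding c_def r_def t_def by (subst gram_schmidt.simps) (simp add: Let_def)
  have ct: "coeff t i = 0" if "i \<ge> n" for i
    unfolding t_def coeff_sum
  proof (intro sum.neutral ballI)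
    fix k assume "k \<in> {..<n}"
    hence "degree (?g k) < i" using less[of k] that by simp
    thus "coeff (smult (?L (monom 1 n * ?g k)) (?g k)) i = 0" by (simp add: coeff_eq_0)
  qed
  have cr: "coeff r n = 1" by (simp add: r_def ct)
  have dr: "degree r = n"
    using cr by (intro order_antisym degree_le le_degree) (auto simp: r_def ct)
  have "r \<noteq> 0" using cr by auto
  hence pos: "?L (r * r) > 0" using assms by (simp add: positive_definite_seq_def)
  hence c: "c > 0" by (simp add: c_def)
  have orth: "?L (?g m * ?g k) = (if m = k then 1 else 0)" if "m < n" "k < n" for m k
    using less[OF that(1)] less[OF that(2)]
    by (metis linorder_neq_iff mult.commute)
  have "?L (?g m * r) = 0" if m: "m < n" for m
  proof -
    have "?L (?g m * t) = (\<Sum>k<n. ?L (monom 1 n * ?g k) * ?L (?g m * ?g k))"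
      unfolding t_def by (simp add: sum_distrib_left moment_functional_linear)
    also have "\<dots> = (\<Sum>k<n. if k = m then ?L (monom 1 n * ?g k) else 0)"
      by (intro sum.cong) (auto simp: orth m)
    also have "\<dots> = ?L (?g m * monom 1 n)" using m by (simp add: mult.commute)
    finally show ?thesis by (simp add: r_def right_diff_distrib moment_functional_linear)
  qed
  moreover have "c * c * ?L (r * r) = 1" using pos by (simp add: c_def)
  ultimately show ?case
    using c by (simp add: g dr cr moment_functional_linear mult.assoc)
qed

lemma orthonormal_system_exists:
  assumes "positive_definite_seq s"
  shows "orthonormal_system s (gram_schmidt s)"
proof -
  have "moment_functional s (gram_schmidt s m * gram_schmidt s n) = (if m = n then 1 else 0)" for m n
    using gram_schmidt_orthonormal[OF assms, of m] gram_schmidt_orthonormal[OF assms, of n]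
    by (metis linorder_neq_iff mult.commute)
  thus ?thesis using gram_schmidt_orthonormal[OF assms] by (simp add: orthonormal_system_def)
qed

lemma poly_in_span_of_degrees:
  fixes g :: "'a::real_normed_field poly"
  assumes "\<And>k. degree (P k) = k" "\<And>k. coeff (P k) k > 0" "degree g \<le> n"
  shows "\<exists>c. g = (\<Sum>k\<le>n. smult (c k) (rpoly (P k)))"
  using assms(3)
proof (induction n arbitrary: g)
  case 0
  have "coeff (P 0) 0 \<noteq> 0" using assms(1)[of 0] assms(2)[of 0] by simp
  moreover obtain a where "g = [:a:]" using 0 by (auto elim: degree_eq_zeroE)
  moreover obtain b where "P 0 = [:b:]" using assms(1)[of 0] by (auto elim: degree_eq_zeroE)
  ultimately show ?case
    by (intro exI[of _ "\<lambda>_. a / of_real b"]) (simp add: map_poly_pCons)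
next
  case (Suc n)
  define l where "l = coeff (P (Suc n)) (Suc n)"
  have l: "l \<noteq> 0" using assms(2)[of "Suc n"] by (simp add: l_def)
  define a where "a = coeff g (Suc n) / of_real l"
  define h where "h = g - smult a (rpoly (P (Suc n)))"
  have "coeff h i = 0" if "i > n" for i
  proof (cases "i = Suc n")
    case True
    thus ?thesis using l by (simp add: h_def a_def l_def assms(1))
  next
    case False
    thus ?thesis using that Suc.prems by (simp add: h_def coeff_eq_0 assms(1))
  qed
  hence "degree h \<le> n" by (simp add: degree_le)
  from Suc.IH[OF this] obtain c where c: "h = (\<Sum>k\<le>n. smult (c k) (rpoly (P k)))" by blast
  have "g = (\<Sum>k\<le>Suc n. smult ((c(Suc n := a)) k) (rpoly (P k)))"
  proof -
    have "(\<Sum>k\<le>n. smult ((c(Suc n := a)) k) (rpoly (P k))) = h"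
      unfolding c by (intro sum.cong) auto
    thus ?thesis by (simp add: h_def)
  qed
  thus ?case by blast
qed

lemma orthonormal_system_rpoly:
  assumes "orthonormal_system s P"
  shows "moment_functional s (rpoly (P m) * rpoly (P n) :: 'a::real_normed_field poly) = (if m = n then 1 else 0)"
  using assms by (simp add: orthonormal_system_def flip: rpoly_mult)

lemma orthonormal_expansion:
  fixes g :: "'a::real_normed_field poly"
  assumes "orthonormal_system s P" "degree g \<le> n"
  shows "g = (\<Sum>k\<le>n. smult (moment_functional s (g * rpoly (P k))) (rpoly (P k)))"
proof -
  obtain c where c: "g = (\<Sum>k\<le>n. smult (c k) (rpoly (P k)))"
    using poly_in_span_of_degrees[of P g n] assms by (auto simp: orthonormal_system_def)
  have "moment_functional s (g * rpoly (P j)) = c j" if "j \<le> n" for j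
  proof -
    have "moment_functional s (g * rpoly (P j)) = (\<Sum>k\<le>n. c k * (if k = j then 1 else 0))"
      unfolding c sum_distrib_right mult_smult_left moment_functional_linear
        orthonormal_system_rpoly[OF assms(1)] ..
    also have "\<dots> = (\<Sum>k\<le>n. if k = j then c k else 0)" by (intro sum.cong) auto
    finally show ?thesis using that by simp
  qed
  thus ?thesis using c by simp
qed

lemma orthonormal_parseval:
  fixes g h :: "'a::real_normed_field poly"
  assumes "orthonormal_system s P" "degree g \<le> n"
  shows "moment_functional s (g * h) = (\<Sum>k\<le>n. moment_functional s (g * rpoly (P k)) * moment_functional s (h * rpoly (P k)))"
proof -
  have "moment_functional s (g * h) =
      moment_functional s ((\<Sum>k\<le>n. smult (moment_functional s (g * rpoly (P k))) (rpoly (P k))) * h)"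
    using orthonormal_expansion[OF assms] by simp
  thus ?thesis by (simp add: sum_distrib_right moment_functional_linear mult.commute[of h])
qed

lemma orthonormal_to_lower_degree:
  fixes g :: "'a::real_normed_field poly"
  assumes "orthonormal_system s P" "degree g < n"
  shows "moment_functional s (rpoly (P n) * g) = 0"
proof -
  have "moment_functional s (g * rpoly (P n)) = 0"
  proof (subst orthonormal_parseval[OF assms(1) order_refl], intro sum.neutral ballI)
    fix k assume "k \<in> {..degree g}"
    thus "moment_functional s (g * rpoly (P k)) * moment_functional s (rpoly (P n) * rpoly (P k)) = 0"
      using assms(2) by (simp add: orthonormal_system_rpoly[OF assms(1)])
  qed
  thus ?thesis by (simp add: mult.commute)
qed

text \<open>Orthogonality to all lower \<open>P k\<close> leaves only the last term in the expansion
  of \<open>Q n\<close>; unit norm gives c^2 = 1, and the positive leading coefficients exclude c =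
  -1.\<close>

lemma orthonormal_system_unique:
  assumes "orthonormal_system s P" "orthonormal_system s Q"
  shows "P = Q"
proof
  fix n
  have deg: "degree (P k) = k" "degree (Q k) = k" for k
    using assms by (auto simp: orthonormal_system_def)
  have low: "moment_functional s (Q n * P k) = 0" if "k < n" for k
    using orthonormal_to_lower_degree[OF assms(2), where g = "P k" and n = n] that deg by simp
  define c where "c = moment_functional s (Q n * P n)"
  have "Q n = (\<Sum>k\<le>n. smult (moment_functional s (Q n * P k)) (P k))"
    using orthonormal_expansion[OF assms(1), of "Q n" n] deg by simp
  also have "\<dots> = smult c (P n)"
    by (subst lessThan_Suc_atMost[symmetric]) (simp add: low c_def)
  finally have Q: "Q n = smult c (P n)" .
  have pos: "coeff (P n) n > 0" "coeff (Q n) n > 0" using assms by (auto simp: orthonormal_system_def)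
  hence "c > 0" using Q by (auto simp: zero_less_mult_iff)
  moreover have "c * c = 1"
  proof -
    have "1 = moment_functional s (Q n * Q n)" using assms(2) by (simp add: orthonormal_system_def)
    also have "\<dots> = c * c * moment_functional s (P n * P n)" by (simp add: Q moment_functional_linear)
    finally show ?thesis using assms(1) by (simp add: orthonormal_system_def)
  qed
  ultimately have "c = 1" using square_eq_1_iff[of c] by auto
  thus "P n = Q n" using Q by simp
qed

section \<open>Measures with moments: polynomial integrals and supports\<close>

text \<open>\<open>Mstar\<close> without the infinite support. For weak limits and competitor
  measures only this has to be checked, since positive definiteness comes with the moments.\<close>

definition has_moments :: "real measure \<Rightarrow> bool" where
  "has_moments \<mu> \<longleftrightarrow> sets \<mu> = sets borel \<and> (\<forall>n::nat. integrable \<mu> (\<lambda>x. x ^ n))"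

lemma has_momentsD:
  assumes "has_moments \<mu>"
  shows "sets \<mu> = sets borel" "space \<mu> = UNIV" "finite_measure \<mu>" "integrable \<mu> (\<lambda>x. x ^ n)"
proof -
  show s: "sets \<mu> = sets borel" and "integrable \<mu> (\<lambda>x. x ^ n)"
    using assms by (auto simp: has_moments_def)
  show sp: "space \<mu> = UNIV" using sets_eq_imp_space_eq[OF s] by simp
  have "integrable \<mu> (\<lambda>x. x ^ 0)" using assms by (auto simp: has_moments_def simp del: power_0)
  hence "(\<integral>\<^sup>+x. ennreal (norm ((x::real) ^ 0)) \<partial>\<mu>) < \<infinity>" by (simp only: integrable_iff_bounded)
  thus "finite_measure \<mu>" by (intro finite_measureI) simp
qed

lemma borel_measurable_has_moments:
  "has_moments \<mu> \<Longrightarrow> f \<in> borel_measurable borel \<Longrightarrow> f \<in> borel_measurable \<mu>"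
  by (simp add: has_momentsD(1) cong: measurable_cong_sets)

lemma borel_measurable_poly [measurable]:
  "(\<lambda>x. poly (p :: 'a::{real_normed_field, second_countable_topology} poly) (of_real x)) \<in> borel_measurable borel"
  by (intro borel_measurable_continuous_onI continuous_intros)

lemma borel_measurable_real_poly [measurable]: "poly (p :: real poly) \<in> borel_measurable borel"
  using borel_measurable_poly[of p] by simp

lemma has_bochner_integral_poly:
  fixes p :: "'a::{real_normed_field, banach, second_countable_topology} poly"
  assumes "has_moments \<mu>"
  shows "has_bochner_integral \<mu> (\<lambda>x. poly p (of_real x)) (moment_functional (moments \<mu>) p)"
proof -
  have "has_bochner_integral \<mu> (\<lambda>x. \<Sum>i\<le>degree p. coeff p i * of_real (x ^ i))
      (\<Sum>i\<le>degree p. coeff p i * of_real (moments \<mu> i))"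
    unfolding moments_def using has_momentsD(4)[OF assms]
    by (intro has_bochner_integral_sum has_bochner_integral_mult_right has_bochner_integral_of_real
        has_bochner_integral_integrable)
  thus ?thesis by (simp add: poly_altdef moment_functional_def)
qed

lemmas integrable_poly = has_bochner_integral_poly[THEN integrable.intros]
lemmas integral_poly = has_bochner_integral_poly[THEN has_bochner_integral_integral_eq]

lemma integrable_real_poly: "has_moments \<mu> \<Longrightarrow> integrable \<mu> (poly (p :: real poly))"
  and integral_real_poly: "has_moments \<mu> \<Longrightarrow> (LINT x|\<mu>. poly p x) = moment_functional (moments \<mu>) p"
  using integrable_poly[of \<mu> p] integral_poly[of \<mu> p] by simp_all

text \<open>The complement of the support is a possibly uncountable union of open null sets; the
  Lindelof property leaves countably many of them.\<close>

lemma null_sets_compl_msupport: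
  assumes "sets \<mu> = sets borel"
  shows "- msupport \<mu> \<in> null_sets \<mu>"
proof -
  define F where "F = {U. open U \<and> emeasure \<mu> U = 0}"
  obtain F' where F': "F' \<subseteq> F" "countable F'" "\<Union>F' = \<Union>F"
    using Lindelof[of F] by (auto simp: F_def)
  have "- msupport \<mu> = \<Union>F" by (auto simp: msupport_def F_def not_gr_zero)
  hence eq: "- msupport \<mu> = (\<Union>U\<in>F'. U)" using F'(3) by simp
  show ?thesis unfolding eq
  proof (rule null_sets_UN'[OF F'(2)])
    fix U assume "U \<in> F'"
    thus "U \<in> null_sets \<mu>" using F'(1) assms by (auto simp: F_def null_sets_def)
  qed
qed

lemma AE_in_msupport: "sets \<mu> = sets borel \<Longrightarrow> AE x in \<mu>. x \<in> msupport \<mu>"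
  using AE_not_in[OF null_sets_compl_msupport] by simp

lemma msupport_subset_closed:
  assumes "sets \<mu> = sets borel" "closed C" "AE x in \<mu>. x \<in> C"
  shows "msupport \<mu> \<subseteq> C"
proof
  fix x assume x: "x \<in> msupport \<mu>"
  show "x \<in> C"
  proof (rule ccontr)
    assume "x \<notin> C"
    hence "emeasure \<mu> (- C) > 0" using x assms(2) by (auto simp: msupport_def)
    moreover have "emeasure \<mu> (- C) = 0"
      using assms sets_eq_imp_space_eq[OF assms(1)]
      by (subst (asm) AE_iff_measurable[of "- C"]) auto
    ultimately show False by simp
  qed
qed

lemma AE_msupport_iff_closed:
  assumes "sets \<mu> = sets borel" "closed C"
  shows "msupport \<mu> \<subseteq> C \<longleftrightarrow> (AE x in \<mu>. x \<in> C)"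
  using msupport_subset_closed[OF assms] AE_in_msupport[OF assms(1)] by fastforce

lemma AE_poly_zero_iff_square:
  assumes "has_moments \<mu>"
  shows "moment_functional (moments \<mu>) (p * p) = 0 \<longleftrightarrow> (AE x in \<mu>. poly p x = 0)"
proof -
  have "moment_functional (moments \<mu>) (p * p) = (LINT x|\<mu>. poly p x * poly p x)"
    using integral_real_poly[OF assms, of "p * p"] by simp
  moreover have "integrable \<mu> (\<lambda>x. poly p x * poly p x)"
    using integrable_real_poly[OF assms, of "p * p"] by (simp add: poly_mult[abs_def])
  ultimately show ?thesis
    by (simp add: integral_nonneg_eq_0_iff_AE)
qed

lemma moment_functional_nonneg:
  assumes "has_moments \<mu>" "AE x in \<mu>. poly p x \<ge> 0"
  shows "moment_functional (moments \<mu>) p \<ge> 0"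
  using integral_nonneg_AE[OF assms(2)] integral_real_poly[OF assms(1), of p] by simp

text \<open>If the square of p integrates to 0, the measure is carried by the finitely many zeros of
  p; conversely a finite support is the zero set of a product of linear factors.\<close>

lemma Mstar_iff_positive_definite:
  "\<mu> \<in> Mstar \<longleftrightarrow> has_moments \<mu> \<and> positive_definite_seq (moments \<mu>)"
proof (cases "has_moments \<mu>")
  case True
  note [simp] = has_momentsD(1)[OF True]
  have "infinite (msupport \<mu>) \<longleftrightarrow> positive_definite_seq (moments \<mu>)"
  proof
    assume inf: "infinite (msupport \<mu>)"
    show "positive_definite_seq (moments \<mu>)"
      unfolding positive_definite_seq_def
    proof (intro allI impI)
      fix p :: "real poly" assume p: "p \<noteq> 0"
      have ge: "moment_functional (moments \<mu>) (p * p) \<ge> 0"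
        by (rule moment_functional_nonneg[OF True]) simp
      have "moment_functional (moments \<mu>) (p * p) \<noteq> 0"
      proof
        assume "moment_functional (moments \<mu>) (p * p) = 0"
        hence "AE x in \<mu>. x \<in> {x. poly p x = 0}" by (simp add: AE_poly_zero_iff_square[OF True])
        hence "msupport \<mu> \<subseteq> {x. poly p x = 0}"
          using p by (intro msupport_subset_closed finite_imp_closed poly_roots_finite) auto
        thus False using inf poly_roots_finite[OF p] finite_subset by blast
      qed
      thus "moment_functional (moments \<mu>) (p * p) > 0" using ge by simp
    qed
  next
    assume pd: "positive_definite_seq (moments \<mu>)"
    show "infinite (msupport \<mu>)"
    proof
      assume fin: "finite (msupport \<mu>)"
      define p where "p = (\<Prod>y\<in>msupport \<mu>. [:-y, 1:])"
      have "p \<noteq> 0" using fin by (simp add: p_def)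
      moreover have "AE x in \<mu>. poly p x = 0"
        using AE_in_msupport[OF has_momentsD(1)[OF True]] by eventually_elim (use fin in \<open>auto simp: p_def poly_prod\<close>)
      ultimately show False
        using pd AE_poly_zero_iff_square[OF True, of p] by (force simp: positive_definite_seq_def)
    qed
  qed
  thus ?thesis using True by (simp add: Mstar_def has_moments_def)
qed (auto simp: Mstar_def has_moments_def)

lemma V_iff: "\<mu> \<in> V s \<longleftrightarrow> has_moments \<mu> \<and> moments \<mu> = s \<and> positive_definite_seq s"
  by (auto simp: V_def Mstar_iff_positive_definite)

lemma V_has_moments: "\<mu> \<in> V s \<Longrightarrow> has_moments \<mu>"
  and V_moments: "\<mu> \<in> V s \<Longrightarrow> moments \<mu> = s"
  by (auto simp: V_iff)

lemma V_same_moments: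
  "\<mu> \<in> V s \<Longrightarrow> has_moments \<nu> \<Longrightarrow> moments \<nu> = s \<Longrightarrow> \<nu> \<in> V s"
  by (auto simp: V_iff)

section \<open>The orthonormal system of a moment sequence\<close>

locale moment_sequence =
  fixes s :: "nat \<Rightarrow> real"
  assumes V_nonempty: "V s \<noteq> {}"
begin

abbreviation "L \<equiv> moment_functional s"
abbreviation "op \<equiv> orthonormal_poly s"

lemma positive_definite: "positive_definite_seq s"
  using V_nonempty by (auto simp: V_iff)

lemma L_square_pos: "(p::real poly) \<noteq> 0 \<Longrightarrow> L (p * p) > 0"
  using positive_definite by (simp add: positive_definite_seq_def)

lemma L_square_nonneg: "L (p * p :: real poly) \<ge> 0"
  using L_square_pos[of p] by (cases "p = 0") (auto intro: less_imp_le)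

text \<open>All members of \<open>V s\<close> integrate polynomials in the same way, so the
  quantifier over measures in \<open>orthonormal_poly\<close> collapses to the functional
  \<open>L\<close>, and the definite description is met by Gram-Schmidt alone.\<close>

lemma orthonormal_poly_system: "orthonormal_system s op"
proof -
  obtain \<mu>0 where \<mu>0: "\<mu>0 \<in> V s" using V_nonempty by auto
  have "((\<forall>n. degree (P n) = n \<and> lead_coeff (P n) > 0) \<and>
     (\<forall>\<mu> \<in> V s. \<forall>m n. (LINT x|\<mu>. poly (P m) x * poly (P n) x) = (if m = n then 1 else 0)))
     \<longleftrightarrow> orthonormal_system s P" for P
  proof -
    have "(LINT x|\<mu>. poly (P m) x * poly (P n) x) = L (P m * P n)" if "\<mu> \<in> V s" for \<mu> m n
      using integral_real_poly[OF V_has_moments[OF that], of "P m * P n"] V_moments[OF that] by simp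
    hence "(\<forall>\<mu> \<in> V s. \<forall>m n. (LINT x|\<mu>. poly (P m) x * poly (P n) x) = (if m = n then 1 else 0)) \<longleftrightarrow>
        (\<forall>m n. L (P m * P n) = (if m = n then 1 else 0))"
      using \<mu>0 by auto
    moreover have "(\<forall>n. degree (P n) = n \<and> lead_coeff (P n) > 0) \<longleftrightarrow> (\<forall>n. degree (P n) = n \<and> coeff (P n) n > 0)"
      by (rule iff_allI) auto
    ultimately show ?thesis unfolding orthonormal_system_def by (rule arg_cong2[where f = "(\<and>)", rotated])
  qed
  hence "op = (THE P. orthonormal_system s P)"
    unfolding orthonormal_poly_def by presburger
  also have "\<dots> = gram_schmidt s"
    using orthonormal_system_exists[OF positive_definite] orthonormal_system_unique
    by (intro the_equality)
  finally show ?thesis using orthonormal_system_exists[OF positive_definite] by simp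
qed

lemma degree_op [simp]: "degree (op n) = n"
  using orthonormal_poly_system by (simp add: orthonormal_system_def)

lemma L_orthonormal:
  "L (rpoly (op m) * rpoly (op n) :: 'a::real_normed_field poly) = (if m = n then 1 else 0)"
  by (rule orthonormal_system_rpoly[OF orthonormal_poly_system])

lemma L_orthonormal_real: "L (op m * op n) = (if m = n then 1 else 0)"
  using L_orthonormal[where 'a = real] by simp

lemmas op_expansion = orthonormal_expansion[OF orthonormal_poly_system]
lemmas op_parseval = orthonormal_parseval[OF orthonormal_poly_system]
lemmas op_orth_lower = orthonormal_to_lower_degree[OF orthonormal_poly_system]

lemma pfun_of_real: "pfun s n (of_real x :: 'a::real_normed_field) = of_real (pfun s n x)"
  by (simp add: pfun_def)

lemma pfun_real: "pfun s n (x::real) = poly (op n) x"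
  by (simp add: pfun_def)

lemma qfun_eq: "qfun s n z = second_kind s (rpoly (op n)) z"
proof -
  define \<mu> where "\<mu> = (SOME \<mu>. \<mu> \<in> V s)"
  have \<mu>: "\<mu> \<in> V s" using V_nonempty unfolding \<mu>_def by (meson all_not_in_conv someI)
  show ?thesis
    using integral_poly[OF V_has_moments[OF \<mu>], of "synthetic_div (rpoly (op n)) z"] V_moments[OF \<mu>]
    unfolding qfun_def \<mu>_def[symmetric] diff_quot_eq_synthetic_div second_kind_def by simp
qed

lemma qfun_of_real:
  "qfun s n (of_real x :: 'a::{real_normed_field, banach, second_countable_topology}) = of_real (qfun s n x)"
  by (simp add: qfun_eq second_kind_of_real)

lemma qfun_0 [simp]: "qfun s 0 z = 0"
proof -
  have "synthetic_div (rpoly (op 0)) z = 0" by (simp add: synthetic_div_eq_0_iff)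
  thus ?thesis by (simp add: qfun_eq second_kind_def)
qed

lemma mass_pos: "s 0 > 0"
  using L_square_pos[of 1] by (simp add: one_pCons)

text \<open>As p_0 is a constant, this reads p_0^2 s_0 = 1; it serves to show that p_0 does not
  vanish.\<close>

lemma L_sum_kernel: "pfun s 0 (x::real) * L (op 0) = 1"
proof -
  obtain a where a: "op 0 = [:a:]" using degree_op[of 0] degree_eq_zeroE by blast
  show ?thesis using L_orthonormal_real[of 0 0] by (simp add: a pfun_def)
qed

end

section \<open>Uniqueness of the Stieltjes transform\<close>

lemma nn_integral_poisson_kernel:
  fixes x y a :: real
  assumes "y > 0"
  shows "(\<integral>\<^sup>+u. ennreal (y / ((x - u)\<^sup>2 + y\<^sup>2)) * indicator {a..} u \<partial>lborel) = ennreal (pi / 2 - arctan ((a - x) / y))"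
proof (rule nn_integral_FTC_atLeast[where F = "\<lambda>u. arctan ((u - x) / y)"])
  show "((\<lambda>u. arctan ((u - x) / y)) \<longlongrightarrow> pi / 2) at_top"
  proof (rule filterlim_compose[OF tendsto_arctan_at_top])
    show "filterlim (\<lambda>u. (u - x) / y) at_top at_top" using assms by real_asymp
  qed
  show "DERIV (\<lambda>u. arctan ((u - x) / y)) u :> y / ((x - u)\<^sup>2 + y\<^sup>2)" for u
  proof -
    have "(x - u)\<^sup>2 + y\<^sup>2 > 0" using assms by (simp add: sum_power2_gt_zero_iff)
    hence "inverse y * inverse (1 + ((u - x) / y)\<^sup>2) = y / ((x - u)\<^sup>2 + y\<^sup>2)"
      using assms by (simp add: field_simps power2_eq_square)
    moreover have "DERIV (\<lambda>u. arctan ((u - x) / y)) u :> inverse y * inverse (1 + ((u - x) / y)\<^sup>2)"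
      using assms by (auto intro!: derivative_eq_intros simp: field_simps)
    ultimately show ?thesis by simp
  qed
qed (use assms in \<open>auto intro!: divide_nonneg_nonneg\<close>)

lemma Im_inverse_diff: "Im (1 / (complex_of_real x - Complex u y)) = y / ((x - u)\<^sup>2 + y\<^sup>2)"
  by (simp add: Im_divide power2_eq_square)

lemma integrable_resolvent:
  assumes "finite_measure \<mu>" "sets \<mu> = sets borel" "Im z \<noteq> 0"
  shows "integrable \<mu> (\<lambda>x. 1 / (complex_of_real x - z))"
proof (rule finite_measure.integrable_const_bound[OF assms(1), where B = "1 / \<bar>Im z\<bar>"])
  have "norm (1 / (complex_of_real x - z)) \<le> 1 / \<bar>Im z\<bar>" for x
    using abs_Im_le_cmod[of "complex_of_real x - z"] assms(3)
    by (simp add: norm_divide frac_le)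
  thus "AE x in \<mu>. norm (1 / (complex_of_real x - z)) \<le> 1 / \<bar>Im z\<bar>" by simp
qed (use assms(2) in simp)

text \<open>Stieltjes inversion: by Fubini the imaginary part of the transform at height y,
  integrated over [a, infinity), is the integral of pi/2 - arctan((a - x)/y). Off x = a this tends
  to pi times the indicator of the half-line as y tends to 0.\<close>

lemma stieltjes_transform_unique:
  assumes fin: "finite_measure \<mu>" "finite_measure \<nu>"
    and sets: "sets \<mu> = sets borel" "sets \<nu> = sets borel"
    and eq: "\<And>z. Im z > 0 \<Longrightarrow> (LINT x|\<mu>. 1 / (complex_of_real x - z)) = (LINT x|\<nu>. 1 / (complex_of_real x - z))"
  shows "\<mu> = \<nu>"
proof (rule measure_eqI_lessThan[OF sets])
  define I where "I M y a = (\<integral>\<^sup>+x. ennreal (pi / 2 - arctan ((a - x) / y)) \<partial>M)" for M and y a :: real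
  have fub: "I M y a = (\<integral>\<^sup>+u. ennreal (Im (LINT x|M. 1 / (complex_of_real x - Complex u y))) * indicator {a..} u \<partial>lborel)"
    if M: "finite_measure M" "sets M = sets borel" and y: "y > 0" for M and y a :: real
  proof -
    interpret finite_measure M by fact
    interpret pair_sigma_finite M lborel
      by (intro pair_sigma_finite.intro sigma_finite_measure_axioms sigma_finite_lborel)
    have [measurable_cong]: "sets M = sets borel" by fact
    have "I M y a = (\<integral>\<^sup>+x. (\<integral>\<^sup>+u. ennreal (y / ((x - u)\<^sup>2 + y\<^sup>2)) * indicator {a..} u \<partial>lborel) \<partial>M)"
      unfolding I_def nn_integral_poisson_kernel[OF y] ..
    also have "\<dots> = (\<integral>\<^sup>+u. (\<integral>\<^sup>+x. ennreal (y / ((x - u)\<^sup>2 + y\<^sup>2)) * indicator {a..} u \<partial>M) \<partial>lborel)"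
      by (rule Fubini'[symmetric]) measurable
    also have "\<dots> = (\<integral>\<^sup>+u. ennreal (Im (LINT x|M. 1 / (complex_of_real x - Complex u y))) * indicator {a..} u \<partial>lborel)"
    proof (intro nn_integral_cong)
      fix u :: real
      have int: "integrable M (\<lambda>x. 1 / (complex_of_real x - Complex u y))"
        using M y by (intro integrable_resolvent) auto
      have "(\<integral>\<^sup>+x. ennreal (y / ((x - u)\<^sup>2 + y\<^sup>2)) \<partial>M) = ennreal (LINT x|M. y / ((x - u)\<^sup>2 + y\<^sup>2))"
        using integrable_Im[OF int] y unfolding Im_inverse_diff
        by (intro nn_integral_eq_integral) (auto intro!: divide_nonneg_nonneg)
      also have "\<dots> = ennreal (Im (LINT x|M. 1 / (complex_of_real x - Complex u y)))"
        using integral_Im[OF int] unfolding Im_inverse_diff by simp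
      finally show "(\<integral>\<^sup>+x. ennreal (y / ((x - u)\<^sup>2 + y\<^sup>2)) * indicator {a..} u \<partial>M) =
        ennreal (Im (LINT x|M. 1 / (complex_of_real x - Complex u y))) * indicator {a..} u"
        by (simp add: nn_integral_multc)
    qed
    finally show ?thesis .
  qed
  have I_eq: "I \<mu> y a = I \<nu> y a" if "y > 0" for y a
    using fub[OF fin(1) sets(1) that, of a] fub[OF fin(2) sets(2) that, of a] eq[of "Complex _ y"] that by simp
  \<comment> \<open>The left end point approaches a at distance 1/(n+1), much more slowly than the
    height 1/(n+1)^2 shrinks. At x = a the arctangent then tends to pi/2, so an atom at a
    contributes nothing instead of half its mass, and the limit is the open half-line.\<close>
  have lim: "(\<lambda>n. I M (1 / (real n + 1)\<^sup>2) (a + 1 / (real n + 1))) \<longlonglongrightarrow> ennreal pi * emeasure M {a<..}"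
    if M: "finite_measure M" "sets M = sets borel" for M a
  proof -
    interpret finite_measure M by fact
    have [measurable_cong]: "sets M = sets borel" by fact
    have "(\<lambda>n. I M (1 / (real n + 1)\<^sup>2) (a + 1 / (real n + 1))) \<longlonglongrightarrow> (\<integral>\<^sup>+x. ennreal pi * indicator {a<..} x \<partial>M)"
      unfolding I_def
    proof (rule nn_integral_dominated_convergence[where w = "\<lambda>_. ennreal pi"])
      show "AE x in M. ennreal (pi / 2 - arctan ((a + 1 / (real n + 1) - x) / (1 / (real n + 1)\<^sup>2))) \<le> ennreal pi" for n
      proof (intro AE_I2 ennreal_leI)
        show "pi / 2 - arctan y \<le> pi" for y using arctan_lbound[of y] by simp
      qed
      show "(\<integral>\<^sup>+x. ennreal pi \<partial>M) < \<infinity>"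
        by (simp add: ennreal_mult_less_top emeasure_eq_measure)
      show "AE x in M. (\<lambda>n. ennreal (pi / 2 - arctan ((a + 1 / (real n + 1) - x) / (1 / (real n + 1)\<^sup>2)))) \<longlonglongrightarrow> ennreal pi * indicator {a<..} x"
      proof (rule AE_I2)
        fix x
        show "(\<lambda>n. ennreal (pi / 2 - arctan ((a + 1 / (real n + 1) - x) / (1 / (real n + 1)\<^sup>2)))) \<longlonglongrightarrow> ennreal pi * indicator {a<..} x"
        proof (cases "x > a")
          case True
          have "filterlim (\<lambda>n. (a + 1 / (real n + 1) - x) / (1 / (real n + 1)\<^sup>2)) at_bot sequentially"
            using True by real_asymp
          from filterlim_compose[OF tendsto_arctan_at_bot this]
          have "(\<lambda>n. pi / 2 - arctan ((a + 1 / (real n + 1) - x) / (1 / (real n + 1)\<^sup>2))) \<longlonglongrightarrow> pi / 2 - (- (pi / 2))"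
            by (intro tendsto_intros)
          thus ?thesis using True by (intro tendsto_ennrealI[THEN tendsto_eq_rhs]) auto
        next
          case False
          have "filterlim (\<lambda>n. (a + 1 / (real n + 1) - x) / (1 / (real n + 1)\<^sup>2)) at_top sequentially"
          proof (cases "x = a")
            case True thus ?thesis by simp real_asymp
          next
            case False
            with \<open>\<not> x > a\<close> have "x < a" by simp
            thus ?thesis by real_asymp
          qed
          from filterlim_compose[OF tendsto_arctan_at_top this]
          have "(\<lambda>n. pi / 2 - arctan ((a + 1 / (real n + 1) - x) / (1 / (real n + 1)\<^sup>2))) \<longlonglongrightarrow> pi / 2 - pi / 2"
            by (intro tendsto_intros)
          thus ?thesis using False by (intro tendsto_ennrealI[THEN tendsto_eq_rhs]) auto
        qed
      qed
    qed measurable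
    also have "(\<integral>\<^sup>+x. ennreal pi * indicator {a<..} x \<partial>M) = ennreal pi * emeasure M {a<..}"
      by (simp add: nn_integral_cmult_indicator)
    finally show ?thesis .
  qed
  show "emeasure \<mu> {a<..} < \<infinity>" for a
    using finite_measure.emeasure_finite[OF fin(1)] by (simp add: less_top)
  show "emeasure \<mu> {a<..} = emeasure \<nu> {a<..}" for a
  proof -
    have "ennreal pi * emeasure \<mu> {a<..} = ennreal pi * emeasure \<nu> {a<..}"
    proof (rule LIMSEQ_unique[OF lim[OF fin(1) sets(1)]])
      have "I \<mu> (1 / (real n + 1)\<^sup>2) (a + 1 / (real n + 1)) = I \<nu> (1 / (real n + 1)\<^sup>2) (a + 1 / (real n + 1))" for n
        by (rule I_eq) simp
      thus "(\<lambda>n. I \<mu> (1 / (real n + 1)\<^sup>2) (a + 1 / (real n + 1))) \<longlonglongrightarrow> ennreal pi * emeasure \<nu> {a<..}"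
        using lim[OF fin(2) sets(2), of a] by presburger
    qed
    thus ?thesis by (simp add: ennreal_mult_cancel_left)
  qed
qed

section \<open>Square integrable functions and Bessel's inequality\<close>

definition sq_integrable :: "real measure \<Rightarrow> (real \<Rightarrow> real) \<Rightarrow> bool" where
  "sq_integrable \<mu> f \<longleftrightarrow> f \<in> borel_measurable \<mu> \<and> integrable \<mu> (\<lambda>x. (f x)\<^sup>2)"

lemma sq_integrable_mult:
  assumes "sq_integrable \<mu> f" "sq_integrable \<mu> g"
  shows "integrable \<mu> (\<lambda>x. f x * g x)"
proof (rule Bochner_Integration.integrable_bound)
  show "integrable \<mu> (\<lambda>x. (f x)\<^sup>2 + (g x)\<^sup>2)" using assms by (auto simp: sq_integrable_def)
  show "(\<lambda>x. f x * g x) \<in> borel_measurable \<mu>" using assms by (auto simp: sq_integrable_def)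
  have "\<bar>a * b\<bar> \<le> a\<^sup>2 + b\<^sup>2" for a b :: real
  proof -
    have "2 * (\<bar>a\<bar> * \<bar>b\<bar>) \<le> a\<^sup>2 + b\<^sup>2" using sum_squares_bound[of "\<bar>a\<bar>" "\<bar>b\<bar>"] by simp
    moreover have "0 \<le> \<bar>a\<bar> * \<bar>b\<bar>" by simp
    ultimately show ?thesis unfolding abs_mult by linarith
  qed
  thus "AE x in \<mu>. norm (f x * g x) \<le> norm ((f x)\<^sup>2 + (g x)\<^sup>2)" by simp
qed

lemma sq_integrable_add:
  assumes "sq_integrable \<mu> f" "sq_integrable \<mu> g"
  shows "sq_integrable \<mu> (\<lambda>x. f x + g x)"
proof -
  have "integrable \<mu> (\<lambda>x. (f x)\<^sup>2 + 2 * (f x * g x) + (g x)\<^sup>2)"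
    using assms sq_integrable_mult[OF assms] by (auto simp: sq_integrable_def)
  thus ?thesis using assms by (auto simp: sq_integrable_def power2_sum algebra_simps)
qed

lemma sq_integrable_uminus: "sq_integrable \<mu> f \<Longrightarrow> sq_integrable \<mu> (\<lambda>x. - f x)"
  by (auto simp: sq_integrable_def)

lemma sq_integrable_diff:
  "sq_integrable \<mu> f \<Longrightarrow> sq_integrable \<mu> g \<Longrightarrow> sq_integrable \<mu> (\<lambda>x. f x - g x)"
  using sq_integrable_add[of \<mu> f "\<lambda>x. - g x"] sq_integrable_uminus[of \<mu> g] by simp

lemma sq_integrable_cmult: "sq_integrable \<mu> f \<Longrightarrow> sq_integrable \<mu> (\<lambda>x. c * f x)"
  by (auto simp: sq_integrable_def power_mult_distrib)

lemma sq_integrable_poly: "has_moments \<mu> \<Longrightarrow> sq_integrable \<mu> (poly p)"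
proof -
  assume "has_moments \<mu>"
  moreover have "(\<lambda>x. (poly p x)\<^sup>2) = poly (p * p)" by (simp add: fun_eq_iff power2_eq_square)
  ultimately show "sq_integrable \<mu> (poly p)"
    using integrable_real_poly[of \<mu> "p * p"] borel_measurable_has_moments[OF _ borel_measurable_real_poly]
    by (simp add: sq_integrable_def)
qed

lemma sq_integrable_bounded:
  assumes "has_moments \<mu>" "f \<in> borel_measurable borel" "\<And>x. \<bar>f x\<bar> \<le> B"
  shows "sq_integrable \<mu> f"
proof -
  have "norm ((f x)\<^sup>2) \<le> B\<^sup>2" for x
    using power_mono[OF assms(3)[of x], of 2] by simp
  thus ?thesis
    using assms borel_measurable_has_moments[OF assms(1,2)]
    by (auto simp: sq_integrable_def intro!: finite_measure.integrable_const_bound[OF has_momentsD(3), where B = "B\<^sup>2"])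
qed

text \<open>Cauchy-Schwarz against the constant 1, from the nonnegative integral of
  \<open>(m * \<bar>f x\<bar> - c)\<^sup>2\<close>. A factor m has to be cancelled at the end, which
  is why mass 0 is treated separately.\<close>

lemma integral_abs_square_le:
  assumes "has_moments \<mu>" "sq_integrable \<mu> f"
  shows "(LINT x|\<mu>. \<bar>f x\<bar>)\<^sup>2 \<le> moments \<mu> 0 * (LINT x|\<mu>. (f x)\<^sup>2)"
proof -
  define m where "m = moments \<mu> 0"
  define c where "c = (LINT x|\<mu>. \<bar>f x\<bar>)"
  interpret finite_measure \<mu> by (rule has_momentsD(3)[OF assms(1)])
  have m: "m = measure \<mu> (space \<mu>)" by (simp add: m_def moments_def)
  have 1: "sq_integrable \<mu> (\<lambda>x. \<bar>f x\<bar>)" using assms(2) by (auto simp: sq_integrable_def)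
  have i1: "integrable \<mu> (\<lambda>x. \<bar>f x\<bar>)"
    using sq_integrable_mult[OF 1 sq_integrable_poly[OF assms(1), of 1]] by simp
  have i2: "integrable \<mu> (\<lambda>x. (f x)\<^sup>2)" using assms(2) by (simp add: sq_integrable_def)
  have "0 \<le> (LINT x|\<mu>. (m * \<bar>f x\<bar> - c)\<^sup>2)" by simp
  also have "\<dots> = (LINT x|\<mu>. m\<^sup>2 * (f x)\<^sup>2 - 2 * m * c * \<bar>f x\<bar> + c\<^sup>2)"
    by (simp add: power2_diff power_mult_distrib algebra_simps)
  also have "\<dots> = m\<^sup>2 * (LINT x|\<mu>. (f x)\<^sup>2) - 2 * m * c * c + c\<^sup>2 * m"
    using i1 i2 by (simp add: m c_def)
  also have "\<dots> = m * (m * (LINT x|\<mu>. (f x)\<^sup>2) - c\<^sup>2)" by (simp add: power2_eq_square algebra_simps)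
  finally have *: "0 \<le> m * (m * (LINT x|\<mu>. (f x)\<^sup>2) - c\<^sup>2)" .
  have "m \<ge> 0" by (simp add: m)
  show ?thesis
  proof (cases "m = 0")
    case True
    hence "emeasure \<mu> (space \<mu>) = 0" by (simp add: m emeasure_eq_measure)
    hence "AE x in \<mu>. False" by (subst AE_iff_measurable[OF _ refl]) auto
    hence "c = 0" unfolding c_def by (intro integral_eq_zero_AE) auto
    thus ?thesis using True by (simp add: m_def c_def)
  next
    case False
    with \<open>m \<ge> 0\<close> * have "0 \<le> m * (LINT x|\<mu>. (f x)\<^sup>2) - c\<^sup>2" by (simp add: zero_le_mult_iff)
    thus ?thesis by (simp add: m_def c_def)
  qed
qed

section \<open>Bessel's inequality and the Fourier coefficients of the resolvent\<close>

context moment_sequence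
begin

text \<open>Pythagoras in Fourier coefficients. Only the last sum depends on p, so the partial
  Fourier sums are the best approximations; Bessel's inequality and \<open>kpoly_tendsto_L2\<close>
  both rest on this.\<close>

lemma integral_diff_poly_square:
  assumes \<mu>: "\<mu> \<in> V s" and f: "sq_integrable \<mu> f" and deg: "degree p \<le> n"
  defines "c \<equiv> \<lambda>k. (LINT x|\<mu>. f x * poly (op k) x)"
  shows "(LINT x|\<mu>. (f x - poly p x)\<^sup>2) =
    (LINT x|\<mu>. (f x)\<^sup>2) - (\<Sum>k\<le>n. (c k)\<^sup>2) + (\<Sum>k\<le>n. (c k - L (p * op k))\<^sup>2)"
proof -
  note hm = V_has_moments[OF \<mu>]
  define d where "d k = L (p * op k)" for k
  have p: "p = (\<Sum>k\<le>n. smult (d k) (op k))"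
    using op_expansion[OF deg] by (simp add: d_def)
  have fp: "(LINT x|\<mu>. f x * poly p x) = (\<Sum>k\<le>n. d k * c k)"
  proof -
    have "f x * poly p x = (\<Sum>k\<le>n. d k * (f x * poly (op k) x))" for x
      by (subst p) (simp add: poly_sum sum_distrib_left algebra_simps)
    thus ?thesis unfolding c_def
      using sq_integrable_mult[OF f sq_integrable_poly[OF hm]] by simp
  qed
  have pp: "(LINT x|\<mu>. (poly p x)\<^sup>2) = (\<Sum>k\<le>n. (d k)\<^sup>2)"
    using integral_real_poly[OF hm, of "p * p"] op_parseval[OF deg, of p] V_moments[OF \<mu>]
    by (simp add: power2_eq_square d_def)
  have "(LINT x|\<mu>. (f x - poly p x)\<^sup>2) = (LINT x|\<mu>. (f x)\<^sup>2 - 2 * (f x * poly p x) + (poly p x)\<^sup>2)"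
    by (simp add: power2_diff algebra_simps)
  also have "\<dots> = (LINT x|\<mu>. (f x)\<^sup>2) - 2 * (LINT x|\<mu>. f x * poly p x) + (LINT x|\<mu>. (poly p x)\<^sup>2)"
    using f sq_integrable_poly[OF hm, of p] sq_integrable_mult[OF f sq_integrable_poly[OF hm, of p]]
    by (simp add: sq_integrable_def)
  also have "\<dots> = (LINT x|\<mu>. (f x)\<^sup>2) - (\<Sum>k\<le>n. (c k)\<^sup>2) + (\<Sum>k\<le>n. (c k - d k)\<^sup>2)"
    unfolding fp pp by (simp add: power2_diff sum.distrib sum_subtractf sum_distrib_left algebra_simps)
  finally show ?thesis by (simp add: d_def)
qed

lemma bessel_inequality:
  assumes \<mu>: "\<mu> \<in> V s" and f: "sq_integrable \<mu> f"
  shows "(\<Sum>k\<le>n. (LINT x|\<mu>. f x * poly (op k) x)\<^sup>2) \<le> (LINT x|\<mu>. (f x)\<^sup>2)"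
proof -
  define c where "c k = (LINT x|\<mu>. f x * poly (op k) x)" for k
  define p where "p = (\<Sum>k\<le>n. smult (c k) (op k))"
  have deg: "degree p \<le> n" unfolding p_def
    by (intro degree_sum_le) (auto intro: order_trans[OF degree_smult_le])
  have "L (p * op k) = c k" if "k \<le> n" for k
    using that unfolding p_def
    by (simp add: sum_distrib_right moment_functional_linear L_orthonormal_real if_distrib[of "\<lambda>x. _ * x"] cong: if_cong)
  hence "(\<Sum>k\<le>n. (c k - L (p * op k))\<^sup>2) = 0" by simp
  hence "(LINT x|\<mu>. (f x - poly p x)\<^sup>2) = (LINT x|\<mu>. (f x)\<^sup>2) - (\<Sum>k\<le>n. (c k)\<^sup>2)"
    using integral_diff_poly_square[OF \<mu> f deg] by (simp add: c_def)
  moreover have "(LINT x|\<mu>. (f x - poly p x)\<^sup>2) \<ge> 0" by simp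
  ultimately show ?thesis by (simp add: c_def)
qed

text \<open>Splitting off the value of p at z leaves the divided difference, which is a polynomial.
  For p = p_k the result is the Fourier coefficient q_k(z) + w p_k(z) of the resolvent.\<close>

lemma op_resolvent:
  assumes \<mu>: "\<mu> \<in> V s" and z: "Im z \<noteq> 0"
  shows "integrable \<mu> (\<lambda>x. complex_of_real (poly p x) / (of_real x - z))"
    and "(LINT x|\<mu>. complex_of_real (poly p x) / (of_real x - z)) =
      second_kind s (rpoly p) z + poly (rpoly p) z * (LINT x|\<mu>. 1 / (complex_of_real x - z))"
proof -
  note hm = V_has_moments[OF \<mu>]
  have eq: "complex_of_real (poly p x) / (of_real x - z) =
      poly (synthetic_div (rpoly p) z) (of_real x) + poly (rpoly p) z * (1 / (of_real x - z))" for x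
  proof -
    have "of_real x - z \<noteq> 0" using z by (auto simp: complex_eq_iff)
    thus ?thesis
      using poly_eq_synthetic_div[of "rpoly p" "of_real x" z] by (simp add: field_simps)
  qed
  note int = integrable_resolvent[OF has_momentsD(3,1)[OF hm] z]
  show "integrable \<mu> (\<lambda>x. complex_of_real (poly p x) / (of_real x - z))"
    unfolding eq using int integrable_poly[OF hm] by (intro Bochner_Integration.integrable_add integrable_mult_right)
  show "(LINT x|\<mu>. complex_of_real (poly p x) / (of_real x - z)) =
      second_kind s (rpoly p) z + poly (rpoly p) z * (LINT x|\<mu>. 1 / (complex_of_real x - z))"
    unfolding eq using int integrable_poly[OF hm] integral_poly[OF hm] V_moments[OF \<mu>]
    by (subst Bochner_Integration.integral_add)
      (auto simp: second_kind_def simp del: times_divide_eq_right intro!: integrable_mult_right)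
qed

lemma bessel_inequality_complex:
  fixes g :: "real \<Rightarrow> complex"
  assumes \<mu>: "\<mu> \<in> V s" and u: "sq_integrable \<mu> (\<lambda>x. Re (g x))" and v: "sq_integrable \<mu> (\<lambda>x. Im (g x))"
    and int: "\<And>k. integrable \<mu> (\<lambda>x. of_real (poly (op k) x) * g x)"
  shows "(\<Sum>k\<le>n. (norm (LINT x|\<mu>. of_real (poly (op k) x) * g x))\<^sup>2) \<le> (LINT x|\<mu>. (norm (g x))\<^sup>2)"
proof -
  have c: "(norm (LINT x|\<mu>. of_real (poly (op k) x) * g x))\<^sup>2 =
      (LINT x|\<mu>. Re (g x) * poly (op k) x)\<^sup>2 + (LINT x|\<mu>. Im (g x) * poly (op k) x)\<^sup>2" for k
    unfolding cmod_power2 using integral_Re[OF int[of k]] integral_Im[OF int[of k]] by (simp add: mult.commute)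
  have "(\<Sum>k\<le>n. (norm (LINT x|\<mu>. of_real (poly (op k) x) * g x))\<^sup>2) \<le>
      (LINT x|\<mu>. (Re (g x))\<^sup>2) + (LINT x|\<mu>. (Im (g x))\<^sup>2)"
    unfolding c sum.distrib by (intro add_mono bessel_inequality[OF \<mu>] u v)
  also have "\<dots> = (LINT x|\<mu>. (norm (g x))\<^sup>2)"
    unfolding cmod_power2 using u v by (simp add: sq_integrable_def)
  finally show ?thesis .
qed

text \<open>These are the Fourier coefficients of the bounded function 1 / (x - z). Two solutions
  with different w will then bound p_k(z) and q_k(z) separately.\<close>

lemma bessel_resolvent:
  assumes \<mu>: "\<mu> \<in> V s" and z: "Im z \<noteq> 0"
  defines "w \<equiv> LINT x|\<mu>. 1 / (complex_of_real x - z)"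
  shows "summable (\<lambda>k. (norm (qfun s k z + w * pfun s k z))\<^sup>2)"
proof -
  note hm = V_has_moments[OF \<mu>]
  define g where "g x = 1 / (complex_of_real x - z)" for x
  have bd: "norm (g x) \<le> 1 / \<bar>Im z\<bar>" for x
    using abs_Im_le_cmod[of "complex_of_real x - z"] z by (simp add: g_def norm_divide frac_le)
  have [measurable]: "g \<in> borel_measurable borel" unfolding g_def by measurable
  have u: "sq_integrable \<mu> (\<lambda>x. Re (g x))"
    using order_trans[OF abs_Re_le_cmod bd] by (intro sq_integrable_bounded[OF hm, where B = "1 / \<bar>Im z\<bar>"]) auto
  have v: "sq_integrable \<mu> (\<lambda>x. Im (g x))"
    using order_trans[OF abs_Im_le_cmod bd] by (intro sq_integrable_bounded[OF hm, where B = "1 / \<bar>Im z\<bar>"]) auto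
  have int: "integrable \<mu> (\<lambda>x. of_real (poly (op k) x) * g x)"
    and c: "qfun s k z + w * pfun s k z = (LINT x|\<mu>. of_real (poly (op k) x) * g x)" for k
    using op_resolvent[OF \<mu> z, of "op k"] by (simp_all add: qfun_eq pfun_def w_def g_def mult.commute)
  show ?thesis
  proof (rule summableI_nonneg_bounded)
    fix n
    have "(\<Sum>k<n. (norm (qfun s k z + w * pfun s k z))\<^sup>2) \<le> (\<Sum>k\<le>n. (norm (qfun s k z + w * pfun s k z))\<^sup>2)"
      by (intro sum_mono2) auto
    also have "\<dots> \<le> (LINT x|\<mu>. (norm (g x))\<^sup>2)"
      unfolding c by (rule bessel_inequality_complex[OF \<mu> u v int])
    finally show "(\<Sum>k<n. (norm (qfun s k z + w * pfun s k z))\<^sup>2) \<le> (LINT x|\<mu>. (norm (g x))\<^sup>2)" .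
  qed auto
qed

text \<open>A Christoffel-Darboux formula free of recurrence coefficients. To test the quotient g
  against p_k, write p_k as (x - z) h + p_k(z): then (x - z) g = p_n - p_n(z), and p_n h integrates
  to 0 because h has degree below n.\<close>

lemma synthetic_div_op:
  fixes z :: "'a::{real_normed_field, banach, second_countable_topology}"
  shows "synthetic_div (rpoly (op n)) z =
    (\<Sum>k<n. smult (pfun s k z * qfun s n z - pfun s n z * qfun s k z) (rpoly (op k)))"
proof (cases "n = 0")
  case True
  thus ?thesis by (simp add: synthetic_div_eq_0_iff)
next
  case False
  let ?P = "\<lambda>k. rpoly (op k) :: 'a poly"
  define g where "g = synthetic_div (?P n) z"
  have dg: "degree g \<le> n - 1" by (simp add: g_def degree_synthetic_div)
  have ng: "[:-z, 1:] * g = ?P n - [:pfun s n z:]"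
    using synthetic_div_correct'[of z "?P n"] by (simp add: g_def pfun_def eq_diff_eq)
  have coeff: "L (g * ?P k) = pfun s k z * qfun s n z - pfun s n z * qfun s k z" if "k < n" for k
  proof -
    define h where "h = synthetic_div (?P k) z"
    have "?P k = [:-z, 1:] * h + [:pfun s k z:]"
      using synthetic_div_correct'[of z "?P k"] by (simp only: h_def pfun_def)
    hence "g * ?P k = ([:-z, 1:] * g) * h + smult (pfun s k z) g"
      by (simp only: distrib_left mult_ac) simp
    also have "\<dots> = ?P n * h - smult (pfun s n z) h + smult (pfun s k z) g"
      by (simp only: ng left_diff_distrib) simp
    finally have "L (g * ?P k) = L (?P n * h) - pfun s n z * L h + pfun s k z * L g"
      by (simp add: moment_functional_linear)
    moreover have "L (?P n * h) = 0"
      using that by (intro op_orth_lower) (simp add: h_def degree_synthetic_div)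
    ultimately show ?thesis by (simp add: h_def g_def qfun_eq second_kind_def)
  qed
  have "{..n - 1} = {..<n}" using False by auto
  thus ?thesis using op_expansion[OF dg] coeff by (simp add: g_def)
qed

text \<open>Variation of constants. As the sum stops before n, this is a discrete Volterra equation
  for the values at z, with a kernel of rank two in the values at z0.\<close>

lemma pfun_shift:
  fixes z z0 :: "'a::{real_normed_field, banach, second_countable_topology}"
  shows "pfun s n z = pfun s n z0 + (z - z0) *
    (\<Sum>k<n. (pfun s k z0 * qfun s n z0 - pfun s n z0 * qfun s k z0) * pfun s k z)"
  using poly_eq_synthetic_div[of "rpoly (op n)" z z0]
  by (simp add: synthetic_div_op poly_sum pfun_def algebra_simps)

lemma qfun_shift:
  fixes z z0 :: "'a::{real_normed_field, banach, second_countable_topology}"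
  shows "qfun s n z = qfun s n z0 + (z - z0) *
    (\<Sum>k<n. (pfun s k z0 * qfun s n z0 - pfun s n z0 * qfun s k z0) * qfun s k z)"
proof -
  let ?g = "synthetic_div (rpoly (op n)) z0"
  have "second_kind s ([:-z0, 1:] * ?g + [:poly (rpoly (op n)) z0:]) z = L ?g + (z - z0) * second_kind s ?g z"
    by (simp only: second_kind_def synthetic_div_add moment_functional_add synthetic_div_linear_mult
        moment_functional_smult synthetic_div_pCons) simp
  hence "qfun s n z = qfun s n z0 + (z - z0) * second_kind s ?g z"
    unfolding synthetic_div_correct' by (simp add: qfun_eq second_kind_def)
  also have "second_kind s ?g z =
      (\<Sum>k<n. (pfun s k z0 * qfun s n z0 - pfun s n z0 * qfun s k z0) * qfun s k z)"
    by (simp add: synthetic_div_op second_kind_sum second_kind_smult qfun_eq)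
  finally show ?thesis .
qed

end

section \<open>Square summability of p_k(z) and q_k(z) in the indeterminate case\<close>

text \<open>Passing from n to n + 1 multiplies the left side by at most 1 + 2 c_n^2, because (1 +
  sqrt S)^2 <= 2 (1 + S); then 1 + t <= exp t.\<close>

lemma discrete_gronwall:
  fixes u c :: "nat \<Rightarrow> real"
  assumes "\<And>n. 0 \<le> u n" "\<And>n. u n \<le> c n * (1 + sqrt (\<Sum>k<n. (u k)\<^sup>2))"
  shows "1 + (\<Sum>k<n. (u k)\<^sup>2) \<le> exp (2 * (\<Sum>k<n. (c k)\<^sup>2))"
proof (induction n)
  case (Suc n)
  define S where "S = (\<Sum>k<n. (u k)\<^sup>2)"
  have S: "S \<ge> 0" by (simp add: S_def sum_nonneg)
  have "(u n)\<^sup>2 \<le> (c n * (1 + sqrt S))\<^sup>2"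
    using assms(1)[of n] assms(2)[of n] by (intro power_mono) (auto simp: S_def)
  also have "\<dots> \<le> (c n)\<^sup>2 * (2 * (1 + S))"
  proof -
    have "(1 + sqrt S)\<^sup>2 \<le> 2 * (1 + S)"
      using sum_squares_bound[of 1 "sqrt S"] S by (simp add: power2_sum)
    thus ?thesis by (simp add: power_mult_distrib mult_left_mono)
  qed
  finally have "1 + (S + (u n)\<^sup>2) \<le> (1 + S) * (1 + 2 * (c n)\<^sup>2)" by (simp add: algebra_simps)
  also have "\<dots> \<le> exp (2 * (\<Sum>k<n. (c k)\<^sup>2)) * exp (2 * (c n)\<^sup>2)"
    using Suc S by (intro mult_mono exp_ge_add_one_self) (auto simp: S_def)
  also have "\<dots> = exp (2 * (\<Sum>k<Suc n. (c k)\<^sup>2))" by (simp add: exp_add algebra_simps)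
  finally show ?case by (simp add: S_def)
qed simp

locale indeterminate_sequence = moment_sequence +
  assumes not_unique: "\<exists>\<mu>\<in>V s. \<exists>\<nu>\<in>V s. \<mu> \<noteq> \<nu>"
begin

text \<open>Distinct solutions have transforms that differ at some z in the upper half-plane.
  Subtracting their square summable sequences q_k + w p_k leaves a nonzero multiple of p_k(z), and
  q_k(z) follows.\<close>

lemma square_summable_at_point:
  obtains z :: complex where "summable (\<lambda>k. (norm (pfun s k z))\<^sup>2)" "summable (\<lambda>k. (norm (qfun s k z))\<^sup>2)"
proof -
  obtain \<mu> \<nu> where m: "\<mu> \<in> V s" "\<nu> \<in> V s" "\<mu> \<noteq> \<nu>" using not_unique by blast
  define W where "W M z = (LINT x|M. 1 / (complex_of_real x - z))" for M z
  obtain z where z: "Im z > 0" and ne: "W \<mu> z \<noteq> W \<nu> z"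
    using stieltjes_transform_unique[of \<mu> \<nu>] m has_momentsD(1,3)[OF V_has_moments] by (auto simp: W_def)
  have sum: "summable (\<lambda>k. (norm (qfun s k z + W M z * pfun s k z))\<^sup>2)" if "M \<in> V s" for M
    unfolding W_def using z that by (intro bessel_resolvent) auto
  have sq: "(norm (a - b))\<^sup>2 \<le> 2 * ((norm a)\<^sup>2 + (norm b)\<^sup>2)" for a b :: complex
  proof -
    have "(norm (a - b))\<^sup>2 \<le> (norm a + norm b)\<^sup>2" by (intro power_mono norm_triangle_ineq4) auto
    also have "\<dots> \<le> 2 * ((norm a)\<^sup>2 + (norm b)\<^sup>2)"
      using sum_squares_bound[of "norm a" "norm b"] by (simp add: power2_sum)
    finally show ?thesis .
  qed
  define d where "d = (norm (W \<mu> z - W \<nu> z))\<^sup>2"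
  have d: "d > 0" using ne by (simp add: d_def)
  have p: "summable (\<lambda>k. (norm (pfun s k z))\<^sup>2)"
  proof (rule summable_comparison_test')
    show "summable (\<lambda>k. 2 / d * ((norm (qfun s k z + W \<mu> z * pfun s k z))\<^sup>2 + (norm (qfun s k z + W \<nu> z * pfun s k z))\<^sup>2))"
      using sum m by (intro summable_mult summable_add) auto
    fix k :: nat
    have "d * (norm (pfun s k z))\<^sup>2 = (norm ((qfun s k z + W \<mu> z * pfun s k z) - (qfun s k z + W \<nu> z * pfun s k z)))\<^sup>2"
      by (simp add: d_def norm_mult[symmetric] power_mult_distrib[symmetric] left_diff_distrib)
    also have "\<dots> \<le> 2 * ((norm (qfun s k z + W \<mu> z * pfun s k z))\<^sup>2 + (norm (qfun s k z + W \<nu> z * pfun s k z))\<^sup>2)"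
      by (rule sq)
    finally show "norm ((norm (pfun s k z))\<^sup>2) \<le>
        2 / d * ((norm (qfun s k z + W \<mu> z * pfun s k z))\<^sup>2 + (norm (qfun s k z + W \<nu> z * pfun s k z))\<^sup>2)"
      using d by (simp add: field_simps)
  qed
  have q: "summable (\<lambda>k. (norm (qfun s k z))\<^sup>2)"
  proof (rule summable_comparison_test')
    show "summable (\<lambda>k. 2 * ((norm (qfun s k z + W \<mu> z * pfun s k z))\<^sup>2 + (norm (W \<mu> z))\<^sup>2 * (norm (pfun s k z))\<^sup>2))"
      using sum m p by (intro summable_mult summable_add) auto
    show "norm ((norm (qfun s k z))\<^sup>2) \<le>
        2 * ((norm (qfun s k z + W \<mu> z * pfun s k z))\<^sup>2 + (norm (W \<mu> z))\<^sup>2 * (norm (pfun s k z))\<^sup>2)" for k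
      using sq[of "qfun s k z + W \<mu> z * pfun s k z" "W \<mu> z * pfun s k z"]
      by (simp add: norm_mult power_mult_distrib)
  qed
  show ?thesis using that p q by blast
qed

text \<open>Square summability spreads from the single point z0 by variation of constants. The bound
  sees z only through its norm, which later gives uniform convergence on bounded sets.\<close>

lemma square_sums_locally_bounded:
  "\<exists>K. \<forall>z::complex. norm z \<le> R \<longrightarrow> (\<forall>n. (\<Sum>k<n. (norm (pfun s k z))\<^sup>2) \<le> K \<and> (\<Sum>k<n. (norm (qfun s k z))\<^sup>2) \<le> K)"
proof -
  obtain z0 :: complex where z0: "summable (\<lambda>k. (norm (pfun s k z0))\<^sup>2)" "summable (\<lambda>k. (norm (qfun s k z0))\<^sup>2)"
    by (rule square_summable_at_point)
  define a where "a k = norm (pfun s k z0)" for k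
  define b where "b k = norm (qfun s k z0)" for k
  define A where "A = sqrt (\<Sum>k. (a k)\<^sup>2)"
  define B where "B = sqrt (\<Sum>k. (b k)\<^sup>2)"
  have sa: "summable (\<lambda>k. (a k)\<^sup>2)" and sb: "summable (\<lambda>k. (b k)\<^sup>2)" using z0 by (auto simp: a_def b_def)
  have A: "sqrt (\<Sum>k<n. (a k)\<^sup>2) \<le> A" for n unfolding A_def using sa by (intro real_sqrt_le_mono sum_le_suminf) auto
  have B: "sqrt (\<Sum>k<n. (b k)\<^sup>2) \<le> B" for n unfolding B_def using sb by (intro real_sqrt_le_mono sum_le_suminf) auto
  have A0: "A \<ge> 0" "B \<ge> 0" using A[of 0] B[of 0] by auto
  define Q where "Q = \<bar>R\<bar> + norm z0"
  \<comment> \<open>Cauchy-Schwarz on the kernel gives norm (v n) <= (a n + b n) (1 + Q (A + B) S),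
    where Q bounds the distance of z from z0 and S is the norm of the earlier terms; the factor
    absorbs both summands into 1 + S.\<close>
  define c where "c k = (1 + Q * (A + B)) * (a k + b k)" for k
  have Q: "Q \<ge> 0" by (simp add: Q_def)
  have sc: "summable (\<lambda>k. (c k)\<^sup>2)"
  proof (rule summable_comparison_test')
    show "summable (\<lambda>k. (1 + Q * (A + B))\<^sup>2 * (2 * ((a k)\<^sup>2 + (b k)\<^sup>2)))"
      using sa sb by (intro summable_mult summable_add)
    fix k
    have "(a k + b k)\<^sup>2 \<le> 2 * ((a k)\<^sup>2 + (b k)\<^sup>2)"
      using sum_squares_bound[of "a k" "b k"] by (simp add: power2_sum)
    thus "norm ((c k)\<^sup>2) \<le> (1 + Q * (A + B))\<^sup>2 * (2 * ((a k)\<^sup>2 + (b k)\<^sup>2))"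
      unfolding c_def power_mult_distrib by (simp add: mult_left_mono)
  qed
  define K where "K = exp (2 * (\<Sum>k. (c k)\<^sup>2))"
  have main: "(\<Sum>k<n. (norm (v k))\<^sup>2) \<le> K"
    if z: "norm z \<le> R" and i: "\<And>n. norm (v0 n) \<le> a n + b n"
      and v: "\<And>n. v n = v0 n + (z - z0) * (\<Sum>k<n. (pfun s k z0 * qfun s n z0 - pfun s n z0 * qfun s k z0) * v k)"
    for z :: complex and v v0 :: "nat \<Rightarrow> complex" and n
  proof -
    have zz: "norm (z - z0) \<le> Q" using z norm_triangle_ineq4[of z z0] by (simp add: Q_def)
    have step: "norm (v n) \<le> c n * (1 + sqrt (\<Sum>k<n. (norm (v k))\<^sup>2))" for n
    proof -
      define S where "S = sqrt (\<Sum>k<n. (norm (v k))\<^sup>2)"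
      have S: "S \<ge> 0" by (simp add: S_def sum_nonneg)
      have cs: "(\<Sum>k<n. e k * norm (v k)) \<le> sqrt (\<Sum>k<n. (e k)\<^sup>2) * S" for e :: "nat \<Rightarrow> real"
        unfolding S_def real_sqrt_mult[symmetric]
        by (rule real_le_rsqrt) (rule Cauchy_Schwarz_ineq_sum)
      have "norm (\<Sum>k<n. (pfun s k z0 * qfun s n z0 - pfun s n z0 * qfun s k z0) * v k)
          \<le> (\<Sum>k<n. (a k * b n + a n * b k) * norm (v k))"
        unfolding a_def b_def norm_mult[symmetric]
        by (rule sum_norm_le) (simp add: norm_mult mult_right_mono norm_triangle_ineq4[THEN order_trans])
      also have "\<dots> = b n * (\<Sum>k<n. a k * norm (v k)) + a n * (\<Sum>k<n. b k * norm (v k))"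
        by (simp add: sum_distrib_left sum.distrib algebra_simps)
      also have "\<dots> \<le> b n * (A * S) + a n * (B * S)"
        using cs[of a] cs[of b] A[of n] B[of n] S
        by (intro add_mono mult_left_mono order_trans[OF cs] mult_right_mono) (auto simp: a_def b_def)
      also have "\<dots> \<le> (a n + b n) * ((A + B) * S)"
        using A0 S by (simp add: algebra_simps a_def b_def)
      finally have 1: "norm (\<Sum>k<n. (pfun s k z0 * qfun s n z0 - pfun s n z0 * qfun s k z0) * v k)
        \<le> (a n + b n) * ((A + B) * S)" .
      have "norm (v n) \<le> (a n + b n) + Q * ((a n + b n) * ((A + B) * S))"
        unfolding v[of n]
        by (rule order_trans[OF norm_triangle_ineq], rule add_mono[OF i])
          (use zz Q 1 in \<open>auto simp: norm_mult intro!: mult_mono\<close>)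
      also have "\<dots> \<le> c n * (1 + S)"
        using A0 S Q by (simp add: c_def algebra_simps a_def b_def)
      finally show ?thesis by (simp add: S_def)
    qed
    have "1 + (\<Sum>k<n. (norm (v k))\<^sup>2) \<le> exp (2 * (\<Sum>k<n. (c k)\<^sup>2))"
      by (rule discrete_gronwall[OF _ step]) auto
    also have "\<dots> \<le> K" unfolding K_def using sc by (auto intro!: sum_le_suminf)
    finally show ?thesis by simp
  qed
  have "(\<Sum>k<n. (norm (pfun s k z))\<^sup>2) \<le> K" "(\<Sum>k<n. (norm (qfun s k z))\<^sup>2) \<le> K" if "norm z \<le> R" for z :: complex and n
    by (rule main[OF that _ pfun_shift[of _ z z0]], simp add: a_def b_def,
        rule main[OF that _ qfun_shift[of _ z z0]], simp add: a_def b_def)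
  thus ?thesis by blast
qed

lemma pfun_square_summable: "summable (\<lambda>k. (norm (pfun s k (z::complex)))\<^sup>2)"
  and qfun_square_summable: "summable (\<lambda>k. (norm (qfun s k (z::complex)))\<^sup>2)"
proof -
  obtain K where K: "\<And>n. (\<Sum>k<n. (norm (pfun s k z))\<^sup>2) \<le> K" "\<And>n. (\<Sum>k<n. (norm (qfun s k z))\<^sup>2) \<le> K"
    using square_sums_locally_bounded[of "norm z"] by (metis order_refl)
  show "summable (\<lambda>k. (norm (pfun s k z))\<^sup>2)" "summable (\<lambda>k. (norm (qfun s k z))\<^sup>2)"
    using summableI_nonneg_bounded[OF _ K(1)] summableI_nonneg_bounded[OF _ K(2)] by simp_all
qed

lemma pfun_square_summable_real: "summable (\<lambda>k. (pfun s k (x::real))\<^sup>2)"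
  and qfun_square_summable_real: "summable (\<lambda>k. (qfun s k (x::real))\<^sup>2)"
  using pfun_square_summable[of "of_real x"] qfun_square_summable[of "of_real x"]
  by (simp_all add: pfun_of_real qfun_of_real)

text \<open>Cauchy-Schwarz in the orthonormal expansion: evaluation at z is a bounded functional,
  with the square sum of the p_k(z) as constant.\<close>

lemma complex_evaluation_bound:
  fixes G :: "complex poly"
  assumes "degree G \<le> n"
  shows "(norm (poly G z))\<^sup>2 \<le> (\<Sum>k. (norm (pfun s k z))\<^sup>2) * (\<Sum>k\<le>n. (norm (L (G * rpoly (op k))))\<^sup>2)"
proof -
  have "poly G z = (\<Sum>k\<le>n. L (G * rpoly (op k)) * pfun s k z)"
    using arg_cong[OF op_expansion[OF assms], of "\<lambda>p. poly p z"] by (simp add: poly_sum pfun_def)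
  hence "norm (poly G z) \<le> (\<Sum>k\<le>n. norm (L (G * rpoly (op k))) * norm (pfun s k z))"
    by (simp add: sum_norm_le norm_mult)
  hence "(norm (poly G z))\<^sup>2 \<le> (\<Sum>k\<le>n. norm (L (G * rpoly (op k))) * norm (pfun s k z))\<^sup>2"
    by (intro power_mono) auto
  also have "\<dots> \<le> (\<Sum>k\<le>n. (norm (L (G * rpoly (op k))))\<^sup>2) * (\<Sum>k\<le>n. (norm (pfun s k z))\<^sup>2)"
    by (rule Cauchy_Schwarz_ineq_sum)
  also have "\<dots> \<le> (\<Sum>k\<le>n. (norm (L (G * rpoly (op k))))\<^sup>2) * (\<Sum>k. (norm (pfun s k z))\<^sup>2)"
    by (intro mult_left_mono sum_le_suminf pfun_square_summable) (auto intro: sum_nonneg)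
  finally show ?thesis by (simp add: mult.commute)
qed

lemma real_evaluation_bound: "(poly (p :: real poly) x)\<^sup>2 \<le> (\<Sum>k. (pfun s k x)\<^sup>2) * L (p * p)"
proof -
  have "(norm (poly (rpoly p) (complex_of_real x)))\<^sup>2 \<le> (\<Sum>k. (norm (pfun s k (complex_of_real x)))\<^sup>2) *
     (\<Sum>k\<le>degree p. (norm (L (rpoly p * rpoly (op k) :: complex poly)))\<^sup>2)"
    by (rule complex_evaluation_bound) simp
  also have "(\<Sum>k\<le>degree p. (norm (L (rpoly p * rpoly (op k) :: complex poly)))\<^sup>2) = L (p * p)"
    using op_parseval[of p "degree p" p] by (simp add: rpoly_mult[symmetric] power2_eq_square)
  finally show ?thesis by (simp add: pfun_of_real)
qed

end

lemma indeterminate_sequenceI: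
  "\<mu> \<in> V s \<Longrightarrow> \<nu> \<in> V s \<Longrightarrow> \<mu> \<noteq> \<nu> \<Longrightarrow> indeterminate_sequence s"
  by unfold_locales auto

text \<open>In an indeterminate space evaluation at b is bounded by
  \<open>real_evaluation_bound\<close>, which excludes arbitrarily small polynomials with value 1 at
  b. The point b is free; it will be chosen outside the support.\<close>

lemma determinateI:
  assumes \<mu>: "\<mu> \<in> Mstar" and small: "\<And>e. e > 0 \<Longrightarrow> \<exists>p. poly p b = 1 \<and> (LINT x|\<mu>. (poly p x)\<^sup>2) < e"
  shows "\<mu> \<in> M_det"
proof (rule ccontr)
  assume "\<mu> \<notin> M_det"
  then obtain \<nu> where "\<nu> \<in> V (moments \<mu>)" "\<nu> \<noteq> \<mu>" using \<mu> by (auto simp: M_det_def V_def)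
  moreover have "\<mu> \<in> V (moments \<mu>)" using \<mu> by (simp add: V_def)
  ultimately interpret indeterminate_sequence "moments \<mu>" by (intro indeterminate_sequenceI)
  define K where "K = (\<Sum>k. (pfun (moments \<mu>) k b)\<^sup>2)"
  have "K \<ge> 0" unfolding K_def by (intro suminf_nonneg pfun_square_summable_real) auto
  obtain p where p: "poly p b = 1" "(LINT x|\<mu>. (poly p x)\<^sup>2) < 1 / (K + 1)"
    using small[of "1 / (K + 1)"] \<open>K \<ge> 0\<close> by auto
  have "1 \<le> K * L (p * p)" using real_evaluation_bound[of p b] p(1) by (simp add: K_def)
  also have "L (p * p) = (LINT x|\<mu>. (poly p x)\<^sup>2)"
    using integral_real_poly[of \<mu> "p * p"] \<mu> by (simp add: Mstar_iff_positive_definite power2_eq_square)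
  also have "K * \<dots> \<le> K * (1 / (K + 1))" using p(2) \<open>K \<ge> 0\<close> by (intro mult_left_mono) auto
  also have "\<dots> < 1" using \<open>K \<ge> 0\<close> by (simp add: field_simps)
  finally show False by simp
qed

section \<open>Extremal measures\<close>

definition poly_approximable :: "real measure \<Rightarrow> (real \<Rightarrow> real) \<Rightarrow> bool" where
  "poly_approximable \<mu> f \<longleftrightarrow> sq_integrable \<mu> f \<and> (\<forall>e>0. \<exists>p. (LINT x|\<mu>. (f x - poly p x)\<^sup>2) < e)"

text \<open>
  For \<open>\<epsilon> = 1\<close> the function \<open>f\<close> is \<open>1 / (x - b)\<close> and \<open>\<tau>\<close> is its integral; for \<open>\<epsilon> = 0\<close> it is a
  multiple of the indicator of \<open>b\<close>, so that \<open>b\<close> is an atom.  Treating both cases at once covers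
  the parameters \<open>t \<in> \<real>\<close> and \<open>t = \<infinity>\<close> uniformly.
\<close>

definition extremal_at :: "real measure \<Rightarrow> real \<Rightarrow> real \<Rightarrow> real \<Rightarrow> (real \<Rightarrow> real) \<Rightarrow> bool" where
  "extremal_at \<mu> b \<epsilon> \<tau> f \<longleftrightarrow> poly_approximable \<mu> f \<and> (AE x in \<mu>. (x - b) * f x = \<epsilon>) \<and>
     (LINT x|\<mu>. f x) = \<tau> \<and> (\<epsilon> \<noteq> 0 \<or> \<tau> \<noteq> 0)"

text \<open>Cauchy-Schwarz applied to the tail. The bound sees v only through K, so for v_k = p_k(z)
  it is uniform for z in a bounded set.\<close>

lemma l2_product:
  fixes a :: "nat \<Rightarrow> real" and v :: "nat \<Rightarrow> 'a::{real_normed_field, banach}"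
  assumes a: "summable (\<lambda>k. (a k)\<^sup>2)" and v: "\<And>n. (\<Sum>k<n. (norm (v k))\<^sup>2) \<le> K"
  shows "summable (\<lambda>k. of_real (a k) * v k)"
    and "(norm ((\<Sum>k<N. of_real (a k) * v k) - (\<Sum>k. of_real (a k) * v k)))\<^sup>2 \<le> K * (\<Sum>k. (a (k + N))\<^sup>2)"
proof -
  have K: "K \<ge> 0" using v[of 0] by simp
  define T where "T = (\<Sum>k. (a (k + N))\<^sup>2)"
  have aN: "summable (\<lambda>k. (a (k + N))\<^sup>2)" using summable_ignore_initial_segment[OF a] .
  have T: "T \<ge> 0" unfolding T_def by (intro suminf_nonneg aN) auto
  have bd: "(\<Sum>k<n. norm (of_real (a (k + N)) * v (k + N))) \<le> sqrt (K * T)" for n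
  proof (rule real_le_rsqrt)
    have "(\<Sum>k<n. norm (of_real (a (k + N)) * v (k + N)))\<^sup>2 = (\<Sum>k<n. \<bar>a (k + N)\<bar> * norm (v (k + N)))\<^sup>2"
      by (simp add: norm_mult)
    also have "\<dots> \<le> (\<Sum>k<n. \<bar>a (k + N)\<bar>\<^sup>2) * (\<Sum>k<n. (norm (v (k + N)))\<^sup>2)"
      by (rule Cauchy_Schwarz_ineq_sum)
    also have "\<dots> \<le> T * K"
    proof (intro mult_mono)
      show "(\<Sum>k<n. \<bar>a (k + N)\<bar>\<^sup>2) \<le> T" unfolding T_def using aN by (auto intro!: sum_le_suminf)
      have "(\<Sum>k<n. (norm (v (k + N)))\<^sup>2) = (\<Sum>k\<in>{N..<n + N}. (norm (v k))\<^sup>2)"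
        by (subst sum.shift_bounds_nat_ivl[of _ 0 N n, simplified]) (simp add: atLeast0LessThan)
      also have "\<dots> \<le> (\<Sum>k<n + N. (norm (v k))\<^sup>2)" by (intro sum_mono2) auto
      also have "\<dots> \<le> K" by (rule v)
      finally show "(\<Sum>k<n. (norm (v (k + N)))\<^sup>2) \<le> K" .
    qed (use T in \<open>auto intro: sum_nonneg\<close>)
    finally show "(\<Sum>k<n. norm (of_real (a (k + N)) * v (k + N)))\<^sup>2 \<le> K * T" by (simp add: mult.commute)
  qed
  have sn: "summable (\<lambda>k. norm (of_real (a (k + N)) * v (k + N)))"
    by (rule summableI_nonneg_bounded[OF _ bd]) auto
  have sN: "summable (\<lambda>k. of_real (a (k + N)) * v (k + N))" by (rule summable_norm_cancel[OF sn])
  thus s: "summable (\<lambda>k. of_real (a k) * v k)" by (subst (asm) summable_iff_shift)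
  have "(\<Sum>k. of_real (a k) * v k) - (\<Sum>k<N. of_real (a k) * v k) = (\<Sum>k. of_real (a (k + N)) * v (k + N))"
    using suminf_minus_initial_segment[OF s, of N] by simp
  hence "norm ((\<Sum>k<N. of_real (a k) * v k) - (\<Sum>k. of_real (a k) * v k)) = norm (\<Sum>k. of_real (a (k + N)) * v (k + N))"
    by (metis norm_minus_commute)
  also have "\<dots> \<le> (\<Sum>k. norm (of_real (a (k + N)) * v (k + N)))" by (rule summable_norm[OF sn])
  also have "\<dots> \<le> sqrt (K * T)" by (rule suminf_le_const[OF sn bd])
  finally have "(norm ((\<Sum>k<N. of_real (a k) * v k) - (\<Sum>k. of_real (a k) * v k)))\<^sup>2 \<le> (sqrt (K * T))\<^sup>2"
    by (intro power_mono) auto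
  thus "(norm ((\<Sum>k<N. of_real (a k) * v k) - (\<Sum>k. of_real (a k) * v k)))\<^sup>2 \<le> K * (\<Sum>k. (a (k + N))\<^sup>2)"
    using K T by (simp add: T_def)
qed

lemma suminf_tail_tendsto_0:
  fixes f :: "nat \<Rightarrow> real"
  assumes "summable f"
  shows "(\<lambda>N. \<Sum>k. f (k + N)) \<longlonglongrightarrow> 0"
proof -
  have "(\<lambda>N. suminf f - (\<Sum>k<N. f k)) \<longlonglongrightarrow> suminf f - suminf f"
    by (intro tendsto_intros summable_LIMSEQ assms)
  thus ?thesis using suminf_minus_initial_segment[OF assms] by simp
qed

section \<open>Fourier series of the extremal function and the Stieltjes transform\<close>

context moment_sequence
begin

text \<open>The Fourier coefficients of the function \<open>f\<close> in \<open>extremal_at\<close> with respect to the \<open>p\<^sub>k\<close>.\<close>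

definition kcoeff :: "real \<Rightarrow> real \<Rightarrow> real \<Rightarrow> nat \<Rightarrow> real" where
  "kcoeff b \<epsilon> \<tau> k = \<epsilon> * qfun s k b + \<tau> * pfun s k b"

definition kpoly :: "real \<Rightarrow> real \<Rightarrow> real \<Rightarrow> nat \<Rightarrow> real poly" where
  "kpoly b \<epsilon> \<tau> n = (\<Sum>k<n. smult (kcoeff b \<epsilon> \<tau> k) (op k))"

text \<open>For b = 0 the function z \<open>kfun\<close> is \<epsilon> (B + 1) + \<tau> D, and z
  \<open>kfun2\<close> is \<epsilon> A + \<tau> (C - 1), in terms of the Nevanlinna
  functions.\<close>

definition kfun :: "real \<Rightarrow> real \<Rightarrow> real \<Rightarrow> 'a::{real_normed_field, banach} \<Rightarrow> 'a" where
  "kfun b \<epsilon> \<tau> z = (\<Sum>k. of_real (kcoeff b \<epsilon> \<tau> k) * pfun s k z)"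

definition kfun2 :: "real \<Rightarrow> real \<Rightarrow> real \<Rightarrow> complex \<Rightarrow> complex" where
  "kfun2 b \<epsilon> \<tau> z = (\<Sum>k. of_real (kcoeff b \<epsilon> \<tau> k) * qfun s k z)"

lemma poly_kpoly: "poly (kpoly b \<epsilon> \<tau> n) x = (\<Sum>k<n. kcoeff b \<epsilon> \<tau> k * pfun s k x)"
  by (simp add: kpoly_def poly_sum pfun_def)

lemma poly_rpoly_kpoly: "poly (rpoly (kpoly b \<epsilon> \<tau> n)) z = (\<Sum>k<n. of_real (kcoeff b \<epsilon> \<tau> k) * pfun s k z)"
  by (simp add: kpoly_def poly_sum pfun_def rpoly_sum rpoly_smult)

lemma second_kind_kpoly:
  "second_kind s (rpoly (kpoly b \<epsilon> \<tau> n)) z = (\<Sum>k<n. of_real (kcoeff b \<epsilon> \<tau> k) * qfun s k z)"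
  by (simp add: kpoly_def second_kind_sum second_kind_smult qfun_eq rpoly_sum rpoly_smult)

lemma degree_kpoly: "degree (kpoly b \<epsilon> \<tau> (Suc n)) \<le> n"
  unfolding kpoly_def by (intro degree_sum_le) (auto intro: order_trans[OF degree_smult_le])

lemma L_kpoly_op: "L (kpoly b \<epsilon> \<tau> n * op k) = (if k < n then kcoeff b \<epsilon> \<tau> k else 0)"
  by (simp add: kpoly_def sum_distrib_right moment_functional_linear L_orthonormal_real
      if_distrib[of "\<lambda>x. _ * x"] cong: if_cong)

text \<open>Splitting p_k at b turns f p_k into \<epsilon> times the divided difference plus p_k(b)
  f. So nothing about f enters except \<epsilon> and its integral, which is why these two numbers
  can determine the measure.\<close>

lemma fourier_coefficient:
  assumes \<mu>: "\<mu> \<in> V s" and f: "sq_integrable \<mu> f" and ae: "AE x in \<mu>. (x - b) * f x = \<epsilon>"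
  shows "(LINT x|\<mu>. f x * poly (op k) x) = kcoeff b \<epsilon> (LINT x|\<mu>. f x) k"
proof -
  note hm = V_has_moments[OF \<mu>]
  have [measurable]: "f \<in> borel_measurable \<mu>" using f by (simp add: sq_integrable_def)
  have [measurable]: "poly p \<in> borel_measurable \<mu>" for p :: "real poly"
    by (intro borel_measurable_has_moments[OF hm]) simp
  let ?g = "synthetic_div (op k) b"
  have fi: "integrable \<mu> f"
    using sq_integrable_mult[OF f sq_integrable_poly[OF hm, of 1]] by simp
  have "(LINT x|\<mu>. f x * poly (op k) x) = (LINT x|\<mu>. \<epsilon> * poly ?g x + poly (op k) b * f x)"
  proof (intro integral_cong_AE)
    show "AE x in \<mu>. f x * poly (op k) x = \<epsilon> * poly ?g x + poly (op k) b * f x"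
      using ae
    proof eventually_elim
      case (elim x)
      have "poly (op k) x = poly (op k) b + (x - b) * poly ?g x"
        using poly_eq_synthetic_div[of "op k" x b] by simp
      hence "f x * poly (op k) x = poly (op k) b * f x + ((x - b) * f x) * poly ?g x"
        by (simp only:) (simp add: algebra_simps)
      thus ?case using elim by simp
    qed
  qed measurable
  also have "\<dots> = \<epsilon> * (LINT x|\<mu>. poly ?g x) + poly (op k) b * (LINT x|\<mu>. f x)"
    using fi integrable_real_poly[OF hm] by simp
  also have "(LINT x|\<mu>. poly ?g x) = qfun s k b"
    using integral_real_poly[OF hm, of ?g] V_moments[OF \<mu>] by (simp add: qfun_eq second_kind_def)
  finally show ?thesis by (simp add: kcoeff_def pfun_real)
qed

text \<open>The partial Fourier sum is at least as near to f as any polynomial of its degree, so the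
  mere existence of good approximants makes the explicit sums converge.\<close>

lemma kpoly_tendsto_L2:
  assumes \<mu>: "\<mu> \<in> V s" and f: "extremal_at \<mu> b \<epsilon> \<tau> f"
  shows "(\<lambda>n. LINT x|\<mu>. (f x - poly (kpoly b \<epsilon> \<tau> n) x)\<^sup>2) \<longlonglongrightarrow> 0"
proof (rule tendstoI)
  fix e :: real assume "e > 0"
  have sq: "sq_integrable \<mu> f" and ae: "AE x in \<mu>. (x - b) * f x = \<epsilon>" and \<tau>: "(LINT x|\<mu>. f x) = \<tau>"
    using f by (auto simp: extremal_at_def poly_approximable_def)
  obtain p where p: "(LINT x|\<mu>. (f x - poly p x)\<^sup>2) < e"
    using f \<open>e > 0\<close> by (auto simp: extremal_at_def poly_approximable_def)
  have c: "(LINT x|\<mu>. f x * poly (op k) x) = kcoeff b \<epsilon> \<tau> k" for k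
    using fourier_coefficient[OF \<mu> sq ae] \<tau> by simp
  have "(LINT x|\<mu>. (f x - poly (kpoly b \<epsilon> \<tau> (Suc n)) x)\<^sup>2) \<le> (LINT x|\<mu>. (f x - poly p x)\<^sup>2)"
    if n: "n \<ge> degree p" for n
    unfolding integral_diff_poly_square[OF \<mu> sq degree_kpoly] integral_diff_poly_square[OF \<mu> sq n] c
    by (simp add: L_kpoly_op sum_nonneg)
  hence "(LINT x|\<mu>. (f x - poly (kpoly b \<epsilon> \<tau> n) x)\<^sup>2) < e" if "n \<ge> Suc (degree p)" for n
    using that p by (cases n) (auto intro: le_less_trans)
  thus "eventually (\<lambda>n. dist (LINT x|\<mu>. (f x - poly (kpoly b \<epsilon> \<tau> n) x)\<^sup>2) 0 < e) sequentially"
    by (auto simp: eventually_sequentially)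
qed

end

context indeterminate_sequence
begin

lemma kcoeff_square_summable: "summable (\<lambda>k. (kcoeff b \<epsilon> \<tau> k)\<^sup>2)"
proof (rule summable_comparison_test')
  show "summable (\<lambda>k. 2 * (\<epsilon>\<^sup>2 * (qfun s k b)\<^sup>2 + \<tau>\<^sup>2 * (pfun s k b)\<^sup>2))"
    by (intro summable_mult summable_add pfun_square_summable_real qfun_square_summable_real)
  fix k
  have "(u + v)\<^sup>2 \<le> 2 * (u\<^sup>2 + v\<^sup>2)" for u v :: real
    using sum_squares_bound[of u v] by (simp add: power2_sum)
  from this[of "\<epsilon> * qfun s k b" "\<tau> * pfun s k b"]
  show "norm ((kcoeff b \<epsilon> \<tau> k)\<^sup>2) \<le> 2 * (\<epsilon>\<^sup>2 * (qfun s k b)\<^sup>2 + \<tau>\<^sup>2 * (pfun s k b)\<^sup>2)"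
    by (simp add: kcoeff_def power_mult_distrib)
qed

lemma pfun_square_sum_le: "(\<Sum>k<n. (norm (pfun s k (z::complex)))\<^sup>2) \<le> (\<Sum>k. (norm (pfun s k z))\<^sup>2)"
  and qfun_square_sum_le: "(\<Sum>k<n. (norm (qfun s k (z::complex)))\<^sup>2) \<le> (\<Sum>k. (norm (qfun s k z))\<^sup>2)"
  by (intro sum_le_suminf pfun_square_summable qfun_square_summable; simp)+

lemma kfun_summable: "summable (\<lambda>k. of_real (kcoeff b \<epsilon> \<tau> k) * pfun s k (z::complex))"
  and kfun2_summable: "summable (\<lambda>k. of_real (kcoeff b \<epsilon> \<tau> k) * qfun s k (z::complex))"
  by (rule l2_product(1)[OF kcoeff_square_summable pfun_square_sum_le],
      rule l2_product(1)[OF kcoeff_square_summable qfun_square_sum_le])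

lemma kfun_of_real: "kfun b \<epsilon> \<tau> (complex_of_real x) = of_real (kfun b \<epsilon> \<tau> x)"
proof -
  have "summable (\<lambda>k. complex_of_real (kcoeff b \<epsilon> \<tau> k * pfun s k x))"
    using kfun_summable[of b \<epsilon> \<tau> "of_real x"] by (simp add: pfun_of_real)
  hence "summable (\<lambda>k. kcoeff b \<epsilon> \<tau> k * pfun s k x)" by (subst (asm) summable_of_real_iff)
  thus ?thesis unfolding kfun_def by (simp add: pfun_of_real suminf_of_real flip: of_real_mult)
qed

lemma kpoly_tendsto: "(\<lambda>n. poly (rpoly (kpoly b \<epsilon> \<tau> n)) z) \<longlonglongrightarrow> kfun b \<epsilon> \<tau> (z::complex)"
  unfolding kfun_def poly_rpoly_kpoly by (rule summable_LIMSEQ[OF kfun_summable])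

lemma second_kind_kpoly_tendsto: "(\<lambda>n. second_kind s (rpoly (kpoly b \<epsilon> \<tau> n)) z) \<longlonglongrightarrow> kfun2 b \<epsilon> \<tau> (z::complex)"
  unfolding kfun2_def second_kind_kpoly by (rule summable_LIMSEQ[OF kfun2_summable])

lemma kpoly_uniform_limit:
  "uniform_limit (cball 0 R) (\<lambda>n x. poly (kpoly b \<epsilon> \<tau> n) x) (kfun b \<epsilon> \<tau> :: real \<Rightarrow> real) sequentially"
proof (rule uniform_limitI)
  fix e :: real assume e: "e > 0"
  obtain K where K: "\<And>z::complex. \<And>n. norm z \<le> R \<Longrightarrow> (\<Sum>k<n. (norm (pfun s k z))\<^sup>2) \<le> K"
    using square_sums_locally_bounded[of R] by meson
  have "(\<lambda>N. K * (\<Sum>k. (kcoeff b \<epsilon> \<tau> (k + N))\<^sup>2)) \<longlonglongrightarrow> K * 0"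
    by (intro tendsto_intros suminf_tail_tendsto_0 kcoeff_square_summable)
  hence "eventually (\<lambda>N. K * (\<Sum>k. (kcoeff b \<epsilon> \<tau> (k + N))\<^sup>2) < e\<^sup>2) sequentially"
    using e by (intro order_tendstoD(2)) auto
  thus "eventually (\<lambda>n. \<forall>x\<in>cball 0 R. dist (poly (kpoly b \<epsilon> \<tau> n) x) (kfun b \<epsilon> \<tau> x) < e) sequentially"
  proof eventually_elim
    case (elim N)
    show ?case
    proof
      fix x :: real assume x: "x \<in> cball 0 R"
      have "(norm ((\<Sum>k<N. of_real (kcoeff b \<epsilon> \<tau> k) * pfun s k (complex_of_real x)) - kfun b \<epsilon> \<tau> (complex_of_real x)))\<^sup>2
          \<le> K * (\<Sum>k. (kcoeff b \<epsilon> \<tau> (k + N))\<^sup>2)"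
        unfolding kfun_def using x by (intro l2_product(2) kcoeff_square_summable K) simp
      also have "(\<Sum>k<N. of_real (kcoeff b \<epsilon> \<tau> k) * pfun s k (complex_of_real x)) - kfun b \<epsilon> \<tau> (complex_of_real x) =
          of_real (poly (kpoly b \<epsilon> \<tau> N) x - kfun b \<epsilon> \<tau> x)"
        by (simp add: kfun_of_real pfun_of_real poly_kpoly)
      also note elim
      finally have "(dist (poly (kpoly b \<epsilon> \<tau> N) x) (kfun b \<epsilon> \<tau> x))\<^sup>2 < e\<^sup>2"
        by (simp only: norm_of_real dist_real_def)
      thus "dist (poly (kpoly b \<epsilon> \<tau> N) x) (kfun b \<epsilon> \<tau> x) < e"
        using e by (meson less_imp_le power_less_imp_less_base)
    qed
  qed
qed

lemma continuous_kfun: "continuous_on UNIV (kfun b \<epsilon> \<tau> :: real \<Rightarrow> real)"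
proof -
  have "isCont (kfun b \<epsilon> \<tau> :: real \<Rightarrow> real) x" for x
  proof -
    have "continuous_on (cball 0 (\<bar>x\<bar> + 1)) (kfun b \<epsilon> \<tau> :: real \<Rightarrow> real)"
      by (rule uniform_limit_theorem[OF always_eventually kpoly_uniform_limit])
        (auto intro!: continuous_intros)
    hence "continuous_on (ball 0 (\<bar>x\<bar> + 1)) (kfun b \<epsilon> \<tau> :: real \<Rightarrow> real)"
      by (rule continuous_on_subset) auto
    thus ?thesis by (subst (asm) continuous_on_eq_continuous_at) auto
  qed
  thus ?thesis by (simp add: continuous_at_imp_continuous_on)
qed

lemma kfun_atom: "kfun b 0 \<tau> b = \<tau> * (\<Sum>k. (pfun s k b)\<^sup>2)"
  unfolding kfun_def kcoeff_def
  by (subst suminf_mult[OF pfun_square_summable_real, symmetric]) (simp add: power2_eq_square mult.assoc)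

lemma kernel_diag_pos: "(\<Sum>k. (pfun s k (b::real))\<^sup>2) > 0"
proof (rule suminf_pos2[OF pfun_square_summable_real, of _ 0])
  show "(pfun s 0 b)\<^sup>2 > 0" using L_sum_kernel[of b] by auto
qed auto

text \<open>
  If the two sides vanished at \<open>z\<close>, the polynomials
  \<open>((x - b) P\<^sub>n(x) - (z - b) P\<^sub>n(z)) / (x - z)\<close> would tend to \<open>0\<close> in \<open>L\<^sup>2\<close>, hence pointwise
  by boundedness of the point evaluations, which forces \<open>(y - b) P(y) = \<epsilon>\<close> for all \<open>y\<close>.
\<close>

lemma kfun_nonvanishing:
  assumes \<mu>: "\<mu> \<in> V s" and f: "extremal_at \<mu> b \<epsilon> \<tau> f" and z: "Im z \<noteq> 0"
  shows "of_real \<epsilon> - (z - of_real b) * kfun b \<epsilon> \<tau> z \<noteq> 0"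
proof
  assume zero: "of_real \<epsilon> - (z - of_real b) * kfun b \<epsilon> \<tau> z = 0"
  note hm = V_has_moments[OF \<mu>]
  let ?P = "kpoly b \<epsilon> \<tau>"
  have sq: "sq_integrable \<mu> f" and ae: "AE x in \<mu>. (x - b) * f x = \<epsilon>" and ne: "\<epsilon> \<noteq> 0 \<or> \<tau> \<noteq> 0"
    using f by (auto simp: extremal_at_def poly_approximable_def)
  define Q where "Q n = [:-b, 1:] * ?P (Suc n)" for n
  define R where "R n = synthetic_div (rpoly (Q n)) z" for n
  define \<delta> where "\<delta> n = of_real \<epsilon> - (z - of_real b) * poly (rpoly (?P (Suc n))) z" for n
  \<comment> \<open>A bound for (x - b) / (x - z) on the real line, from (x - b) / (x - z) = 1 + (z
    - b) / (x - z).\<close>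
  define C where "C = 1 + norm (z - of_real b) / \<bar>Im z\<bar>"
  define I where "I n = 2 * C\<^sup>2 * (LINT x|\<mu>. (f x - poly (?P (Suc n)) x)\<^sup>2) + 2 * (norm (\<delta> n))\<^sup>2 / (Im z)\<^sup>2 * s 0" for n
  have polyQ: "poly (rpoly (Q n)) y = (y - of_real b) * poly (rpoly (?P (Suc n))) y" for n and y :: complex
    by (simp only: Q_def rpoly_mult poly_mult) (simp add: map_poly_pCons)
  have \<delta>: "\<delta> \<longlonglongrightarrow> 0"
  proof -
    have "\<delta> \<longlonglongrightarrow> of_real \<epsilon> - (z - of_real b) * kfun b \<epsilon> \<tau> z"
      unfolding \<delta>_def by (intro tendsto_intros LIMSEQ_Suc[OF kpoly_tendsto])
    thus ?thesis using zero by simp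
  qed
  have I0: "I \<longlonglongrightarrow> 0"
  proof -
    have "I \<longlonglongrightarrow> 2 * C\<^sup>2 * 0 + 2 * (norm (0::complex))\<^sup>2 / (Im z)\<^sup>2 * s 0"
      unfolding I_def by (intro tendsto_intros LIMSEQ_Suc[OF kpoly_tendsto_L2[OF \<mu> f]] \<delta>) (use z in auto)
    thus ?thesis by simp
  qed
  have degR: "degree (R n) \<le> Suc n" for n
    unfolding R_def degree_synthetic_div degree_rpoly Q_def
    using degree_kpoly[of b \<epsilon> \<tau> n] degree_mult_le[of "[:-b, 1:]" "?P (Suc n)"] by simp
  have bound: "(LINT x|\<mu>. (norm (poly (R n) (of_real x)))\<^sup>2) \<le> I n" for n
  proof -
    have h: "integrable \<mu> (\<lambda>x. (f x - poly (?P (Suc n)) x)\<^sup>2)"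
      using sq_integrable_diff[OF sq sq_integrable_poly[OF hm]] by (simp add: sq_integrable_def)
    interpret finite_measure \<mu> by (rule has_momentsD(3)[OF hm])
    have "(LINT x|\<mu>. (norm (poly (R n) (of_real x)))\<^sup>2) \<le>
        (LINT x|\<mu>. 2 * C\<^sup>2 * (f x - poly (?P (Suc n)) x)\<^sup>2 + 2 * (norm (\<delta> n))\<^sup>2 / (Im z)\<^sup>2)"
    proof (rule integral_mono_AE')
      show "integrable \<mu> (\<lambda>x. 2 * C\<^sup>2 * (f x - poly (?P (Suc n)) x)\<^sup>2 + 2 * (norm (\<delta> n))\<^sup>2 / (Im z)\<^sup>2)"
        using h by simp
      show "AE x in \<mu>. (norm (poly (R n) (of_real x)))\<^sup>2 \<le> 2 * C\<^sup>2 * (f x - poly (?P (Suc n)) x)\<^sup>2 + 2 * (norm (\<delta> n))\<^sup>2 / (Im z)\<^sup>2"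
        using ae
      proof eventually_elim
        case (elim x)
        define h where "h = poly (?P (Suc n)) x - f x"
        define X where "X = complex_of_real x - z"
        have X: "X \<noteq> 0" "\<bar>Im z\<bar> \<le> norm X" using z abs_Im_le_cmod[of X] by (auto simp: X_def complex_eq_iff)
        have "X * poly (R n) (of_real x) = poly (rpoly (Q n)) (of_real x) - poly (rpoly (Q n)) z"
          unfolding R_def X_def by (rule poly_eq_synthetic_div[symmetric])
        also have "\<dots> = (of_real x - of_real b) * of_real h + of_real ((x - b) * f x) - (z - of_real b) * poly (rpoly (?P (Suc n))) z"
          unfolding polyQ by (simp add: h_def algebra_simps)
        also have "\<dots> = (of_real x - of_real b) * of_real h + \<delta> n" by (simp add: elim \<delta>_def)
        finally have R: "poly (R n) (of_real x) = (of_real x - of_real b) / X * of_real h + \<delta> n / X"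
          using X by (simp add: field_simps)
        have "norm ((of_real x - of_real b) / X) = norm (1 + (z - of_real b) / X)"
          using X by (intro arg_cong[of _ _ norm]) (simp add: field_simps X_def)
        also have "\<dots> \<le> 1 + norm (z - of_real b) / norm X"
          using norm_triangle_ineq[of 1 "(z - of_real b) / X"] by (simp add: norm_divide)
        also have "\<dots> \<le> C" unfolding C_def using X z by (intro add_left_mono divide_left_mono) auto
        finally have 1: "norm ((of_real x - of_real b) / X) \<le> C" .
        have "norm (poly (R n) (of_real x)) \<le> C * \<bar>h\<bar> + norm (\<delta> n) / \<bar>Im z\<bar>"
          unfolding R
        proof (intro order_trans[OF norm_triangle_ineq] add_mono)
          show "norm ((of_real x - of_real b) / X * of_real h) \<le> C * \<bar>h\<bar>"
            using mult_right_mono[OF 1, of "\<bar>h\<bar>"] by (simp only: norm_mult norm_of_real)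
          show "norm (\<delta> n / X) \<le> norm (\<delta> n) / \<bar>Im z\<bar>"
            using X z by (auto simp: norm_divide intro!: divide_left_mono)
        qed
        hence "(norm (poly (R n) (of_real x)))\<^sup>2 \<le> (C * \<bar>h\<bar> + norm (\<delta> n) / \<bar>Im z\<bar>)\<^sup>2"
          by (intro power_mono) auto
        also have "\<dots> \<le> 2 * ((C * \<bar>h\<bar>)\<^sup>2 + (norm (\<delta> n) / \<bar>Im z\<bar>)\<^sup>2)"
          using sum_squares_bound[of "C * \<bar>h\<bar>" "norm (\<delta> n) / \<bar>Im z\<bar>"] by (simp add: power2_sum)
        also have "\<dots> = 2 * C\<^sup>2 * (f x - poly (?P (Suc n)) x)\<^sup>2 + 2 * (norm (\<delta> n))\<^sup>2 / (Im z)\<^sup>2"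
          by (simp add: h_def power_mult_distrib power_divide power2_commute)
        finally show ?case .
      qed
    qed simp
    also have "\<dots> = I n"
      using h V_moments[OF \<mu>] by (auto simp: I_def moments_def)
    finally show ?thesis .
  qed
  have conv0: "(\<lambda>n. poly (R n) y) \<longlonglongrightarrow> 0" for y
  proof -
    define K where "K = (\<Sum>k. (norm (pfun s k y))\<^sup>2)"
    have K: "K \<ge> 0" unfolding K_def by (intro suminf_nonneg pfun_square_summable) auto
    have le: "(norm (poly (R n) y))\<^sup>2 \<le> K * I n" for n
    proof -
      let ?g = "\<lambda>x. poly (R n) (complex_of_real x)"
      have intp: "integrable \<mu> (\<lambda>x. of_real (poly (op k) x) * ?g x)"
        and Lp: "L (R n * rpoly (op k)) = (LINT x|\<mu>. of_real (poly (op k) x) * ?g x)" for k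
        using integrable_poly[OF hm, of "R n * rpoly (op k)"] integral_poly[OF hm, of "R n * rpoly (op k)"] V_moments[OF \<mu>]
        by (simp_all add: mult.commute)
      have norm2: "integrable \<mu> (\<lambda>x. (norm (?g x))\<^sup>2)"
      proof -
        \<comment> \<open>On the real line the squared norm of \<open>R n\<close> is itself a
          polynomial, the product with the polynomial of conjugate coefficients, and hence
          integrable.\<close>
        define cR where "cR = map_poly cnj (R n)"
        have "poly cR (complex_of_real x) = cnj (?g x)" for x
          unfolding cR_def by (metis complex_cnj_complex_of_real poly_cnj)
        hence "poly (R n * cR) (complex_of_real x) = of_real ((norm (?g x))\<^sup>2)" for x
          by (simp add: complex_norm_square flip: of_real_power)
        thus ?thesis using integrable_Re[OF integrable_poly[OF hm, of "R n * cR"]] by simp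
      qed
      have [measurable]: "?g \<in> borel_measurable \<mu>"
        by (intro borel_measurable_has_moments[OF hm]) measurable
      have sqi: "sq_integrable \<mu> (\<lambda>x. Re (?g x))" "sq_integrable \<mu> (\<lambda>x. Im (?g x))"
        unfolding sq_integrable_def
        by (auto intro!: Bochner_Integration.integrable_bound[OF norm2] simp: cmod_power2)
      have "(norm (poly (R n) y))\<^sup>2 \<le> K * (\<Sum>k\<le>Suc n. (norm (L (R n * rpoly (op k))))\<^sup>2)"
        unfolding K_def by (rule complex_evaluation_bound[OF degR])
      also have "\<dots> \<le> K * (LINT x|\<mu>. (norm (?g x))\<^sup>2)"
        unfolding Lp by (intro mult_left_mono bessel_inequality_complex \<mu> sqi intp K)
      also have "\<dots> \<le> K * I n" by (intro mult_left_mono bound K)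
      finally show ?thesis .
    qed
    have "(\<lambda>n. (norm (poly (R n) y))\<^sup>2) \<longlonglongrightarrow> 0"
    proof (rule tendsto_sandwich[OF _ _ tendsto_const])
      show "(\<lambda>n. K * I n) \<longlonglongrightarrow> 0" using tendsto_mult_left[OF I0, of K] by simp
    qed (use le in auto)
    hence "(\<lambda>n. sqrt ((norm (poly (R n) y))\<^sup>2)) \<longlonglongrightarrow> sqrt 0" by (rule tendsto_real_sqrt)
    thus ?thesis by (simp add: tendsto_norm_zero_iff)
  qed
  have id: "(y - b) * kfun b \<epsilon> \<tau> y = \<epsilon>" for y :: real
  proof -
    let ?y = "complex_of_real y"
    have "(\<lambda>n. (?y - z) * poly (R n) ?y) \<longlonglongrightarrow> (?y - z) * 0" by (intro tendsto_intros conv0)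
    moreover have "(?y - z) * poly (R n) ?y =
        (?y - of_real b) * poly (rpoly (?P (Suc n))) ?y - (z - of_real b) * poly (rpoly (?P (Suc n))) z" for n
      unfolding R_def poly_eq_synthetic_div[symmetric] polyQ ..
    moreover have "(\<lambda>n. (?y - of_real b) * poly (rpoly (?P (Suc n))) ?y - (z - of_real b) * poly (rpoly (?P (Suc n))) z)
        \<longlonglongrightarrow> (?y - of_real b) * kfun b \<epsilon> \<tau> ?y - (z - of_real b) * kfun b \<epsilon> \<tau> z"
      by (intro tendsto_intros LIMSEQ_Suc[OF kpoly_tendsto])
    ultimately have "(?y - of_real b) * kfun b \<epsilon> \<tau> ?y - (z - of_real b) * kfun b \<epsilon> \<tau> z = 0"
      using LIMSEQ_unique by force
    hence "(?y - of_real b) * kfun b \<epsilon> \<tau> ?y = of_real \<epsilon>" using zero by simp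
    hence "complex_of_real ((y - b) * kfun b \<epsilon> \<tau> y) = of_real \<epsilon>" by (simp add: kfun_of_real)
    thus ?thesis by (simp only: of_real_eq_iff)
  qed
  \<comment> \<open>Evaluating the identity at b gives \<epsilon> = 0, so \<open>kfun\<close>
    vanishes off b and, by continuity, at b. There its value is \<tau> times the positive square sum
    of the p_k(b), so \<tau> = 0 as well.\<close>
  have \<epsilon>: "\<epsilon> = 0" using id[of b] by simp
  have "kfun b \<epsilon> \<tau> y = 0" if "y \<noteq> b" for y :: real using id[of y] \<epsilon> that by simp
  hence "(kfun b \<epsilon> \<tau> \<longlongrightarrow> (0::real)) (at b)"
    by (intro tendsto_eventually) (simp add: eventually_at_filter)
  moreover have "(kfun b \<epsilon> \<tau> \<longlongrightarrow> (kfun b \<epsilon> \<tau> b :: real)) (at b)"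
    using continuous_kfun[of b \<epsilon> \<tau>] by (simp add: continuous_on_def)
  ultimately have "kfun b \<epsilon> \<tau> b = (0::real)" using tendsto_unique[OF trivial_limit_at] by blast
  thus False using \<epsilon> ne kfun_atom[of b \<tau>] kernel_diag_pos[of b] by simp
qed

text \<open>The integral F of f / (x - z) is computed twice. The polynomials \<open>kpoly\<close>
  give F = \<open>kfun2\<close> + w \<open>kfun\<close>, where w is the transform, and (x - b) f =
  \<epsilon> gives (z - b) F = \<epsilon> w - \<tau>. Eliminating F determines w, as the resulting
  coefficient of w does not vanish.\<close>

lemma extremal_transform:
  assumes \<mu>: "\<mu> \<in> V s" and f: "extremal_at \<mu> b \<epsilon> \<tau> f" and z: "Im z \<noteq> 0"
  shows "(LINT x|\<mu>. 1 / (complex_of_real x - z)) =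
    (of_real \<tau> + (z - of_real b) * kfun2 b \<epsilon> \<tau> z) / (of_real \<epsilon> - (z - of_real b) * kfun b \<epsilon> \<tau> z)"
proof -
  note hm = V_has_moments[OF \<mu>]
  let ?P = "kpoly b \<epsilon> \<tau>"
  define w where "w = (LINT x|\<mu>. 1 / (complex_of_real x - z))"
  have sq: "sq_integrable \<mu> f" and ae: "AE x in \<mu>. (x - b) * f x = \<epsilon>" and \<tau>: "(LINT x|\<mu>. f x) = \<tau>"
    using f by (auto simp: extremal_at_def poly_approximable_def)
  have [measurable]: "f \<in> borel_measurable \<mu>" using sq by (simp add: sq_integrable_def)
  have [measurable_cong]: "sets \<mu> = sets borel" by (rule has_momentsD(1)[OF hm])
  have fi: "integrable \<mu> f" using sq_integrable_mult[OF sq sq_integrable_poly[OF hm, of 1]] by simp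
  have bd: "norm (1 / (complex_of_real x - z)) \<le> 1 / \<bar>Im z\<bar>" for x
    using abs_Im_le_cmod[of "complex_of_real x - z"] z by (simp add: norm_divide frac_le)
  have int: "integrable \<mu> (\<lambda>x. of_real (g x) / (complex_of_real x - z))"
    and le: "norm (LINT x|\<mu>. of_real (g x) / (complex_of_real x - z)) \<le> (LINT x|\<mu>. \<bar>g x\<bar>) / \<bar>Im z\<bar>"
    if g: "integrable \<mu> g" for g :: "real \<Rightarrow> real"
  proof -
    have [measurable]: "g \<in> borel_measurable \<mu>" using g by simp
    have b: "norm (of_real (g x) / (complex_of_real x - z)) \<le> \<bar>g x\<bar> / \<bar>Im z\<bar>" for x
      using mult_left_mono[OF bd[of x], of "\<bar>g x\<bar>"] by (simp add: norm_divide)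
    have gi: "integrable \<mu> (\<lambda>x. \<bar>g x\<bar> / \<bar>Im z\<bar>)" using g by simp
    show i: "integrable \<mu> (\<lambda>x. of_real (g x) / (complex_of_real x - z))"
      by (rule Bochner_Integration.integrable_bound[OF gi]) (use b in auto)
    have "norm (LINT x|\<mu>. of_real (g x) / (complex_of_real x - z)) \<le> (LINT x|\<mu>. \<bar>g x\<bar> / \<bar>Im z\<bar>)"
      by (rule Bochner_Integration.integral_norm_bound_integral[OF i gi b])
    thus "norm (LINT x|\<mu>. of_real (g x) / (complex_of_real x - z)) \<le> (LINT x|\<mu>. \<bar>g x\<bar>) / \<bar>Im z\<bar>" by simp
  qed
  define F where "F = (LINT x|\<mu>. of_real (f x) / (complex_of_real x - z))"
  have "(\<lambda>n. LINT x|\<mu>. complex_of_real (poly (?P n) x) / (of_real x - z)) \<longlonglongrightarrow> F"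
  proof (rule Lim_null[THEN iffD2], rule Lim_null_comparison)
    let ?e = "\<lambda>n. sqrt (s 0 * (LINT x|\<mu>. (f x - poly (?P n) x)\<^sup>2)) / \<bar>Im z\<bar>"
    have "?e \<longlonglongrightarrow> sqrt (s 0 * 0) / \<bar>Im z\<bar>"
      using z by (intro tendsto_intros kpoly_tendsto_L2[OF \<mu> f]) auto
    thus "?e \<longlonglongrightarrow> 0" by simp
    show "eventually (\<lambda>n. norm ((LINT x|\<mu>. complex_of_real (poly (?P n) x) / (of_real x - z)) - F) \<le> ?e n) sequentially"
    proof (intro always_eventually allI)
      fix n
      have d: "sq_integrable \<mu> (\<lambda>x. f x - poly (?P n) x)"
        by (intro sq_integrable_diff sq sq_integrable_poly hm)
      have di: "integrable \<mu> (\<lambda>x. poly (?P n) x - f x)"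
        using fi integrable_real_poly[OF hm] by simp
      have "(LINT x|\<mu>. complex_of_real (poly (?P n) x) / (of_real x - z)) - F =
          (LINT x|\<mu>. complex_of_real (poly (?P n) x - f x) / (of_real x - z))"
        unfolding F_def using int[OF fi] int[OF integrable_real_poly[OF hm]]
        by (subst Bochner_Integration.integral_diff[symmetric]) (auto simp: diff_divide_distrib)
      also have "norm \<dots> \<le> (LINT x|\<mu>. \<bar>poly (?P n) x - f x\<bar>) / \<bar>Im z\<bar>" by (rule le[OF di])
      also have "(LINT x|\<mu>. \<bar>poly (?P n) x - f x\<bar>) \<le> sqrt (s 0 * (LINT x|\<mu>. (f x - poly (?P n) x)\<^sup>2))"
        using integral_abs_square_le[OF hm d] V_moments[OF \<mu>]
        by (intro real_le_rsqrt) (simp add: abs_minus_commute)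
      finally show "norm ((LINT x|\<mu>. complex_of_real (poly (?P n) x) / (of_real x - z)) - F) \<le> ?e n"
        using z by (simp add: divide_right_mono)
    qed
  qed
  moreover have "(\<lambda>n. LINT x|\<mu>. complex_of_real (poly (?P n) x) / (of_real x - z)) \<longlonglongrightarrow>
      kfun2 b \<epsilon> \<tau> z + kfun b \<epsilon> \<tau> z * w"
    unfolding op_resolvent(2)[OF \<mu> z] w_def[symmetric]
    by (intro tendsto_intros second_kind_kpoly_tendsto kpoly_tendsto)
  ultimately have F: "F = kfun2 b \<epsilon> \<tau> z + kfun b \<epsilon> \<tau> z * w" by (rule LIMSEQ_unique)
  have "(z - of_real b) * F = (LINT x|\<mu>. (z - of_real b) * (of_real (f x) / (complex_of_real x - z)))"
    unfolding F_def by (rule integral_mult_right_zero[symmetric])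
  also have "\<dots> = (LINT x|\<mu>. of_real \<epsilon> * (1 / (complex_of_real x - z)) - of_real (f x))"
  proof (intro integral_cong_AE)
    show "AE x in \<mu>. (z - of_real b) * (of_real (f x) / (complex_of_real x - z)) =
        of_real \<epsilon> * (1 / (complex_of_real x - z)) - of_real (f x)"
      using ae
    proof eventually_elim
      case (elim x)
      have X: "complex_of_real x - z \<noteq> 0" using z by (auto simp: complex_eq_iff)
      have "of_real \<epsilon> = (of_real x - of_real b) * complex_of_real (f x)" unfolding elim[symmetric] by simp
      thus ?case using X by (simp add: divide_simps) (simp add: algebra_simps)
    qed
  qed measurable
  also have "\<dots> = of_real \<epsilon> * w - of_real \<tau>"
    unfolding w_def \<tau>[symmetric] using integrable_resolvent[OF has_momentsD(3,1)[OF hm] z] fi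
    by (subst Bochner_Integration.integral_diff) (auto simp del: times_divide_eq_right mult_1_right)
  finally have "w * (of_real \<epsilon> - (z - of_real b) * kfun b \<epsilon> \<tau> z) = of_real \<tau> + (z - of_real b) * kfun2 b \<epsilon> \<tau> z"
    unfolding F by (simp add: algebra_simps)
  thus ?thesis using kfun_nonvanishing[OF \<mu> f z] by (simp add: w_def field_simps)
qed

text \<open>The formula of \<open>extremal_transform\<close> contains only s, b, \<epsilon> and
  \<tau>; neither the measure nor f occurs in it.\<close>

lemma extremal_unique:
  assumes "\<mu> \<in> V s" "extremal_at \<mu> b \<epsilon> \<tau> f" "\<nu> \<in> V s" "extremal_at \<nu> b \<epsilon> \<tau> g"
  shows "\<mu> = \<nu>"
proof (rule stieltjes_transform_unique)
  show "(LINT x|\<mu>. 1 / (complex_of_real x - z)) = (LINT x|\<nu>. 1 / (complex_of_real x - z))" if "Im z > 0" for z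
    using extremal_transform[OF assms(1,2), of z] extremal_transform[OF assms(3,4), of z] that by simp
qed (use assms has_momentsD(1,3)[OF V_has_moments] in auto)

text \<open>The pair \<open>(\<epsilon>, \<tau>)\<close> belonging to the parameter \<open>t \<in> \<real> \<union> {\<infinity>}\<close>.\<close>

definition par_eps :: "ereal \<Rightarrow> real" where "par_eps t = (if t = \<infinity> then 0 else 1)"
definition par_tau :: "ereal \<Rightarrow> real" where "par_tau t = (if t = \<infinity> then 1 else real_of_ereal t)"

text \<open>For b = 0 and finite t the fraction in \<open>extremal_transform\<close> has numerator A
  + t C and denominator -(B + t D), for t = \<infinity> it has C and -D. With Stieltjes uniqueness
  this resolves the description in \<open>mu_ext\<close>: any statement about it reduces to
  exhibiting one extremal measure.\<close>

lemma mu_ext_eqI: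
  assumes \<mu>: "\<mu> \<in> V s" and f: "extremal_at \<mu> 0 (par_eps t) (par_tau t) f"
  shows "mu_ext s t = \<mu>"
proof -
  have sum: "summable (\<lambda>k. of_real (qfun s k 0) * pfun s k z)" "summable (\<lambda>k. of_real (pfun s k 0) * pfun s k z)"
    "summable (\<lambda>k. of_real (qfun s k 0) * qfun s k z)" "summable (\<lambda>k. of_real (pfun s k 0) * qfun s k z)" for z :: complex
    using kfun_summable[of 0 1 0 z] kfun_summable[of 0 0 1 z] kfun2_summable[of 0 1 0 z] kfun2_summable[of 0 0 1 z]
    by (simp_all add: kcoeff_def)
  have k: "kfun 0 e a z = of_real e * (\<Sum>k. of_real (qfun s k 0) * pfun s k z) + of_real a * (\<Sum>k. of_real (pfun s k 0) * pfun s k z)"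
    "kfun2 0 e a z = of_real e * (\<Sum>k. of_real (qfun s k 0) * qfun s k z) + of_real a * (\<Sum>k. of_real (pfun s k 0) * qfun s k z)"
    for e a and z :: complex
    unfolding kfun_def kfun2_def kcoeff_def
    by (simp_all add: distrib_right mult.assoc suminf_add[symmetric] suminf_mult sum summable_mult)
  have q0: "qfun s n (0::complex) = of_real (qfun s n 0)" "pfun s n (0::complex) = of_real (pfun s n 0)" for n
    using qfun_of_real[of n 0, where 'a = complex] pfun_of_real[of n 0, where 'a = complex] by simp_all
  have tr: "(LINT x|\<mu>. 1 / (complex_of_real x - z)) = nev_transform s t z" if "z \<notin> \<real>" for z
  proof -
    have z: "Im z \<noteq> 0" using that by (simp add: complex_is_Real_iff)
    define N where "N = of_real (par_tau t) + (z - of_real 0) * kfun2 0 (par_eps t) (par_tau t) z"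
    define M where "M = of_real (par_eps t) - (z - of_real 0) * kfun 0 (par_eps t) (par_tau t) z"
    have "(LINT x|\<mu>. 1 / (complex_of_real x - z)) = N / M"
      unfolding N_def M_def by (rule extremal_transform[OF \<mu> f z])
    also have "\<dots> = - (N / (- M))" by simp
    also have "\<dots> = nev_transform s t z"
      unfolding nev_transform_def nev_A_def nev_B_def nev_C_def nev_D_def q0 N_def M_def k
      by (auto simp: par_eps_def par_tau_def algebra_simps intro!: arg_cong2[where f = "(/)"])
    finally show ?thesis .
  qed
  show ?thesis unfolding mu_ext_def
  proof (rule the_equality)
    show "\<mu> \<in> V s \<and> (\<forall>z. z \<notin> \<real> \<longrightarrow> (LINT x|\<mu>. 1 / (complex_of_real x - z)) = nev_transform s t z)"
      using \<mu> tr by blast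
    fix \<nu> assume \<nu>: "\<nu> \<in> V s \<and> (\<forall>z. z \<notin> \<real> \<longrightarrow> (LINT x|\<nu>. 1 / (complex_of_real x - z)) = nev_transform s t z)"
    show "\<nu> = \<mu>"
      by (rule stieltjes_transform_unique) (use \<nu> \<mu> tr has_momentsD(1,3)[OF V_has_moments] in \<open>auto simp: complex_is_Real_iff\<close>)
  qed
qed

end

section \<open>Quadrature formulas\<close>

lemma moment_functional_monom: "moment_functional s (monom c n) = c * of_real (s n)"
proof -
  have "moment_functional s (monom c n) = (\<Sum>i\<le>n. if i = n then c * of_real (s i) else 0)"
    unfolding moment_functional_eq_sum[OF degree_monom_le] by (intro sum.cong) auto
  thus ?thesis by simp
qed

text \<open>The cofactor g has degree below n, so Q g integrates to 0, although it is a sum of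
  squares. The form (x - a)^2 + c^2 covers a double real zero (c = 0) and a conjugate pair at
  once.\<close>

lemma (in moment_sequence) no_nonneg_quadratic_factor:
  assumes Q: "Q \<noteq> 0" "degree Q \<le> Suc n" and orth: "\<And>r. degree r < n \<Longrightarrow> L (Q * r) = 0" and n: "n > 0"
  shows "\<not> ([:-a, 1:] * [:-a, 1:] + [:c\<^sup>2:]) dvd (Q :: real poly)"
proof
  let ?l = "[:-a, 1:] :: real poly"
  define h where "h = ?l * ?l + [:c\<^sup>2:]"
  assume "?l * ?l + [:c\<^sup>2:] dvd Q"
  then obtain g where g: "Q = h * g" by (auto simp: h_def dvd_def)
  have "g \<noteq> 0" using g Q by auto
  have h: "h = [:a * a + c\<^sup>2, - 2 * a, 1:]" by (simp add: h_def)
  hence "degree h = 2" "h \<noteq> 0" by auto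
  hence "degree Q = 2 + degree g" unfolding g using \<open>g \<noteq> 0\<close> by (subst degree_mult_eq) auto
  hence "degree g < n" using Q n by simp
  hence "0 = L (Q * g)" using orth by simp
  also have "Q * g = (?l * g) * (?l * g) + smult (c\<^sup>2) (g * g)"
    unfolding g h_def distrib_right by (simp only: mult_ac) simp
  also have "L \<dots> = L ((?l * g) * (?l * g)) + c\<^sup>2 * L (g * g)"
    by (simp only: moment_functional_linear)
  also have "\<dots> > 0"
    using \<open>g \<noteq> 0\<close> by (intro add_pos_nonneg mult_nonneg_nonneg L_square_pos L_square_nonneg) (auto simp del: mult_pCons_left)
  finally show False by simp
qed

text \<open>A nonreal zero z would give the forbidden quadratic factor with c = Im z, a multiple
  zero the one with c = 0; so the complex factorisation has real and simple zeros only.\<close>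

lemma (in moment_sequence) quasi_orthogonal_roots:
  assumes Q: "Q \<noteq> 0" "degree Q \<le> Suc n" and orth: "\<And>r. degree r < n \<Longrightarrow> L (Q * r) = 0" and n: "n > 0"
  shows "card {y::real. poly Q y = 0} = degree Q"
proof -
  let ?Q = "rpoly Q :: complex poly"
  note nofac = no_nonneg_quadratic_factor[OF assms]
  have real: "Im z = 0" if "poly ?Q z = 0" for z
  proof (rule ccontr)
    assume z: "Im z \<noteq> 0"
    define h where "h = [:- Re z, 1:] * [:- Re z, 1:] + [:(Im z)\<^sup>2:]"
    have dh: "h = [:Re z * Re z + (Im z)\<^sup>2, - 2 * Re z, 1:]" by (simp add: h_def)
    have hz: "poly (rpoly h) z = 0"
      unfolding dh by (simp add: map_poly_pCons complex_eq_iff power2_eq_square algebra_simps)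
    define r where "r = Q mod h"
    have "degree r < 2" using degree_mod_less[of h Q] dh by (auto simp: r_def)
    then obtain a b where r: "r = [:a, b:]"
      by (metis degree_pCons_eq_if lessI less_2_cases not_less_iff_gr_or_eq one_add_one pCons_cases degree_eq_zeroE
          Suc_1 Suc_less_eq less_Suc0 pCons_0_0)
    have "Q = h * (Q div h) + r" by (simp add: r_def)
    hence "poly ?Q z = poly (rpoly h) z * poly (rpoly (Q div h)) z + poly (rpoly r) z"
      by (metis poly_add poly_mult rpoly_add rpoly_mult)
    hence "poly (rpoly r) z = 0" using that hz by simp
    hence "complex_of_real a + z * of_real b = 0" by (simp add: r map_poly_pCons)
    hence "a = 0" "b = 0" using z by (auto simp: complex_eq_iff)
    hence "h dvd Q" using r by (simp add: r_def dvd_eq_mod_eq_0)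
    thus False using nofac[of "Re z" "Im z"] by (simp only: h_def)
  qed
  have sqf: "rsquarefree ?Q"
    unfolding rsquarefree_roots
  proof (intro allI notI, elim conjE)
    fix z assume z: "poly ?Q z = 0" "poly (pderiv ?Q) z = 0"
    define y where "y = Re z"
    have zy: "z = of_real y" using real[OF z(1)] by (simp add: y_def complex_eq_iff)
    have "pderiv ?Q = rpoly (pderiv Q)" by (simp add: poly_eq_iff coeff_pderiv)
    hence y: "poly Q y = 0" "poly (pderiv Q) y = 0"
      using z unfolding zy by simp_all
    obtain g where g: "Q = [:-y, 1:] * g" using y(1) by (auto simp: poly_eq_0_iff_dvd)
    have "poly g y = 0" using y(2) unfolding g pderiv_mult by (simp add: pderiv_pCons del: mult_pCons_left)
    then obtain k where "g = [:-y, 1:] * k" by (auto simp: poly_eq_0_iff_dvd)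
    hence "[:-y, 1:] * [:-y, 1:] + [:0\<^sup>2:] dvd Q" unfolding g by (simp add: mult.assoc[symmetric] del: mult_pCons_left)
    thus False using nofac[of y 0] by simp
  qed
  have "degree Q = degree (\<Prod>z | poly ?Q z = 0. [:-z, 1:])"
    using complex_poly_decompose_rsquarefree[OF sqf] Q(1)
    by (metis degree_rpoly degree_smult_eq leading_coeff_0_iff rpoly_eq_0_iff)
  also have "\<dots> = card {z. poly ?Q z = 0}" by (subst degree_prod_eq_sum_degree) auto
  also have "{z. poly ?Q z = 0} = complex_of_real ` {y. poly Q y = 0}"
  proof (intro equalityI subsetI)
    fix z assume "z \<in> {z. poly ?Q z = 0}"
    hence z: "poly ?Q z = 0" by simp
    hence "z = of_real (Re z)" using real[OF z] by (simp add: complex_eq_iff)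
    moreover have "poly Q (Re z) = 0" using z calculation by (metis of_real_eq_0_iff poly_rpoly)
    ultimately show "z \<in> complex_of_real ` {y. poly Q y = 0}" by blast
  qed auto
  also have "card \<dots> = card {y. poly Q y = 0}" by (intro card_image) (simp add: inj_on_def)
  finally show ?thesis by simp
qed

text \<open>The weights integrate the Lagrange polynomials. Division by Q gives exactness beyond the
  degree of Q, since the quotient has degree below n. The square of a Lagrange polynomial has degree
  at most 2 (deg Q - 1) < deg Q + n, because deg Q <= n + 1, so it is integrated exactly and its
  integral is the weight.\<close>

lemma (in moment_sequence) quadrature_exists:
  assumes Q: "Q \<noteq> 0" "degree Q \<le> Suc n" and orth: "\<And>r. degree r < n \<Longrightarrow> L (Q * r) = 0" and n: "n > 0"
  shows "\<exists>m::real \<Rightarrow> real. (\<forall>y. poly Q y = 0 \<longrightarrow> m y > 0) \<and>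
    (\<forall>p. degree p < degree Q + n \<longrightarrow> (\<Sum>y | poly Q y = 0. m y * poly p y) = L p)"
proof -
  define Z where "Z = {y. poly Q y = 0}"
  have fin: "finite Z" using Q(1) by (simp add: Z_def poly_roots_finite)
  have card: "card Z = degree Q" unfolding Z_def by (rule quasi_orthogonal_roots[OF assms])
  define lag where "lag y = smult (1 / (\<Prod>x\<in>Z - {y}. y - x)) (\<Prod>x\<in>Z - {y}. [:-x, 1:])" for y
  have lag: "poly (lag y) x = (if x = y then 1 else 0)" if "x \<in> Z" "y \<in> Z" for x y
    using that fin by (auto simp: lag_def poly_prod)
  have deglag: "degree (lag y) < degree Q" if "y \<in> Z" for y
  proof -
    have "degree (lag y) \<le> degree (\<Prod>x\<in>Z - {y}. [:-x, 1:])" unfolding lag_def by (rule degree_smult_le)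
    also have "\<dots> = card (Z - {y})" by (subst degree_prod_eq_sum_degree) auto
    also have "\<dots> < card Z" using that fin by (intro psubset_card_mono) auto
    finally show ?thesis by (simp add: card)
  qed
  define m where "m y = L (lag y)" for y
  have exact: "(\<Sum>y\<in>Z. m y * poly p y) = L p" if p: "degree p < degree Q + n" for p
  proof -
    define r where "r = p mod Q"
    define g where "g = p div Q"
    have pr: "p = Q * g + r" by (simp add: r_def g_def)
    have dQ: "degree Q > 0"
    proof (rule ccontr)
      assume "\<not> degree Q > 0"
      hence "L (Q * Q) = 0" using n by (intro orth) auto
      thus False using L_square_pos[OF Q(1)] by simp
    qed
    have dr: "degree r < degree Q" using degree_mod_less'[OF Q(1), of p] dQ unfolding r_def by (cases "p mod Q = 0") auto
    have "L (Q * g) = 0"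
    proof (cases "g = 0")
      case False
      have "degree (Q * g) \<le> max (degree p) (degree r)" using pr degree_diff_le_max[of p r] by simp
      hence "degree Q + degree g < degree Q + n" using p dr Q(1) False n by (simp add: degree_mult_eq)
      thus ?thesis by (intro orth) simp
    qed simp
    hence "L p = L r" by (subst pr) (simp add: moment_functional_linear)
    also have "r = (\<Sum>y\<in>Z. smult (poly r y) (lag y))"
    proof (rule poly_eqI_degree[of Z])
      fix x assume x: "x \<in> Z"
      have "poly (\<Sum>y\<in>Z. smult (poly r y) (lag y)) x = (\<Sum>y\<in>Z. poly r y * (if x = y then 1 else 0))"
        using x by (simp add: poly_sum lag)
      also have "\<dots> = (\<Sum>y\<in>Z. if x = y then poly r y else 0)" by (intro sum.cong) auto
      also have "\<dots> = poly r x" using x fin by simp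
      finally show "poly r x = poly (\<Sum>y\<in>Z. smult (poly r y) (lag y)) x" by simp
    next
      show "degree r < card Z" using dr card by simp
      show "degree (\<Sum>y\<in>Z. smult (poly r y) (lag y)) < card Z"
        unfolding card by (intro degree_sum_less dQ) (use deglag degree_smult_le le_less_trans in blast)
    qed
    also have "L \<dots> = (\<Sum>y\<in>Z. m y * poly r y)"
      by (simp add: moment_functional_linear m_def mult.commute)
    also have "\<dots> = (\<Sum>y\<in>Z. m y * poly p y)"
      by (intro sum.cong refl) (subst pr, simp add: Z_def)
    finally show ?thesis by simp
  qed
  have "m y > 0" if y: "y \<in> Z" for y
  proof -
    have "degree (lag y * lag y) < degree Q + n"
      using degree_mult_le[of "lag y" "lag y"] deglag[OF y] Q(2) by linarith
    hence "L (lag y * lag y) = (\<Sum>x\<in>Z. m x * poly (lag y * lag y) x)" by (rule exact[symmetric])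
    also have "\<dots> = (\<Sum>x\<in>Z. if x = y then m x else 0)" using y by (intro sum.cong) (auto simp: lag)
    also have "\<dots> = m y" using y fin by simp
    finally have "m y = L (lag y * lag y)" by simp
    moreover have "lag y \<noteq> 0" using lag[OF y y] by auto
    ultimately show ?thesis using L_square_pos by simp
  qed
  thus ?thesis using exact by (auto simp: Z_def)
qed

section \<open>Weak limits of quadrature formulas\<close>

text \<open>A continuous trapezoid, for R >= 1 equal to 1 where \<bar>x\<bar> <= R - 1. It makes any
  continuous function an admissible test function for weak convergence, and it increases with
  R.\<close>

definition cutoff :: "real \<Rightarrow> real \<Rightarrow> real" where
  "cutoff R x = max 0 (min 1 (R - \<bar>x\<bar>))"

lemma cutoff_bounds: "0 \<le> cutoff R x" "cutoff R x \<le> 1"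
  by (auto simp: cutoff_def)

lemma cutoff_eq_0: "\<bar>x\<bar> \<ge> R \<Longrightarrow> cutoff R x = 0"
  by (auto simp: cutoff_def)

lemma continuous_cutoff [continuous_intros]: "continuous_on A (cutoff R)"
  unfolding cutoff_def by (intro continuous_intros)

lemma cutoff_times_bounded:
  assumes "continuous_on UNIV (h :: real \<Rightarrow> real)"
  shows "\<exists>B. \<forall>x. \<bar>cutoff R x * h x\<bar> \<le> B"
proof -
  have "compact (h ` cball 0 R)" using assms by (intro compact_continuous_image continuous_on_subset[OF assms]) auto
  then obtain B where B: "\<And>x. x \<in> cball 0 R \<Longrightarrow> \<bar>h x\<bar> \<le> B"
    using compact_imp_bounded bounded_iff by (metis imageI real_norm_def)
  have "\<bar>cutoff R x * h x\<bar> \<le> max 0 B" for x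
  proof (cases "\<bar>x\<bar> \<ge> R")
    case True thus ?thesis by (simp add: cutoff_eq_0)
  next
    case False
    hence "\<bar>h x\<bar> \<le> B" by (intro B) auto
    have "\<bar>cutoff R x * h x\<bar> \<le> 1 * \<bar>h x\<bar>"
      unfolding abs_mult using cutoff_bounds[of R x] by (intro mult_right_mono) auto
    with \<open>\<bar>h x\<bar> \<le> B\<close> show ?thesis by simp
  qed
  thus ?thesis by blast
qed

lemma integrable_bounded_continuous:
  assumes "finite_measure \<mu>" "sets \<mu> = sets borel" "continuous_on UNIV (h :: real \<Rightarrow> real)" "\<And>x. \<bar>h x\<bar> \<le> B"
  shows "integrable \<mu> h"
  using assms borel_measurable_continuous_onI[OF assms(3)]
  by (intro finite_measure.integrable_const_bound[where B = B]) (auto cong: measurable_cong_sets)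

lemma integrable_cutoff:
  assumes "finite_measure \<mu>" "sets \<mu> = sets borel" "continuous_on UNIV (h :: real \<Rightarrow> real)"
  shows "integrable \<mu> (\<lambda>x. cutoff R x * h x)"
proof -
  obtain B where B: "\<And>x. \<bar>cutoff R x * h x\<bar> \<le> B" using cutoff_times_bounded[OF assms(3)] by blast
  show ?thesis by (rule integrable_bounded_continuous[OF assms(1,2) _ B]) (intro continuous_intros assms(3))
qed

lemma integrable_from_cutoff:
  assumes fin: "finite_measure \<mu>" and sets: "sets \<mu> = sets borel"
    and h: "continuous_on UNIV (h :: real \<Rightarrow> real)" "\<And>x. h x \<ge> 0"
    and bd: "\<And>R::nat. (LINT x|\<mu>. cutoff R x * h x) \<le> C"
  shows "integrable \<mu> h" "(LINT x|\<mu>. h x) \<le> C"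
proof -
  define f where "f i x = cutoff (real i) x * h x" for i x
  have int: "integrable \<mu> (f i)" for i unfolding f_def by (rule integrable_cutoff[OF fin sets h(1)])
  have mono: "f i x \<le> f j x" if "i \<le> j" for i j x
    unfolding f_def using that by (intro mult_right_mono h(2)) (auto simp: cutoff_def)
  have lim: "(\<lambda>i. f i x) \<longlonglongrightarrow> h x" for x
  proof (rule tendsto_eventually)
    have "eventually (\<lambda>i. real i \<ge> \<bar>x\<bar> + 1) sequentially" by real_asymp
    thus "eventually (\<lambda>i. f i x = h x) sequentially"
      by eventually_elim (auto simp: f_def cutoff_def)
  qed
  have "incseq (\<lambda>i. LINT x|\<mu>. f i x)"
    by (auto simp: incseq_def intro!: integral_mono int mono)
  then obtain l where l: "(\<lambda>i. LINT x|\<mu>. f i x) \<longlonglongrightarrow> l" "\<And>i. (LINT x|\<mu>. f i x) \<le> l"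
    using incseq_convergent[of "\<lambda>i. LINT x|\<mu>. f i x" C] bd by (auto simp: f_def)
  have "l \<le> C" using l(1) bd by (intro LIMSEQ_le_const2[OF l(1)]) (auto simp: f_def)
  have meas: "h \<in> borel_measurable \<mu>"
    using borel_measurable_continuous_onI[OF h(1)] sets by (simp cong: measurable_cong_sets)
  have m: "AE x in \<mu>. mono (\<lambda>i. f i x)" using mono by (simp add: mono_def)
  have li: "AE x in \<mu>. (\<lambda>i. f i x) \<longlonglongrightarrow> h x" using lim by simp
  show "integrable \<mu> h" by (rule integrable_monotone_convergence[OF int m li l(1) meas])
  show "(LINT x|\<mu>. h x) \<le> C"
    using integral_monotone_convergence[OF int m li l(1) meas] \<open>l \<le> C\<close> by simp
qed

lemma integral_density_const:
  fixes f :: "real \<Rightarrow> 'a::{banach, second_countable_topology}"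
  assumes "f \<in> borel_measurable M" "c \<ge> 0"
  shows "(LINT x|density M (\<lambda>_. ennreal c). f x) = c *\<^sub>R (LINT x|M. f x)"
  using assms by (subst integral_density) auto

text \<open>Weak convergence stated for the weighted sums, so that the point measures and their
  normalisation to mass 1 stay inside \<open>quadrature_limit\<close>.\<close>

definition quadrature_converges :: "(nat \<Rightarrow> real set) \<Rightarrow> (nat \<Rightarrow> real \<Rightarrow> real) \<Rightarrow> real measure \<Rightarrow> bool" where
  "quadrature_converges Z m \<mu> \<longleftrightarrow> (\<forall>h B. continuous_on UNIV h \<longrightarrow> (\<forall>x. \<bar>h x\<bar> \<le> B) \<longrightarrow>
     (\<lambda>n. \<Sum>y\<in>Z n. m n y * h y) \<longlonglongrightarrow> (LINT x|\<mu>. h x))"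

lemma quadrature_convergesD:
  "quadrature_converges Z m \<mu> \<Longrightarrow> continuous_on UNIV h \<Longrightarrow> (\<And>x. \<bar>h x\<bar> \<le> B) \<Longrightarrow>
    (\<lambda>n. \<Sum>y\<in>Z n. m n y * h y) \<longlonglongrightarrow> (LINT x|\<mu>. h x)"
  unfolding quadrature_converges_def by blast

text \<open>Helly selection. Exactness up to degree n + 2 gives every formula the second moment s_2,
  hence tightness. Weak convergence does not carry moments along by itself; the fixed moment of
  order 2k controls the loss when x^k is truncated.\<close>

lemma (in moment_sequence) quadrature_limit:
  assumes fin: "\<And>n. finite (Z n)" and pos: "\<And>n y. y \<in> Z n \<Longrightarrow> m n y \<ge> (0::real)"
    and exact: "\<And>n p. degree p \<le> n + 2 \<Longrightarrow> (\<Sum>y\<in>Z n. m n y * poly p y) = L p"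
  shows "\<exists>\<mu> r. \<mu> \<in> V s \<and> strict_mono (r :: nat \<Rightarrow> nat) \<and> quadrature_converges (Z \<circ> r) (m \<circ> r) \<mu>"
proof -
  have s0: "s 0 > 0" by (rule mass_pos)
  define P where "P n = point_measure (Z n) (\<lambda>y. ennreal (m n y / s 0))" for n
  define M where "M n = distr (P n) borel (\<lambda>x. x)" for n
  have idP: "(\<lambda>x. x) \<in> P n \<rightarrow>\<^sub>M borel" for n by (simp add: P_def)
  have setsM [simp, measurable_cong]: "sets (M n) = sets borel" for n by (simp add: M_def)
  have intM: "(LINT x|M n. h x) = (\<Sum>y\<in>Z n. m n y * h y) / s 0" if "h \<in> borel_measurable borel" for n and h :: "real \<Rightarrow> real"
    unfolding M_def integral_distr[OF idP that] using fin[of n] pos[of _ n] s0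
    by (simp add: P_def lebesgue_integral_point_measure_finite sum_divide_distrib)
  have mass: "(\<Sum>y\<in>Z n. m n y) = s 0" for n using exact[of 1 n] by (simp add: one_pCons)
  have rd: "real_distribution (M n)" for n
  proof -
    have "emeasure (P n) (space (P n)) = (\<Sum>y\<in>Z n. ennreal (m n y / s 0))"
      unfolding P_def space_point_measure using fin by (subst emeasure_point_measure_finite) auto
    also have "\<dots> = ennreal (\<Sum>y\<in>Z n. m n y / s 0)" using pos s0 by (subst sum_ennreal) auto
    also have "\<dots> = 1" using mass[of n] s0 by (simp add: sum_divide_distrib[symmetric])
    finally interpret prob_space "P n" by (intro prob_spaceI)
    show ?thesis
      unfolding M_def real_distribution_def real_distribution_axioms_def by (auto intro!: prob_space_distr idP)
  qed
  have tight: "tight M"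
    unfolding tight_def
  proof (intro conjI allI impI rd)
    fix \<epsilon> :: real assume \<epsilon>: "\<epsilon> > 0"
    \<comment> \<open>By Chebyshev's inequality the mass outside {-R<..R} is at most s_2 / (s_0
      R^2); the summand 1 makes the comparison with \<epsilon> strict.\<close>
    define R where "R = sqrt (s 2 / (s 0 * \<epsilon>)) + 1"
    have s2: "s 2 \<ge> 0" using L_square_nonneg[of "[:0, 1:]"] by (simp add: moment_functional_def numeral_2_eq_2)
    have R: "R > 0" unfolding R_def using s2 s0 \<epsilon> by (intro add_nonneg_pos) auto
    have R2: "s 2 / (s 0 * R\<^sup>2) < \<epsilon>"
    proof -
      have "s 2 / (s 0 * \<epsilon>) = (sqrt (s 2 / (s 0 * \<epsilon>)))\<^sup>2" using s2 s0 \<epsilon> by simp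
      also have "\<dots> < R\<^sup>2" unfolding R_def using s2 s0 \<epsilon> by (intro power_strict_mono) auto
      finally show ?thesis using s0 \<epsilon> R by (simp add: field_simps)
    qed
    have "measure (M n) {-R<..R} > 1 - \<epsilon>" for n
    proof -
      interpret real_distribution "M n" by (rule rd)
      have "1 - measure (M n) {-R<..R} = (LINT x|M n. 1 - indicator {-R<..R} x)"
        using prob_space by (subst Bochner_Integration.integral_diff) (auto intro!: integrable_const_bound[where B = 1])
      also have "\<dots> = (\<Sum>y\<in>Z n. m n y * (1 - indicator {-R<..R} y)) / s 0" by (rule intM) simp
      also have "\<dots> \<le> (\<Sum>y\<in>Z n. m n y * (y\<^sup>2 / R\<^sup>2)) / s 0"
      proof (intro divide_right_mono sum_mono mult_left_mono)
        fix y
        show "1 - indicator {-R<..R} y \<le> y\<^sup>2 / R\<^sup>2"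
        proof (cases "y \<in> {-R<..R}")
          case False
          hence "R \<le> \<bar>y\<bar>" by auto
          hence "R\<^sup>2 \<le> y\<^sup>2" using R by (metis abs_le_square_iff abs_of_pos)
          thus ?thesis using R False by simp
        qed simp
      qed (use pos s0 in auto)
      also have "\<dots> = (\<Sum>y\<in>Z n. m n y * poly (monom 1 2) y) / R\<^sup>2 / s 0"
        by (simp add: sum_divide_distrib poly_monom)
      also have "(\<Sum>y\<in>Z n. m n y * poly (monom 1 2) y) = s 2"
        by (subst exact) (auto simp: degree_monom_eq moment_functional_def numeral_2_eq_2)
      also have "s 2 / R\<^sup>2 / s 0 < \<epsilon>" using R2 by (simp add: mult.commute)
      finally show ?thesis by simp
    qed
    thus "\<exists>a b. a < b \<and> (\<forall>n. 1 - \<epsilon> < measure (M n) {a<..b})"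
      using R by (intro exI[of _ "-R"] exI[of _ R]) auto
  qed
  obtain r N where r: "strict_mono (r :: nat \<Rightarrow> nat)" and N: "real_distribution N" and wc: "weak_conv_m (M \<circ> id \<circ> r) N"
    using tight_imp_convergent_subsubsequence[OF tight strict_mono_id] by blast
  interpret N: real_distribution N by fact
  define \<mu> where "\<mu> = density N (\<lambda>_. ennreal (s 0))"
  have sets\<mu> [simp, measurable_cong]: "sets \<mu> = sets borel" by (simp add: \<mu>_def)
  have int\<mu>: "(LINT x|\<mu>. h x) = s 0 * (LINT x|N. h x)" if "h \<in> borel_measurable borel" for h :: "real \<Rightarrow> real"
    unfolding \<mu>_def using that s0 by (subst integral_density_const) auto
  have fin\<mu>: "finite_measure \<mu>"
  proof (rule finite_measureI)
    have "emeasure \<mu> (space \<mu>) = ennreal (s 0) * emeasure N (space N)"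
      unfolding \<mu>_def by (subst emeasure_density) (auto simp: nn_integral_cmult_indicator)
    thus "emeasure \<mu> (space \<mu>) \<noteq> \<infinity>" by (simp only: N.emeasure_space_1) simp
  qed
  have conv: "(\<lambda>n. \<Sum>y\<in>Z (r n). m (r n) y * h y) \<longlonglongrightarrow> (LINT x|\<mu>. h x)"
    if h: "continuous_on UNIV h" and B: "\<And>x. \<bar>h x\<bar> \<le> B" for h :: "real \<Rightarrow> real" and B
  proof -
    have hm: "h \<in> borel_measurable borel" using h by (rule borel_measurable_continuous_onI)
    have "(\<lambda>n. integral\<^sup>L ((M \<circ> id \<circ> r) n) h) \<longlonglongrightarrow> integral\<^sup>L N h"
    proof (rule weak_conv_imp_integral_bdd_continuous_conv[OF _ N wc])
      show "real_distribution ((M \<circ> id \<circ> r) n)" for n by (simp add: rd)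
      show "norm (h x) \<le> B" for x using B by simp
      show "isCont h x" for x using h by (simp add: continuous_on_eq_continuous_at)
    qed
    hence "(\<lambda>n. s 0 * ((\<Sum>y\<in>Z (r n). m (r n) y * h y) / s 0)) \<longlonglongrightarrow> s 0 * integral\<^sup>L N h"
      by (intro tendsto_intros) (simp add: intM[OF hm])
    thus ?thesis using s0 by (simp add: int\<mu>[OF hm])
  qed
  have cut: "(LINT x|\<mu>. cutoff R x * (x ^ k)\<^sup>2) \<le> L (monom 1 (2 * k))" for k R :: nat
  proof -
    obtain B where B: "\<And>x. \<bar>cutoff R x * (x ^ k)\<^sup>2\<bar> \<le> B"
      using cutoff_times_bounded[of "\<lambda>x. (x ^ k)\<^sup>2" R, OF continuous_on_power[OF continuous_on_power[OF continuous_on_id]]]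
      by auto
    show ?thesis
    proof (rule LIMSEQ_le_const2[OF conv[OF _ B]])
      show "continuous_on UNIV (\<lambda>x. cutoff R x * (x ^ k)\<^sup>2)" by (intro continuous_intros)
      show "\<exists>N. \<forall>n\<ge>N. (\<Sum>y\<in>Z (r n). m (r n) y * (cutoff R y * (y ^ k)\<^sup>2)) \<le> L (monom 1 (2 * k))"
      proof (intro exI allI impI)
        fix n assume n: "n \<ge> 2 * k"
        have "(\<Sum>y\<in>Z (r n). m (r n) y * (cutoff R y * (y ^ k)\<^sup>2)) \<le> (\<Sum>y\<in>Z (r n). m (r n) y * (1 * (y ^ k)\<^sup>2))"
          by (intro sum_mono mult_left_mono mult_right_mono pos cutoff_bounds) auto
        also have "\<dots> = (\<Sum>y\<in>Z (r n). m (r n) y * poly (monom 1 (2 * k)) y)"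
          by (simp add: poly_monom power_mult[symmetric] mult.commute)
        also have "\<dots> = L (monom 1 (2 * k))"
          using n seq_suble[OF r, of n] by (intro exact) (simp add: degree_monom_eq)
        finally show "(\<Sum>y\<in>Z (r n). m (r n) y * (cutoff R y * (y ^ k)\<^sup>2)) \<le> L (monom 1 (2 * k))" .
      qed
    qed
  qed
  have even: "integrable \<mu> (\<lambda>x. (x ^ k)\<^sup>2)" "(LINT x|\<mu>. (x ^ k)\<^sup>2) \<le> L (monom 1 (2 * k))" for k
    by (rule integrable_from_cutoff[OF fin\<mu> sets\<mu> _ _ cut]; auto intro!: continuous_intros)+
  have hm: "has_moments \<mu>"
    unfolding has_moments_def
  proof (intro conjI allI)
    fix k
    interpret finite_measure \<mu> by (rule fin\<mu>)
    show "integrable \<mu> (\<lambda>x. x ^ k)"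
    proof (rule Bochner_Integration.integrable_bound)
      show "integrable \<mu> (\<lambda>x. 1 + (x ^ k)\<^sup>2)" using even(1)[of k] by simp
      have "\<bar>t\<bar> \<le> 1 + t\<^sup>2" for t :: real
        using sum_squares_bound[of 1 "\<bar>t\<bar>"] by simp
      thus "AE x in \<mu>. norm (x ^ k) \<le> norm (1 + (x ^ k)\<^sup>2)" by (auto simp: abs_of_nonneg)
    qed measurable
  qed simp
  have "moments \<mu> k = s k" for k
  proof -
    define c where "c = L (monom 1 (2 * k) :: real poly)"
    have c0: "c \<ge> 0" using order_trans[OF _ even(2)[of k]] by (simp add: c_def)
    \<comment> \<open>The truncation of x^k at height R is bounded and continuous and errs by at
      most x^(2k) / R, which has the same integral bound c / R for the formulas and for the
      limit.\<close>
    define g where "g R x = max (- R) (min R (x ^ k))" for R x :: real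
    have gdiff: "\<bar>x ^ k - g R x\<bar> \<le> (x ^ k)\<^sup>2 / R" if "R > 0" for R x
    proof -
      have "\<bar>t - max (- R) (min R t)\<bar> \<le> t\<^sup>2 / R" for t
      proof (cases "\<bar>t\<bar> \<le> R")
        case True thus ?thesis using that by (auto simp: max_def min_def)
      next
        case False
        hence "\<bar>t - max (- R) (min R t)\<bar> \<le> \<bar>t\<bar>" using that by (auto simp: max_def min_def)
        moreover have "\<bar>t\<bar> * R \<le> \<bar>t\<bar> * \<bar>t\<bar>" using False by (intro mult_left_mono) auto
        hence "\<bar>t\<bar> \<le> t\<^sup>2 / R" using that by (simp add: field_simps power2_eq_square)
        ultimately show ?thesis by simp
      qed
      thus ?thesis by (simp add: g_def)
    qed
    have gcont: "continuous_on UNIV (g R)" for R unfolding g_def by (intro continuous_intros)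
    have gbd: "\<bar>g R x\<bar> \<le> \<bar>R\<bar>" for R x by (auto simp: g_def max_def min_def)
    have "\<bar>moments \<mu> k - s k\<bar> \<le> 2 * c / R" if R: "R > 0" for R
    proof -
      have ig: "integrable \<mu> (g R)" by (rule integrable_bounded_continuous[OF fin\<mu> sets\<mu> gcont gbd])
      have "\<bar>moments \<mu> k - (LINT x|\<mu>. g R x)\<bar> = \<bar>LINT x|\<mu>. x ^ k - g R x\<bar>"
        using ig has_momentsD(4)[OF hm] by (simp add: moments_def)
      also have "\<dots> \<le> (LINT x|\<mu>. \<bar>x ^ k - g R x\<bar>)" by (rule integral_abs_bound)
      also have "\<dots> \<le> (LINT x|\<mu>. (x ^ k)\<^sup>2 / R)"
        using ig has_momentsD(4)[OF hm] even(1) gdiff[OF R] by (intro integral_mono) auto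
      also have "\<dots> \<le> c / R" using even(2)[of k] R by (simp add: c_def divide_right_mono)
      finally have 1: "\<bar>moments \<mu> k - (LINT x|\<mu>. g R x)\<bar> \<le> c / R" .
      have 2: "\<bar>s k - (LINT x|\<mu>. g R x)\<bar> \<le> c / R"
      proof (rule LIMSEQ_le_const2)
        show "(\<lambda>n. \<bar>s k - (\<Sum>y\<in>Z (r n). m (r n) y * g R y)\<bar>) \<longlonglongrightarrow> \<bar>s k - (LINT x|\<mu>. g R x)\<bar>"
          by (intro tendsto_intros conv[OF gcont gbd])
        show "\<exists>N. \<forall>n\<ge>N. \<bar>s k - (\<Sum>y\<in>Z (r n). m (r n) y * g R y)\<bar> \<le> c / R"
        proof (intro exI allI impI)
          fix n assume n: "n \<ge> 2 * k"
          have rn: "r n \<ge> n" by (rule seq_suble[OF r])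
          have "s k = L (monom 1 k)" by (simp add: moment_functional_monom)
          also have "\<dots> = (\<Sum>y\<in>Z (r n). m (r n) y * y ^ k)"
            using exact[of "monom 1 k" "r n"] n rn by (simp add: degree_monom_eq poly_monom)
          finally have "\<bar>s k - (\<Sum>y\<in>Z (r n). m (r n) y * g R y)\<bar> = \<bar>\<Sum>y\<in>Z (r n). m (r n) y * (y ^ k - g R y)\<bar>"
            by (simp add: sum_subtractf right_diff_distrib)
          also have "\<dots> \<le> (\<Sum>y\<in>Z (r n). \<bar>m (r n) y * (y ^ k - g R y)\<bar>)" by (rule sum_abs)
          also have "\<dots> \<le> (\<Sum>y\<in>Z (r n). m (r n) y * ((y ^ k)\<^sup>2 / R))"
            unfolding abs_mult using gdiff[OF R] pos by (intro sum_mono mult_mono) auto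
          also have "\<dots> = (\<Sum>y\<in>Z (r n). m (r n) y * poly (monom 1 (2 * k)) y) / R"
            by (simp add: poly_monom power_mult[symmetric] mult.commute sum_divide_distrib)
          also have "\<dots> = c / R"
            using n rn exact[of "monom 1 (2 * k)" "r n"] by (simp add: degree_monom_eq c_def)
          finally show "\<bar>s k - (\<Sum>y\<in>Z (r n). m (r n) y * g R y)\<bar> \<le> c / R" .
        qed
      qed
      have "2 * c / R = c / R + c / R" by simp
      thus ?thesis using 1 2 by linarith
    qed
    hence le: "\<bar>moments \<mu> k - s k\<bar> * R \<le> 2 * c" if "R > 0" for R using that by (simp add: field_simps)
    show ?thesis
    proof (rule ccontr)
      assume "moments \<mu> k \<noteq> s k"
      hence d: "\<bar>moments \<mu> k - s k\<bar> > 0" by simp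
      from le[of "(2 * c + 1) / \<bar>moments \<mu> k - s k\<bar>"] d c0 show False by simp
    qed
  qed
  hence "\<mu> \<in> V s" using hm positive_definite by (auto simp: V_iff)
  moreover have "quadrature_converges (Z \<circ> r) (m \<circ> r) \<mu>"
    unfolding quadrature_converges_def comp_def by (intro allI impI conv) blast+
  ultimately show ?thesis using r by blast
qed

section \<open>Existence of extremal measures\<close>

context moment_sequence
begin

text \<open>For \<open>b = 0\<close> these are the partial sums of \<open>B + t D\<close> and \<open>D\<close>.\<close>

definition qpoly :: "real \<Rightarrow> real \<Rightarrow> real \<Rightarrow> nat \<Rightarrow> real poly" where
  "qpoly b \<epsilon> \<tau> n = [:-b, 1:] * kpoly b \<epsilon> \<tau> (Suc n) - [:\<epsilon>:]"

lemma poly_qpoly: "poly (qpoly b \<epsilon> \<tau> n) y = (y - b) * poly (kpoly b \<epsilon> \<tau> (Suc n)) y - \<epsilon>"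
  by (simp add: qpoly_def algebra_simps)

lemma degree_qpoly: "degree (qpoly b \<epsilon> \<tau> n) \<le> Suc n"
  unfolding qpoly_def using degree_kpoly[of b \<epsilon> \<tau> n] degree_mult_le[of "[:-b, 1:]" "kpoly b \<epsilon> \<tau> (Suc n)"]
  by (intro degree_diff_le) auto

text \<open>Parseval: on degrees up to n, \<open>kpoly\<close> represents the functional that
  combines the second kind value and the point value at b. For \<epsilon> = 0 it is \<tau> times the
  reproducing kernel at b.\<close>

lemma L_kpoly_mult:
  assumes "degree h \<le> n"
  shows "L (kpoly b \<epsilon> \<tau> (Suc n) * h) = \<epsilon> * second_kind s h b + \<tau> * poly h b"
proof -
  have h: "h = (\<Sum>k\<le>n. smult (L (h * op k)) (op k))" using op_expansion[OF assms] by simp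
  have "L (kpoly b \<epsilon> \<tau> (Suc n) * h) = L (h * kpoly b \<epsilon> \<tau> (Suc n))" by (simp add: mult.commute)
  also have "\<dots> = (\<Sum>k\<le>n. L (h * op k) * kcoeff b \<epsilon> \<tau> k)"
    using op_parseval[OF assms, of "kpoly b \<epsilon> \<tau> (Suc n)"] by (simp add: L_kpoly_op)
  also have "\<dots> = \<epsilon> * (\<Sum>k\<le>n. L (h * op k) * qfun s k b) + \<tau> * (\<Sum>k\<le>n. L (h * op k) * pfun s k b)"
    by (simp add: kcoeff_def sum_distrib_left sum.distrib algebra_simps)
  also have "(\<Sum>k\<le>n. L (h * op k) * qfun s k b) = second_kind s (\<Sum>k\<le>n. smult (L (h * op k)) (op k)) b"
    by (simp add: second_kind_sum second_kind_smult qfun_eq)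
  also have "(\<Sum>k\<le>n. L (h * op k) * pfun s k b) = poly (\<Sum>k\<le>n. smult (L (h * op k)) (op k)) b"
    by (simp add: poly_sum pfun_def)
  finally show ?thesis using h by simp
qed

text \<open>On (x - b) r the point value in \<open>L_kpoly_mult\<close> vanishes and the second kind
  value is \<open>L r\<close>; the constant \<epsilon> subtracted in \<open>qpoly\<close> cancels
  what remains. So the zeros of \<open>qpoly\<close> are nodes of positive quadrature
  formulas.\<close>

lemma qpoly_orth:
  assumes "degree r < n"
  shows "L (qpoly b \<epsilon> \<tau> n * r) = 0"
proof -
  have deg: "degree ([:-b, 1:] * r) \<le> n"
    using assms degree_mult_le[of "[:-b, 1:]" r] by simp
  have "qpoly b \<epsilon> \<tau> n * r = kpoly b \<epsilon> \<tau> (Suc n) * ([:-b, 1:] * r) - smult \<epsilon> r"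
    unfolding qpoly_def left_diff_distrib by (simp only: mult_ac) simp
  hence "L (qpoly b \<epsilon> \<tau> n * r) = \<epsilon> * second_kind s ([:-b, 1:] * r) b + \<tau> * poly ([:-b, 1:] * r) b - \<epsilon> * L r"
    by (simp only: moment_functional_linear L_kpoly_mult[OF deg])
  thus ?thesis unfolding second_kind_linear_mult by simp
qed

lemma kpoly_nonzero:
  assumes "\<tau> \<noteq> 0"
  shows "kpoly b \<epsilon> \<tau> (Suc n) \<noteq> 0"
proof
  assume "kpoly b \<epsilon> \<tau> (Suc n) = 0"
  hence "kcoeff b \<epsilon> \<tau> 0 = 0" using L_kpoly_op[of b \<epsilon> \<tau> "Suc n" 0] by simp
  thus False using assms L_sum_kernel[of b] by (auto simp: kcoeff_def)
qed

lemma qpoly_nonzero: "\<epsilon> \<noteq> 0 \<or> \<tau> \<noteq> 0 \<Longrightarrow> qpoly b \<epsilon> \<tau> n \<noteq> 0"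
proof (cases "\<epsilon> = 0")
  case True
  assume "\<epsilon> \<noteq> 0 \<or> \<tau> \<noteq> 0"
  thus ?thesis using True kpoly_nonzero[of \<tau> b \<epsilon> n] by (auto simp: qpoly_def simp del: mult_pCons_left)
next
  case False
  have "poly (qpoly b \<epsilon> \<tau> n) b = - \<epsilon>" by (simp add: poly_qpoly)
  thus ?thesis using False by auto
qed

lemma L_kpoly: "L (kpoly b \<epsilon> \<tau> (Suc n)) = \<tau>"
  using L_kpoly_mult[of 1 n b \<epsilon> \<tau>] by (simp add: second_kind_def one_pCons)

lemma L_kpoly_diff_square:
  assumes "M \<le> N"
  shows "L ((kpoly b \<epsilon> \<tau> N - kpoly b \<epsilon> \<tau> M) * (kpoly b \<epsilon> \<tau> N - kpoly b \<epsilon> \<tau> M)) = (\<Sum>k=M..<N. (kcoeff b \<epsilon> \<tau> k)\<^sup>2)"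
proof -
  define D where "D = kpoly b \<epsilon> \<tau> N - kpoly b \<epsilon> \<tau> M"
  have D: "D = (\<Sum>k=M..<N. smult (kcoeff b \<epsilon> \<tau> k) (op k))"
    unfolding D_def kpoly_def using sum_diff_nat_ivl[of 0 M N] assms by (simp add: atLeast0LessThan)
  have "L (D * op k) = kcoeff b \<epsilon> \<tau> k" if "k \<in> {M..<N}" for k
    using that unfolding D_def left_diff_distrib moment_functional_linear L_kpoly_op by simp
  moreover have "L (D * D) = (\<Sum>k=M..<N. kcoeff b \<epsilon> \<tau> k * L (D * op k))"
    by (subst (2) D) (simp add: sum_distrib_left moment_functional_linear)
  ultimately show ?thesis by (simp add: D_def power2_eq_square)
qed

lemma kpoly_linear: "kpoly b \<epsilon> \<tau> n = smult \<epsilon> (kpoly b 1 0 n) + smult \<tau> (kpoly b 0 1 n)"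
proof (rule poly_ext)
  show "poly (kpoly b \<epsilon> \<tau> n) x = poly (smult \<epsilon> (kpoly b 1 0 n) + smult \<tau> (kpoly b 0 1 n)) x" for x
    by (simp add: poly_kpoly kcoeff_def sum_distrib_left sum.distrib algebra_simps)
qed

end

context indeterminate_sequence
begin

lemma kfun_linear: "kfun b \<epsilon> \<tau> x = \<epsilon> * kfun b 1 0 x + \<tau> * kfun b 0 1 (x::real)"
proof -
  have "(\<lambda>n. poly (kpoly b e t n) x) \<longlonglongrightarrow> kfun b e t x" for e t
    using tendsto_uniform_limitI[OF kpoly_uniform_limit[of b e t "\<bar>x\<bar>"], of x] by simp
  note l = this
  have "(\<lambda>n. poly (kpoly b \<epsilon> \<tau> n) x) \<longlonglongrightarrow> \<epsilon> * kfun b 1 0 x + \<tau> * kfun b 0 1 x"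
    by (subst kpoly_linear) (simp, intro tendsto_intros l)
  thus ?thesis using l LIMSEQ_unique by blast
qed

text \<open>The parameters have to vary with n because the Gauss formulas leading to
  \<open>mu_F\<close> carry \<open>gauss_param n\<close> instead of its limit. Linearity of
  \<open>kpoly\<close> in them reduces this to two fixed sequences.\<close>

lemma kpoly_uniform_limit_varying:
  assumes "eps \<longlonglongrightarrow> \<epsilon>" "tau \<longlonglongrightarrow> \<tau>" "filterlim N at_top sequentially"
  shows "uniform_limit (cball 0 R) (\<lambda>n x. poly (kpoly b (eps n) (tau n) (N n)) x) (kfun b \<epsilon> \<tau> :: real \<Rightarrow> real) sequentially"
proof -
  have u: "uniform_limit (cball 0 R) (\<lambda>n x. poly (kpoly b e t (N n)) x) (kfun b e t :: real \<Rightarrow> real) sequentially" for e t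
    using filterlim_compose[OF kpoly_uniform_limit assms(3)] .
  have bd: "bounded ((kfun b e t :: real \<Rightarrow> real) ` cball 0 R)" for e t
    by (intro compact_imp_bounded compact_continuous_image continuous_on_subset[OF continuous_kfun]) auto
  have c: "uniform_limit (cball 0 R) (\<lambda>n x. f n) (\<lambda>x. l) sequentially" if "f \<longlonglongrightarrow> l" for f :: "nat \<Rightarrow> real" and l
    using that by (auto simp: uniform_limit_iff tendsto_iff)
  have lim: "uniform_limit (cball 0 R)
      (\<lambda>n x. eps n * poly (kpoly b 1 0 (N n)) x + tau n * poly (kpoly b 0 1 (N n)) x)
      (\<lambda>x. \<epsilon> * kfun b 1 0 x + \<tau> * kfun b 0 1 x) sequentially"
    by (intro uniform_limit_add uniform_lim_mult u c assms bd) (auto intro!: finite_imp_bounded finite_subset[of _ "{_}"])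
  have eq: "poly (kpoly b (eps n) (tau n) (N n)) x = eps n * poly (kpoly b 1 0 (N n)) x + tau n * poly (kpoly b 0 1 (N n)) x" for n x
    by (subst kpoly_linear) simp
  have "kfun b \<epsilon> \<tau> = (\<lambda>x. \<epsilon> * kfun b 1 0 x + \<tau> * kfun b 0 1 (x::real))"
    by (rule ext) (rule kfun_linear)
  thus ?thesis using lim by (simp only: eq)
qed

text \<open>The bound must not depend on n: the parameters move along the quadratures while the
  approximation order M stays fixed.\<close>

lemma kcoeff_tail:
  assumes "\<And>n::nat. \<bar>eps n\<bar> \<le> B" "\<And>n. \<bar>tau n\<bar> \<le> B"
  obtains T where "T \<longlonglongrightarrow> 0" "\<And>n M N. M \<le> N \<Longrightarrow> (\<Sum>k=M..<N. (kcoeff b (eps n) (tau n) k)\<^sup>2) \<le> T M"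
proof
  define g where "g k = 2 * B\<^sup>2 * ((qfun s k b)\<^sup>2 + (pfun s k b)\<^sup>2)" for k
  have g: "summable g" unfolding g_def
    by (intro summable_mult summable_add pfun_square_summable_real qfun_square_summable_real)
  show "(\<lambda>M. \<Sum>k. g (k + M)) \<longlonglongrightarrow> 0" by (rule suminf_tail_tendsto_0[OF g])
  fix n M N :: nat assume MN: "M \<le> N"
  have le: "(kcoeff b (eps n) (tau n) k)\<^sup>2 \<le> g k" for k
  proof -
    have "(u + v)\<^sup>2 \<le> 2 * (u\<^sup>2 + v\<^sup>2)" for u v :: real
      using sum_squares_bound[of u v] by (simp add: power2_sum)
    hence "(kcoeff b (eps n) (tau n) k)\<^sup>2 \<le> 2 * ((eps n * qfun s k b)\<^sup>2 + (tau n * pfun s k b)\<^sup>2)"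
      by (simp add: kcoeff_def)
    also have "\<dots> \<le> 2 * (B\<^sup>2 * (qfun s k b)\<^sup>2 + B\<^sup>2 * (pfun s k b)\<^sup>2)"
      unfolding power_mult_distrib
      by (intro mult_left_mono add_mono mult_right_mono) (use power_mono[OF assms(1), of n 2] power_mono[OF assms(2), of n 2] in auto)
    finally show ?thesis by (simp add: g_def algebra_simps)
  qed
  have "(\<Sum>k=M..<N. (kcoeff b (eps n) (tau n) k)\<^sup>2) \<le> (\<Sum>k=M..<N. g k)" by (intro sum_mono le)
  also have "\<dots> = (\<Sum>k<N - M. g (k + M))"
    using sum.shift_bounds_nat_ivl[of g 0 M "N - M"] MN by (simp add: atLeast0LessThan)
  also have "\<dots> \<le> (\<Sum>k. g (k + M))"
    using summable_ignore_initial_segment[OF g] by (intro sum_le_suminf) (auto simp: g_def)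
  finally show "(\<Sum>k=M..<N. (kcoeff b (eps n) (tau n) k)\<^sup>2) \<le> (\<Sum>k. g (k + M))" .
qed

text \<open>At a node y the polynomial P_n satisfies (y - b) P_n(y) = eps n, and uniform convergence
  on bounded sets passes this on to the limit measure. The formula integrates the square of P_n
  minus its M-th partial sum exactly, so the discrete L2 distance is a tail of coefficients, a bound
  that survives the weak limit. Nodes and weights are part of the result because the position of the
  nodes later locates the support.\<close>

lemma extremal_exists:
  fixes b :: real
  assumes eps: "eps \<longlonglongrightarrow> \<epsilon>" and tau: "tau \<longlonglongrightarrow> \<tau>" and ne: "\<epsilon> \<noteq> 0 \<or> \<tau> \<noteq> 0"
    and ne': "\<And>n. eps n \<noteq> 0 \<or> tau n \<noteq> 0"
  defines "Z \<equiv> \<lambda>n. {y. poly (qpoly b (eps n) (tau n) (n + 2)) y = 0}"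
  shows "\<exists>\<mu> m r. \<mu> \<in> V s \<and> extremal_at \<mu> b \<epsilon> \<tau> (kfun b \<epsilon> \<tau>) \<and> strict_mono (r :: nat \<Rightarrow> nat) \<and>
    (\<forall>n. \<forall>y\<in>Z n. m n y > 0) \<and> (\<forall>n p. degree p \<le> n + 2 \<longrightarrow> (\<Sum>y\<in>Z n. m n y * poly p y) = L p) \<and>
    quadrature_converges (Z \<circ> r) (m \<circ> r) \<mu>"
proof -
  define Q where "Q n = qpoly b (eps n) (tau n) (n + 2)" for n
  have Z_def: "Z n = {y. poly (Q n) y = 0}" for n by (simp add: Z_def Q_def)
  have Q0: "Q n \<noteq> 0" for n unfolding Q_def by (rule qpoly_nonzero[OF ne'])
  have fin: "finite (Z n)" for n unfolding Z_def by (rule poly_roots_finite[OF Q0])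
  have "\<exists>m. (\<forall>y. poly (Q n) y = 0 \<longrightarrow> m y > 0) \<and>
    (\<forall>p. degree p < degree (Q n) + (n + 2) \<longrightarrow> (\<Sum>y | poly (Q n) y = 0. m y * poly p y) = L p)" for n
    using Q0 unfolding Q_def by (intro quadrature_exists degree_qpoly qpoly_orth) auto
  then obtain m where pos: "\<And>n y. poly (Q n) y = 0 \<Longrightarrow> m n y > 0"
    and exact: "\<And>n p. degree p < degree (Q n) + (n + 2) \<Longrightarrow> (\<Sum>y\<in>Z n. m n y * poly p y) = L p"
    unfolding Z_def by metis
  have pos': "m n y \<ge> 0" if "y \<in> Z n" for n y using pos[of n y] that by (simp add: Z_def)
  have degQ: "degree (Q n) \<ge> n + 2" for n
  proof (rule ccontr)
    assume "\<not> degree (Q n) \<ge> n + 2"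
    hence "L (Q n * Q n) = 0" unfolding Q_def by (intro qpoly_orth) simp
    thus False using L_square_pos[OF Q0, of n] by simp
  qed
  have exact2: "(\<Sum>y\<in>Z n. m n y * poly p y) = L p" if "degree p \<le> n + 2" for n p
    using that degQ[of n] by (intro exact) simp
  obtain \<mu> r where \<mu>: "\<mu> \<in> V s" and r: "strict_mono (r :: nat \<Rightarrow> nat)"
    and qc: "quadrature_converges (Z \<circ> r) (m \<circ> r) \<mu>"
    using quadrature_limit[of Z m, OF fin pos' exact2] by blast
  note conv = quadrature_convergesD[OF qc, unfolded comp_def]
  note hm = V_has_moments[OF \<mu>]
  note fin\<mu> = has_momentsD(3)[OF hm] and sets\<mu> = has_momentsD(1)[OF hm]
  define P where "P n = kpoly b (eps n) (tau n) (Suc (n + 2))" for n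
  let ?K = "kfun b \<epsilon> \<tau> :: real \<Rightarrow> real"
  note contK = continuous_on_compose2[OF continuous_kfun[of b \<epsilon> \<tau>] continuous_on_id subset_UNIV, unfolded id_def]
  have node: "(y - b) * poly (P n) y = eps n" if "y \<in> Z n" for n y
    using that by (simp add: Z_def Q_def poly_qpoly P_def)
  have mass: "(\<Sum>y\<in>Z n. m n y) = s 0" for n using exact2[of 1 n] by (simp add: one_pCons)
  have s0: "s 0 > 0" by (rule mass_pos)
  have rinf: "filterlim r at_top sequentially" using r by (rule filterlim_subseq)
  have unif: "uniform_limit (cball 0 R) (\<lambda>n x. poly (P n) x) ?K sequentially" for R
    unfolding P_def by (intro kpoly_uniform_limit_varying eps tau) real_asymp
  have close: "eventually (\<lambda>n. \<forall>x\<in>cball 0 R. \<bar>poly (P (r n)) x - ?K x\<bar> < e) sequentially" if "e > 0" for e R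
    using eventually_compose_filterlim[OF uniform_limitD[OF unif[of R] that] rinf] by (simp add: dist_real_def)
  have sumle: "(\<Sum>y\<in>Z n. m n y * h y) \<le> s 0 * C" if "\<And>y. y \<in> Z n \<Longrightarrow> h y \<le> C" for h C n
  proof -
    have "(\<Sum>y\<in>Z n. m n y * h y) \<le> (\<Sum>y\<in>Z n. m n y * C)" by (intro sum_mono mult_left_mono that pos')
    also have "\<dots> = s 0 * C" by (simp add: sum_distrib_right[symmetric] mass)
    finally show ?thesis .
  qed
  have ae: "AE x in \<mu>. (x - b) * ?K x = \<epsilon>"
  proof -
    define H where "H x = min 1 \<bar>(x - b) * ?K x - \<epsilon>\<bar>" for x
    have contH: "continuous_on UNIV H" unfolding H_def by (intro continuous_intros contK)
    have "AE x in \<mu>. cutoff (real R) x * H x = 0" for R :: nat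
    proof -
      obtain B where B: "\<And>x. \<bar>cutoff R x * H x\<bar> \<le> B" using cutoff_times_bounded[OF contH] by blast
      have cont: "continuous_on UNIV (\<lambda>x. cutoff R x * H x)" by (intro continuous_intros contH)
      have nonneg: "cutoff R x * H x \<ge> 0" for x using cutoff_bounds by (simp add: H_def)
      have "(\<lambda>n. \<Sum>y\<in>Z (r n). m (r n) y * (cutoff R y * H y)) \<longlonglongrightarrow> 0"
      proof (rule tendstoI)
        fix e :: real assume e: "e > 0"
        \<comment> \<open>At a node inside the cutoff the error is at most (R + \<bar>b\<bar>) e1 +
          e1, and the weights sum to s_0; the factor 2 leaves e / 2.\<close>
        define e1 where "e1 = e / (2 * s 0 * (real R + \<bar>b\<bar> + 1))"
        have Rb: "real R + \<bar>b\<bar> + 1 > 0" by (intro add_nonneg_pos) auto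
        hence e1: "e1 > 0" using e s0 by (simp add: e1_def)
        have "eventually (\<lambda>n. \<bar>eps (r n) - \<epsilon>\<bar> < e1) sequentially"
          using eventually_compose_filterlim[OF tendstoD[OF eps e1] rinf] by (simp add: dist_real_def)
        thus "eventually (\<lambda>n. dist (\<Sum>y\<in>Z (r n). m (r n) y * (cutoff R y * H y)) 0 < e) sequentially"
          using close[OF e1, of "real R"]
        proof eventually_elim
          case (elim n)
          have "(\<Sum>y\<in>Z (r n). m (r n) y * (cutoff R y * H y)) \<le> s 0 * (e1 * (real R + \<bar>b\<bar> + 1))"
          proof (rule sumle)
            fix y assume y: "y \<in> Z (r n)"
            show "cutoff R y * H y \<le> e1 * (real R + \<bar>b\<bar> + 1)"
            proof (cases "\<bar>y\<bar> \<ge> R")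
              case True thus ?thesis using e1 by (simp add: cutoff_eq_0)
            next
              case False
              have "(y - b) * ?K y - \<epsilon> = (y - b) * (?K y - poly (P (r n)) y) + (eps (r n) - \<epsilon>)"
                using node[OF y] by (simp add: algebra_simps)
              hence "\<bar>(y - b) * ?K y - \<epsilon>\<bar> \<le> \<bar>y - b\<bar> * \<bar>?K y - poly (P (r n)) y\<bar> + \<bar>eps (r n) - \<epsilon>\<bar>"
                by (metis abs_mult abs_triangle_ineq)
              also have "\<dots> \<le> (real R + \<bar>b\<bar>) * e1 + e1"
              proof (intro add_mono mult_mono)
                show "\<bar>?K y - poly (P (r n)) y\<bar> \<le> e1" using elim(2) False by (auto simp: abs_minus_commute less_imp_le)
              qed (use elim False e1 in auto)
              finally have "H y \<le> e1 * (real R + \<bar>b\<bar> + 1)" by (simp add: H_def algebra_simps)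
              moreover have "cutoff R y * H y \<le> 1 * H y" by (intro mult_right_mono cutoff_bounds) (simp add: H_def)
              ultimately show ?thesis by simp
            qed
          qed
          also have "\<dots> = e / 2" unfolding e1_def using Rb s0 by (simp add: divide_simps)
          also have "\<dots> < e" using e by simp
          finally show ?case using nonneg pos' by (simp add: sum_nonneg)
        qed
      qed
      hence "(LINT x|\<mu>. cutoff R x * H x) = 0" using conv[OF cont B] LIMSEQ_unique by blast
      thus ?thesis using nonneg
        by (subst (asm) integral_nonneg_eq_0_iff_AE) (auto intro: integrable_bounded_continuous[OF fin\<mu> sets\<mu> cont B])
    qed
    hence "AE x in \<mu>. \<forall>R::nat. cutoff (real R) x * H x = 0" unfolding AE_all_countable by blast
    thus ?thesis
    proof eventually_elim
      case (elim x)
      obtain R :: nat where "real R \<ge> \<bar>x\<bar> + 1" using real_arch_simple by blast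
      hence "cutoff R x = 1" by (simp add: cutoff_def)
      thus ?case using elim[rule_format, of R] by (simp add: H_def min_def split: if_splits)
    qed
  qed
  obtain B where B: "\<And>n. \<bar>eps n\<bar> \<le> B" "\<And>n. \<bar>tau n\<bar> \<le> B"
  proof -
    obtain B1 B2 where "\<And>n. \<bar>eps n\<bar> \<le> B1" "\<And>n. \<bar>tau n\<bar> \<le> B2"
      using convergent_imp_Bseq[OF convergentI[OF eps]] convergent_imp_Bseq[OF convergentI[OF tau]] by (auto simp: Bseq_def)
    thus ?thesis using that[of "max B1 B2"] by (meson max.coboundedI1 max.coboundedI2)
  qed
  obtain T where T0: "T \<longlonglongrightarrow> 0"
    and T: "\<And>n M N. M \<le> N \<Longrightarrow> (\<Sum>k=M..<N. (kcoeff b (eps n) (tau n) k)\<^sup>2) \<le> T M"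
    using kcoeff_tail[where eps = eps and tau = tau, OF B] by metis
  define PM where "PM M = kpoly b \<epsilon> \<tau> M" for M
  have L2: "sq_integrable \<mu> (\<lambda>x. ?K x - poly (PM M) x)" "(LINT x|\<mu>. (?K x - poly (PM M) x)\<^sup>2) \<le> 3 * T M" for M
  proof -
    define H where "H x = (?K x - poly (PM M) x)\<^sup>2" for x
    have contH: "continuous_on UNIV H" unfolding H_def by (intro continuous_intros contK)
    have nn: "0 \<le> H x" for x by (simp add: H_def)
    have cut: "(LINT x|\<mu>. cutoff R x * H x) \<le> 3 * T M" for R :: nat
    proof -
      obtain B where B: "\<And>x. \<bar>cutoff R x * H x\<bar> \<le> B" using cutoff_times_bounded[OF contH] by blast
      have cont: "continuous_on UNIV (\<lambda>x. cutoff R x * H x)" by (intro continuous_intros contH)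
      have unifM: "uniform_limit (cball 0 R) (\<lambda>n x. poly (kpoly b (eps n) (tau n) M) x) (\<lambda>x. poly (PM M) x) sequentially"
      proof -
        have bd: "bounded (poly p ` cball 0 (real R))" for p :: "real poly"
          by (intro compact_imp_bounded compact_continuous_image continuous_intros) auto
        have c: "uniform_limit (cball 0 (real R)) (\<lambda>n x. f n) (\<lambda>x. l) sequentially" if "f \<longlonglongrightarrow> l" for f :: "nat \<Rightarrow> real" and l
          using that by (auto simp: uniform_limit_iff tendsto_iff)
        have "uniform_limit (cball 0 R) (\<lambda>n x. eps n * poly (kpoly b 1 0 M) x + tau n * poly (kpoly b 0 1 M) x)
          (\<lambda>x. \<epsilon> * poly (kpoly b 1 0 M) x + \<tau> * poly (kpoly b 0 1 M) x) sequentially"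
          by (intro uniform_limit_add uniform_lim_mult uniform_limit_const c eps tau bd) (auto intro!: finite_imp_bounded finite_subset[of _ "{_}"])
        moreover have "poly (kpoly b (eps n) (tau n) M) x = eps n * poly (kpoly b 1 0 M) x + tau n * poly (kpoly b 0 1 M) x" for n x
          by (subst kpoly_linear) simp
        moreover have "poly (PM M) x = \<epsilon> * poly (kpoly b 1 0 M) x + \<tau> * poly (kpoly b 0 1 M) x" for x
          unfolding PM_def by (subst kpoly_linear) simp
        ultimately show ?thesis by simp
      qed
      have "(LINT x|\<mu>. cutoff R x * H x) \<le> 3 * T M + e" if e: "e > 0" for e
      proof (rule LIMSEQ_le_const2[OF conv[OF cont B]])
        \<comment> \<open>In (u + v + w)^2 <= 3 (u^2 + v^2 + w^2) the two uniform errors u and w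
          contribute at most 6 e1^2, which after weighting with total mass s_0 amounts to e.\<close>
        define e1 where "e1 = sqrt (e / (6 * s 0))"
        have e1: "e1 > 0" "e1\<^sup>2 = e / (6 * s 0)" using e s0 by (auto simp: e1_def)
        have "eventually (\<lambda>n. \<forall>x\<in>cball 0 (real R). \<bar>poly (kpoly b (eps (r n)) (tau (r n)) M) x - poly (PM M) x\<bar> < e1) sequentially"
          using eventually_compose_filterlim[OF uniform_limitD[OF unifM e1(1)] rinf] by (simp add: dist_real_def)
        moreover have "eventually (\<lambda>n. n \<ge> M) sequentially" by (rule eventually_ge_at_top)
        ultimately have "eventually (\<lambda>n. (\<Sum>y\<in>Z (r n). m (r n) y * (cutoff R y * H y)) \<le> 3 * T M + e) sequentially"
          using close[OF e1(1), of "real R"]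
        proof eventually_elim
          case (elim n)
          let ?D = "P (r n) - kpoly b (eps (r n)) (tau (r n)) M"
          have rn: "r n \<ge> n" by (rule seq_suble[OF r])
          have "cutoff R y * H y \<le> 6 * e1\<^sup>2 + 3 * poly (?D * ?D) y" for y
          proof (cases "\<bar>y\<bar> \<ge> R")
            case True
            have "0 \<le> 6 * e1\<^sup>2 + 3 * poly (?D * ?D) y" by simp
            thus ?thesis using True by (simp add: cutoff_eq_0)
          next
            case False
            define u where "u = ?K y - poly (P (r n)) y"
            define v where "v = poly ?D y"
            define w where "w = poly (kpoly b (eps (r n)) (tau (r n)) M) y - poly (PM M) y"
            have "\<bar>u\<bar> \<le> e1" "\<bar>w\<bar> \<le> e1"
              using elim False by (auto simp: u_def w_def abs_minus_commute less_imp_le)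
            hence "u\<^sup>2 \<le> e1\<^sup>2" "w\<^sup>2 \<le> e1\<^sup>2" using e1(1) by (auto simp: abs_le_square_iff[symmetric])
            have "H y = (u + v + w)\<^sup>2" by (simp add: H_def u_def v_def w_def)
            also have "\<dots> \<le> 3 * u\<^sup>2 + 3 * v\<^sup>2 + 3 * w\<^sup>2"
              using sum_squares_bound[of u v] sum_squares_bound[of v w] sum_squares_bound[of u w]
              by (simp add: power2_eq_square algebra_simps)
            also have "\<dots> \<le> 6 * e1\<^sup>2 + 3 * v\<^sup>2" using \<open>u\<^sup>2 \<le> e1\<^sup>2\<close> \<open>w\<^sup>2 \<le> e1\<^sup>2\<close> by simp
            also have "v\<^sup>2 = poly (?D * ?D) y" by (simp add: v_def power2_eq_square)
            finally have "H y \<le> 6 * e1\<^sup>2 + 3 * poly (?D * ?D) y" .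
            moreover have "cutoff R y * H y \<le> 1 * H y" by (intro mult_right_mono cutoff_bounds) (simp add: H_def)
            ultimately show ?thesis by simp
          qed
          hence "(\<Sum>y\<in>Z (r n). m (r n) y * (cutoff R y * H y)) \<le> (\<Sum>y\<in>Z (r n). m (r n) y * (6 * e1\<^sup>2 + 3 * poly (?D * ?D) y))"
            by (intro sum_mono mult_left_mono pos')
          also have "\<dots> = s 0 * (6 * e1\<^sup>2) + 3 * (\<Sum>y\<in>Z (r n). m (r n) y * poly (?D * ?D) y)"
            unfolding distrib_left sum.distrib sum_distrib_right[symmetric] mass
            by (simp only: sum_distrib_left mult.left_commute[of 3])
          also have "(\<Sum>y\<in>Z (r n). m (r n) y * poly (?D * ?D) y) = L (?D * ?D)"
          proof (rule exact)
            \<comment> \<open>If the degree of Q drops, as for Gauss nodes, exactness drops with it;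
              but (x - b) P = Q + const makes the degree of P drop too.\<close>
            have dP: "degree (P (r n)) < degree (Q (r n))"
            proof (rule ccontr)
              assume "\<not> degree (P (r n)) < degree (Q (r n))"
              hence ge: "degree (P (r n)) \<ge> degree (Q (r n))" "degree (P (r n)) \<ge> 1" using degQ[of "r n"] by auto
              hence "P (r n) \<noteq> 0" by auto
              hence "degree ([:-b, 1:] * P (r n)) = Suc (degree (P (r n)))" by (subst degree_mult_eq) auto
              moreover have "[:-b, 1:] * P (r n) = Q (r n) + [:eps (r n):]" by (simp add: Q_def qpoly_def P_def)
              moreover have "degree (Q (r n) + [:eps (r n):]) \<le> degree (Q (r n))"
                using degree_add_le_max[of "Q (r n)" "[:eps (r n):]"] by simp
              ultimately show False using ge by simp
            qed
            have dM: "degree (kpoly b (eps (r n)) (tau (r n)) M) < degree (Q (r n))"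
            proof (cases M)
              case 0 thus ?thesis using degQ[of "r n"] by (simp add: kpoly_def)
            next
              case (Suc M')
              have "degree (kpoly b (eps (r n)) (tau (r n)) M) \<le> M'" unfolding Suc by (rule degree_kpoly)
              thus ?thesis using Suc elim(2) rn degQ[of "r n"] by linarith
            qed
            have "degree ?D < degree (Q (r n))" using degree_diff_le_max[of "P (r n)" "kpoly b (eps (r n)) (tau (r n)) M"] dP dM by linarith
            moreover have "degree (Q (r n)) \<le> Suc (r n + 2)" unfolding Q_def by (rule degree_qpoly)
            ultimately show "degree (?D * ?D) < degree (Q (r n)) + (r n + 2)" using degree_mult_le[of ?D ?D] by linarith
          qed
          also have "L (?D * ?D) \<le> T M"
          proof -
            have "M \<le> Suc (r n + 2)" using elim(2) rn by linarith
            thus ?thesis unfolding P_def by (subst L_kpoly_diff_square) (simp_all only: T)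
          qed
          also have "s 0 * (6 * e1\<^sup>2) = e" using s0 by (simp add: e1(2))
          finally show ?case by simp
        qed
        thus "\<exists>N. \<forall>n\<ge>N. (\<Sum>y\<in>Z (r n). m (r n) y * (cutoff R y * H y)) \<le> 3 * T M + e"
          by (simp add: eventually_sequentially)
      qed
      thus ?thesis by (rule field_le_epsilon)
    qed
    have "integrable \<mu> H" "(LINT x|\<mu>. H x) \<le> 3 * T M"
      using integrable_from_cutoff[OF fin\<mu> sets\<mu> contH nn cut] by auto
    moreover have "(\<lambda>x. ?K x - poly (PM M) x) \<in> borel_measurable \<mu>"
      by (intro borel_measurable_has_moments[OF hm] borel_measurable_continuous_onI continuous_intros contK)
    ultimately show "sq_integrable \<mu> (\<lambda>x. ?K x - poly (PM M) x)" "(LINT x|\<mu>. (?K x - poly (PM M) x)\<^sup>2) \<le> 3 * T M"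
      by (auto simp: sq_integrable_def H_def[abs_def])
  qed
  have sqK: "sq_integrable \<mu> ?K"
    using sq_integrable_add[OF L2(1)[of 0] sq_integrable_poly[OF hm, of "PM 0"]] by simp
  have approx: "poly_approximable \<mu> ?K"
    unfolding poly_approximable_def
  proof (intro conjI allI impI sqK)
    fix e :: real assume e: "e > 0"
    have "eventually (\<lambda>M. T M < e / 3) sequentially" using e by (intro order_tendstoD(2)[OF T0]) simp
    then obtain M where "T M < e / 3" by (auto simp: eventually_sequentially)
    hence "(LINT x|\<mu>. (?K x - poly (PM M) x)\<^sup>2) < e" using L2(2)[of M] by simp
    thus "\<exists>p. (LINT x|\<mu>. (?K x - poly p x)\<^sup>2) < e" by blast
  qed
  have Ki: "integrable \<mu> ?K" using sq_integrable_mult[OF sqK sq_integrable_poly[OF hm, of 1]] by simp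
  have int: "(LINT x|\<mu>. ?K x) = \<tau>"
  proof -
    have "((LINT x|\<mu>. ?K x) - \<tau>)\<^sup>2 \<le> s 0 * (3 * T (Suc M))" for M
    proof -
      have "(LINT x|\<mu>. ?K x) - \<tau> = (LINT x|\<mu>. ?K x - poly (PM (Suc M)) x)"
        using integral_real_poly[OF hm, of "PM (Suc M)"] V_moments[OF \<mu>] Ki integrable_real_poly[OF hm]
        by (simp add: PM_def L_kpoly)
      hence "\<bar>(LINT x|\<mu>. ?K x) - \<tau>\<bar> \<le> (LINT x|\<mu>. \<bar>?K x - poly (PM (Suc M)) x\<bar>)"
        by (simp add: integral_abs_bound)
      hence "\<bar>(LINT x|\<mu>. ?K x) - \<tau>\<bar>\<^sup>2 \<le> (LINT x|\<mu>. \<bar>?K x - poly (PM (Suc M)) x\<bar>)\<^sup>2" by (intro power_mono) auto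
      also have "\<dots> \<le> s 0 * (LINT x|\<mu>. (?K x - poly (PM (Suc M)) x)\<^sup>2)"
        using integral_abs_square_le[OF hm L2(1)] V_moments[OF \<mu>] by simp
      also have "\<dots> \<le> s 0 * (3 * T (Suc M))" using s0 L2(2) by (intro mult_left_mono) auto
      finally show ?thesis by simp
    qed
    moreover have "(\<lambda>M. s 0 * (3 * T (Suc M))) \<longlonglongrightarrow> s 0 * (3 * 0)" by (intro tendsto_intros LIMSEQ_Suc[OF T0])
    ultimately have "((LINT x|\<mu>. ?K x) - \<tau>)\<^sup>2 \<le> s 0 * (3 * 0)" by (intro LIMSEQ_le_const) auto
    thus ?thesis by simp
  qed
  have ext: "extremal_at \<mu> b \<epsilon> \<tau> ?K"
    using approx ae int ne by (simp add: extremal_at_def)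
  have "\<forall>n. \<forall>y\<in>Z n. m n y > 0" using pos by (simp add: Z_def)
  thus ?thesis using \<mu> ext r exact2 qc by blast
qed

end

section \<open>Densities and sums of measures\<close>

lemma poly_approximableE:
  assumes "poly_approximable \<mu> f" "e > 0"
  obtains p where "(LINT x|\<mu>. (f x - poly p x)\<^sup>2) < e"
  using assms by (auto simp: poly_approximable_def)

lemma extremal_at_scale:
  assumes "extremal_at \<mu> b \<epsilon> \<tau> f" "c \<noteq> 0"
  shows "extremal_at \<mu> b (c * \<epsilon>) (c * \<tau>) (\<lambda>x. c * f x)"
proof -
  have "\<exists>p. (LINT x|\<mu>. (c * f x - poly p x)\<^sup>2) < e" if e: "e > 0" for e
  proof -
    obtain p where p: "(LINT x|\<mu>. (f x - poly p x)\<^sup>2) < e / c\<^sup>2"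
      by (rule poly_approximableE[of \<mu> f "e / c\<^sup>2"]) (use assms e in \<open>auto simp: extremal_at_def\<close>)
    have "(LINT x|\<mu>. (c * f x - poly (smult c p) x)\<^sup>2) = (LINT x|\<mu>. c\<^sup>2 * (f x - poly p x)\<^sup>2)"
      by (simp add: right_diff_distrib[symmetric] power_mult_distrib)
    also have "\<dots> < e" using p assms(2) by (simp add: field_simps)
    finally show ?thesis by blast
  qed
  moreover have "AE x in \<mu>. (x - b) * (c * f x) = c * \<epsilon>"
  proof -
    have "AE x in \<mu>. (x - b) * f x = \<epsilon>" using assms(1) by (simp add: extremal_at_def)
    thus ?thesis by eventually_elim auto
  qed
  ultimately show ?thesis
    using assms sq_integrable_cmult[of \<mu> f c] by (auto simp: extremal_at_def poly_approximable_def)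
qed

lemma poly_approximable_density:
  assumes hm: "has_moments \<mu>" and g: "g \<in> borel_measurable borel" "\<And>x. 0 \<le> g x" "\<And>x. g x \<le> C"
    and f: "poly_approximable \<mu> f"
  shows "poly_approximable (density \<mu> (\<lambda>x. ennreal (g x))) f"
proof -
  have C: "C \<ge> 0" using g(2,3) order_trans by blast
  have [measurable]: "g \<in> borel_measurable \<mu>" by (rule borel_measurable_has_moments[OF hm g(1)])
  have [measurable]: "f \<in> borel_measurable \<mu>" using f by (simp add: poly_approximable_def sq_integrable_def)
  have [measurable]: "poly p \<in> borel_measurable \<mu>" for p :: "real poly"
    by (rule borel_measurable_has_moments[OF hm]) simp
  have sqi: "integrable \<mu> (\<lambda>x. g x * (h x)\<^sup>2)" if "sq_integrable \<mu> h" for h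
  proof (rule Bochner_Integration.integrable_bound)
    show "integrable \<mu> (\<lambda>x. C * (h x)\<^sup>2)" using that by (simp add: sq_integrable_def)
    have [measurable]: "h \<in> borel_measurable \<mu>" using that by (simp add: sq_integrable_def)
    show "(\<lambda>x. g x * (h x)\<^sup>2) \<in> borel_measurable \<mu>" by measurable
    show "AE x in \<mu>. norm (g x * (h x)\<^sup>2) \<le> norm (C * (h x)\<^sup>2)"
      using g C by (auto intro!: mult_right_mono simp: abs_mult)
  qed
  have fsq: "sq_integrable \<mu> f" using f by (simp add: poly_approximable_def)
  have "sq_integrable (density \<mu> (\<lambda>x. ennreal (g x))) f"
    using sqi[OF fsq] g(2) by (simp add: sq_integrable_def integrable_real_density)
  moreover have "\<exists>p. (LINT x|density \<mu> (\<lambda>x. ennreal (g x)). (f x - poly p x)\<^sup>2) < e" if e: "e > 0" for e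
  proof -
    obtain p where p: "(LINT x|\<mu>. (f x - poly p x)\<^sup>2) < e / (C + 1)"
      by (rule poly_approximableE[OF f, of "e / (C + 1)"]) (use e C in auto)
    have d: "sq_integrable \<mu> (\<lambda>x. f x - poly p x)" by (intro sq_integrable_diff fsq sq_integrable_poly hm)
    have "(LINT x|density \<mu> (\<lambda>x. ennreal (g x)). (f x - poly p x)\<^sup>2) = (LINT x|\<mu>. g x * (f x - poly p x)\<^sup>2)"
      using g(2) by (subst integral_real_density) auto
    also have "\<dots> \<le> (LINT x|\<mu>. (C + 1) * (f x - poly p x)\<^sup>2)"
      using sqi[OF d] d g by (intro integral_mono) (auto simp: sq_integrable_def intro!: mult_right_mono order_trans[OF g(3)])
    also have "\<dots> = (C + 1) * (LINT x|\<mu>. (f x - poly p x)\<^sup>2)" by (rule integral_mult_right_zero)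
    also have "\<dots> < e" using p C by (simp add: pos_less_divide_eq mult.commute)
    finally show ?thesis by blast
  qed
  ultimately show ?thesis by (simp add: poly_approximable_def)
qed

lemma has_moments_density:
  assumes hm: "has_moments \<mu>" and g: "g \<in> borel_measurable borel" "\<And>x. 0 \<le> g x"
    and bd: "AE x in \<mu>. g x \<le> C * (1 + x\<^sup>2)"
  shows "has_moments (density \<mu> (\<lambda>x. ennreal (g x)))"
    "\<And>p::real poly. integrable \<mu> (\<lambda>x. g x * poly p x)"
    "\<And>p::real poly. moment_functional (moments (density \<mu> (\<lambda>x. ennreal (g x)))) p = (LINT x|\<mu>. g x * poly p x)"
proof -
  have [measurable]: "g \<in> borel_measurable \<mu>" by (rule borel_measurable_has_moments[OF hm g(1)])
  have pm [measurable]: "poly p \<in> borel_measurable \<mu>" for p :: "real poly"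
    by (rule borel_measurable_has_moments[OF hm]) simp
  show int: "integrable \<mu> (\<lambda>x. g x * poly p x)" for p :: "real poly"
  proof (rule Bochner_Integration.integrable_bound)
    show "integrable \<mu> (\<lambda>x. \<bar>poly (smult C (p * [:1, 0, 1:])) x\<bar>)"
      by (intro integrable_abs integrable_real_poly hm)
    show "AE x in \<mu>. norm (g x * poly p x) \<le> norm (\<bar>poly (smult C (p * [:1, 0, 1:])) x\<bar>)"
      using bd
    proof eventually_elim
      case (elim x)
      have "\<bar>g x * poly p x\<bar> \<le> C * (1 + x\<^sup>2) * \<bar>poly p x\<bar>"
        unfolding abs_mult using elim g(2)[of x] by (intro mult_right_mono) auto
      also have "\<dots> = \<bar>C * (1 + x\<^sup>2)\<bar> * \<bar>poly p x\<bar>" using elim order_trans[OF g(2)[of x] elim] by simp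
      also have "\<dots> = \<bar>poly (smult C (p * [:1, 0, 1:])) x\<bar>"
        by (simp add: abs_mult[symmetric] power2_eq_square algebra_simps)
      finally show ?case by simp
    qed
  qed measurable
  show hd: "has_moments (density \<mu> (\<lambda>x. ennreal (g x)))"
    unfolding has_moments_def
  proof (intro conjI allI)
    show "sets (density \<mu> (\<lambda>x. ennreal (g x))) = sets borel" using has_momentsD(1)[OF hm] by simp
    fix n
    show "integrable (density \<mu> (\<lambda>x. ennreal (g x))) (\<lambda>x. x ^ n)"
      using int[of "monom 1 n"] g(2) pm[of "monom 1 n"]
      by (subst integrable_real_density) (auto simp: poly_monom[abs_def])
  qed
  show "moment_functional (moments (density \<mu> (\<lambda>x. ennreal (g x)))) p = (LINT x|\<mu>. g x * poly p x)" for p :: "real poly"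
    unfolding integral_real_poly[OF hd, symmetric] using g(2) by (subst integral_real_density) auto
qed

text \<open>The density may vanish at zeros of q, as \<bar>x\<bar> does at 0. If p is null for the
  density, then q p is null for \<mu>, so positive definiteness carries over.\<close>

lemma Mstar_density:
  assumes \<mu>: "\<mu> \<in> Mstar" and g: "g \<in> borel_measurable borel" "\<And>x. 0 \<le> g x" "AE x in \<mu>. g x \<le> C * (1 + x\<^sup>2)"
    and q: "q \<noteq> 0" "AE x in \<mu>. poly q x \<noteq> 0 \<longrightarrow> g x > 0"
  shows "density \<mu> (\<lambda>x. ennreal (g x)) \<in> Mstar"
proof -
  have hm: "has_moments \<mu>" and pd: "positive_definite_seq (moments \<mu>)"
    using \<mu> by (auto simp: Mstar_iff_positive_definite)
  note D = has_moments_density[OF hm g]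
  have "moment_functional (moments (density \<mu> (\<lambda>x. ennreal (g x)))) (p * p) > 0" if p: "p \<noteq> 0" for p :: "real poly"
  proof -
    have nn: "0 \<le> g x * poly (p * p) x" for x using g(2) by simp
    have ge: "(LINT x|\<mu>. g x * poly (p * p) x) \<ge> 0" using nn by (intro integral_nonneg_AE AE_I2)
    have "(LINT x|\<mu>. g x * poly (p * p) x) \<noteq> 0"
    proof
      assume "(LINT x|\<mu>. g x * poly (p * p) x) = 0"
      hence "AE x in \<mu>. g x * poly (p * p) x = 0"
        using nn by (subst (asm) integral_nonneg_eq_0_iff_AE[OF D(2)]) (auto simp only: AE_I2)
      with q(2) have "AE x in \<mu>. poly (q * p) x = 0" by eventually_elim auto
      hence "moment_functional (moments \<mu>) ((q * p) * (q * p)) = 0"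
        by (simp only: AE_poly_zero_iff_square[OF hm])
      thus False using pd p q(1) by (metis mult_eq_0_iff order_less_irrefl positive_definite_seq_def)
    qed
    thus ?thesis using ge unfolding D(3) by simp
  qed
  thus ?thesis using D(1) by (simp add: Mstar_iff_positive_definite positive_definite_seq_def)
qed

section \<open>The weights and N-extremality of weighted measures\<close>

definition wt :: "real \<Rightarrow> real \<Rightarrow> real" where
  "wt \<alpha> x = (1 + x\<^sup>2) powr (- \<alpha>)"

lemma weighted_eq: "weighted \<alpha> \<mu> = density \<mu> (\<lambda>x. ennreal (wt \<alpha> x))"
  by (simp add: weighted_def wt_def)

lemma borel_measurable_wt [measurable]: "wt \<alpha> \<in> borel_measurable borel"
  unfolding wt_def by measurable

lemma wt_pos: "wt \<alpha> x > 0"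
proof -
  have "1 + x\<^sup>2 > 0" by (simp add: add_pos_nonneg)
  thus ?thesis by (simp add: wt_def)
qed

lemma wt_le_1: "\<alpha> \<ge> 0 \<Longrightarrow> wt \<alpha> x \<le> 1"
  unfolding wt_def using powr_mono[of "-\<alpha>" 0 "1 + x\<^sup>2"] by (simp split: if_splits)

lemma wt_half: "wt (1/2) x = 1 / sqrt (1 + x\<^sup>2)"
proof -
  have "1 + x\<^sup>2 > 0" by (simp add: add_pos_nonneg)
  hence "(1 + x\<^sup>2) powr (1/2) = sqrt (1 + x\<^sup>2)" by (intro powr_half_sqrt) simp
  moreover have "wt (1/2) x = inverse ((1 + x\<^sup>2) powr (1/2))" unfolding wt_def by (rule powr_minus)
  ultimately show ?thesis by (simp only: inverse_eq_divide)
qed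

lemma wt_le_half: "\<alpha> \<ge> 1/2 \<Longrightarrow> wt \<alpha> x \<le> wt (1/2) x"
  unfolding wt_def by (intro powr_mono) auto

lemma weighted_Mstar:
  assumes "\<mu> \<in> Mstar" "\<alpha> \<ge> 0"
  shows "weighted \<alpha> \<mu> \<in> Mstar"
  unfolding weighted_eq
proof (rule Mstar_density[OF assms(1), where C = 1 and q = 1])
  show "AE x in \<mu>. wt \<alpha> x \<le> 1 * (1 + x\<^sup>2)" using wt_le_1[OF assms(2)] by (intro AE_I2) (simp add: add_increasing2)
qed (use wt_pos in \<open>auto intro: less_imp_le\<close>)

lemma AE_weighted:
  assumes "sets \<mu> = sets borel" "AE x in \<mu>. P x"
  shows "AE x in weighted \<alpha> \<mu>. P x"
  unfolding weighted_eq using assms(2)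
  by (subst AE_density) (auto simp: assms(1) cong: measurable_cong_sets)

text \<open>The weight is at most 1, so approximability persists with the same f. The integral
  \<tau>' may change, but N-extremality asks only for some parameter.\<close>

lemma extremal_at_weighted:
  assumes \<mu>: "has_moments \<mu>" and f: "extremal_at \<mu> 0 \<epsilon> \<tau> f" and \<alpha>: "\<alpha> \<ge> 0"
  shows "\<exists>\<tau>'. extremal_at (weighted \<alpha> \<mu>) 0 \<epsilon> \<tau>' f"
proof -
  have ap: "poly_approximable (weighted \<alpha> \<mu>) f"
    unfolding weighted_eq using f wt_le_1[OF \<alpha>] wt_pos
    by (intro poly_approximable_density[OF \<mu>, where C = 1]) (auto simp: extremal_at_def less_imp_le)
  have ae0: "AE x in \<mu>. (x - 0) * f x = \<epsilon>" using f by (simp add: extremal_at_def)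
  have ae: "AE x in weighted \<alpha> \<mu>. (x - 0) * f x = \<epsilon>"
    by (rule AE_weighted[OF has_momentsD(1)[OF \<mu>] ae0])
  have [measurable]: "f \<in> borel_measurable \<mu>" using f by (simp add: extremal_at_def poly_approximable_def sq_integrable_def)
  have [measurable]: "wt \<alpha> \<in> borel_measurable \<mu>" by (rule borel_measurable_has_moments[OF \<mu>]) simp
  \<comment> \<open>For \<epsilon> = 0 the function f vanishes almost everywhere off 0, and at 0 the
    weight is 1, so the integral is unchanged and the pair stays nondegenerate.\<close>
  have "(LINT x|weighted \<alpha> \<mu>. f x) \<noteq> 0" if "\<epsilon> = 0"
  proof -
    have "(LINT x|weighted \<alpha> \<mu>. f x) = (LINT x|\<mu>. wt \<alpha> x * f x)"
      unfolding weighted_eq using wt_pos[of \<alpha>, THEN less_imp_le] by (subst integral_real_density) auto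
    also have "\<dots> = (LINT x|\<mu>. f x)"
    proof (intro integral_cong_AE)
      show "AE x in \<mu>. wt \<alpha> x * f x = f x"
        using ae0
      proof eventually_elim
        case (elim x)
        thus ?case using that by (cases "x = 0") (auto simp: wt_def)
      qed
    qed measurable
    finally show ?thesis using f that by (simp add: extremal_at_def)
  qed
  thus ?thesis using ap ae by (auto simp: extremal_at_def)
qed

lemma extremal_at_const_density:
  assumes \<mu>: "has_moments \<mu>" and f: "extremal_at \<mu> b \<epsilon> \<tau> f" and c: "c > 0"
  shows "extremal_at (density \<mu> (\<lambda>_. ennreal c)) b \<epsilon> (c * \<tau>) f"
proof -
  have [measurable]: "f \<in> borel_measurable \<mu>" using f by (simp add: extremal_at_def poly_approximable_def sq_integrable_def)
  have "poly_approximable (density \<mu> (\<lambda>_. ennreal c)) f"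
    using f c by (intro poly_approximable_density[OF \<mu>, where C = c]) (auto simp: extremal_at_def)
  moreover have "AE x in density \<mu> (\<lambda>_. ennreal c). (x - b) * f x = \<epsilon>"
  proof -
    have "AE x in \<mu>. (x - b) * f x = \<epsilon>" using f by (simp add: extremal_at_def)
    thus ?thesis by (subst AE_density) auto
  qed
  moreover have "(LINT x|density \<mu> (\<lambda>_. ennreal c). f x) = c * \<tau>"
    using f c by (subst integral_density_const) (auto simp: extremal_at_def)
  ultimately show ?thesis using f c by (auto simp: extremal_at_def)
qed

lemma scale_measure_eq_density: "scale_measure r \<mu> = density \<mu> (\<lambda>_. r)"
  by (rule measure_eqI) (auto simp: emeasure_density nn_integral_cmult_indicator)

lemma indeterminate_measureD:
  assumes "\<mu> \<in> M_indet"
  shows "indeterminate_sequence (moments \<mu>)" "\<mu> \<in> V (moments \<mu>)" "indeterminate_seq (moments \<mu>)"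
proof -
  have \<mu>: "\<mu> \<in> Mstar" using assms by (simp add: M_indet_def)
  then obtain \<nu> where \<nu>: "\<nu> \<in> V (moments \<mu>)" "\<nu> \<noteq> \<mu>" using assms by (auto simp: M_indet_def M_det_def V_def)
  show V: "\<mu> \<in> V (moments \<mu>)" using \<mu> by (simp add: V_def)
  show "indeterminate_sequence (moments \<mu>)" by (rule indeterminate_sequenceI[OF V \<nu>(1)]) (use \<nu>(2) in auto)
  show "indeterminate_seq (moments \<mu>)" using V \<nu> by (auto simp: indeterminate_seq_def)
qed

lemma indeterminate_measureI:
  assumes "\<mu> \<in> Mstar" "has_moments \<nu>" "moments \<nu> = moments \<mu>" "\<nu> \<noteq> \<mu>"
  shows "\<mu> \<in> M_indet"
  using assms by (auto simp: M_indet_def M_det_def Mstar_iff_positive_definite)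

text \<open>Normalisation multiplies \<tau> by the reciprocal c of the mass; rescaling f then brings
  the pair to the form (0, 1) or (1, t), with t = c \<tau> / \<epsilon>.\<close>

lemma N_extremalI:
  assumes \<nu>: "\<nu> \<in> M_indet" and f: "extremal_at \<nu> 0 \<epsilon> \<tau> f"
  shows "N_extremal \<nu>"
proof -
  interpret I: indeterminate_sequence "moments \<nu>" by (rule indeterminate_measureD(1)[OF \<nu>])
  have V: "\<nu> \<in> V (moments \<nu>)" by (rule indeterminate_measureD(2)[OF \<nu>])
  note hm = V_has_moments[OF V]
  interpret finite_measure \<nu> by (rule has_momentsD(3)[OF hm])
  define M where "M = moments \<nu> 0"
  have M: "M > 0" "M = measure \<nu> (space \<nu>)" using I.mass_pos by (auto simp: M_def moments_def)
  define c where "c = 1 / M"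
  have c: "c > 0" using M by (simp add: c_def)
  define N where "N = density \<nu> (\<lambda>_. ennreal c)"
  have "1 / emeasure \<nu> (space \<nu>) = ennreal c"
    unfolding c_def emeasure_eq_measure M(2)[symmetric] using M(1) by (metis divide_ennreal ennreal_1 less_imp_le zero_le_one)
  hence N: "normalize_mass \<nu> = N" by (simp add: normalize_mass_def N_def scale_measure_eq_density)
  have momN: "moments (density \<rho> (\<lambda>_. ennreal c)) n = c * moments \<rho> n" if "has_moments \<rho>" for \<rho> n
    using c has_momentsD(4)[OF that] unfolding moments_def by (subst integral_density_const) auto
  have hmN: "has_moments (density \<rho> (\<lambda>_. ennreal c))" if "has_moments \<rho>" for \<rho>
    by (rule has_moments_density(1)[OF that, where C = c]) (use c in \<open>auto simp: algebra_simps\<close>)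
  have NM: "N \<in> Mstar"
    unfolding N_def by (rule Mstar_density[where C = c and q = 1]) (use c V in \<open>auto simp: algebra_simps V_def\<close>)
  obtain \<sigma> where \<sigma>: "\<sigma> \<in> V (moments \<nu>)" "\<sigma> \<noteq> \<nu>" using I.not_unique by metis
  define S where "S = density \<sigma> (\<lambda>_. ennreal c)"
  have "S \<noteq> N"
  proof
    assume SN: "S = N"
    have "ennreal c * emeasure \<sigma> A = ennreal c * emeasure \<nu> A" if "A \<in> sets borel" for A
    proof -
      have "emeasure S A = emeasure N A" by (simp add: SN)
      thus ?thesis
        using that has_momentsD(1)[OF hm] has_momentsD(1)[OF V_has_moments[OF \<sigma>(1)]]
        by (simp add: S_def N_def emeasure_density nn_integral_cmult_indicator)
    qed
    hence "emeasure \<sigma> A = emeasure \<nu> A" if "A \<in> sets borel" for A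
      using that c by (simp add: ennreal_mult_cancel_left)
    hence "\<sigma> = \<nu>"
      using has_momentsD(1)[OF hm] has_momentsD(1)[OF V_has_moments[OF \<sigma>(1)]] by (intro measure_eqI) auto
    thus False using \<sigma> by simp
  qed
  moreover have "moments S = moments N"
    using momN[OF hm] momN[OF V_has_moments[OF \<sigma>(1)]] V_moments[OF \<sigma>(1)] by (simp add: S_def N_def fun_eq_iff)
  ultimately have "N \<in> M_indet"
    using hmN[OF V_has_moments[OF \<sigma>(1)]] by (intro indeterminate_measureI[OF NM]) (auto simp: S_def)
  then interpret N: indeterminate_sequence "moments N" by (rule indeterminate_measureD(1))
  have VN: "N \<in> V (moments N)" using NM by (simp add: V_def)
  have fN: "extremal_at N 0 \<epsilon> (c * \<tau>) f" unfolding N_def by (rule extremal_at_const_density[OF hm f c])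
  have "\<exists>t. t \<noteq> - \<infinity> \<and> mu_ext (moments N) t = N"
  proof (cases "\<epsilon> = 0")
    case True
    hence "c * \<tau> \<noteq> 0" using f c by (auto simp: extremal_at_def)
    from extremal_at_scale[OF fN, of "1 / (c * \<tau>)"] this True
    have "extremal_at N 0 (N.par_eps \<infinity>) (N.par_tau \<infinity>) (\<lambda>x. 1 / (c * \<tau>) * f x)"
      by (simp add: N.par_eps_def N.par_tau_def)
    hence "mu_ext (moments N) \<infinity> = N" by (rule N.mu_ext_eqI[OF VN])
    thus ?thesis by (intro exI[of _ "\<infinity>"]) simp
  next
    case False
    from extremal_at_scale[OF fN, of "1 / \<epsilon>"] False
    have "extremal_at N 0 (N.par_eps (ereal (c * \<tau> / \<epsilon>))) (N.par_tau (ereal (c * \<tau> / \<epsilon>))) (\<lambda>x. 1 / \<epsilon> * f x)"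
      by (simp add: N.par_eps_def N.par_tau_def)
    hence "mu_ext (moments N) (ereal (c * \<tau> / \<epsilon>)) = N" by (rule N.mu_ext_eqI[OF VN])
    thus ?thesis by (intro exI[of _ "ereal (c * \<tau> / \<epsilon>)"]) simp
  qed
  thus ?thesis unfolding N_extremal_def N using \<nu> by metis
qed

section \<open>Sums of measures and the competitor with an additional atom\<close>

definition measure_add :: "real measure \<Rightarrow> real measure \<Rightarrow> real measure" where
  "measure_add M N = measure_of UNIV (sets borel) (\<lambda>A. emeasure M A + emeasure N A)"

lemma sets_measure_add [simp, measurable_cong]: "sets (measure_add M N) = sets borel"
  unfolding measure_add_def by (metis sets.sets_measure_of_eq space_borel)

lemma emeasure_measure_add:
  assumes "sets M = sets borel" "sets N = sets borel" "A \<in> sets borel"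
  shows "emeasure (measure_add M N) A = emeasure M A + emeasure N A"
proof (rule emeasure_measure_of[OF measure_add_def])
  show "countably_additive (sets (measure_add M N)) (\<lambda>A. emeasure M A + emeasure N A)"
  proof (rule countably_additiveI)
    fix F :: "nat \<Rightarrow> real set"
    assume F: "range F \<subseteq> sets (measure_add M N)" "disjoint_family F" "\<Union> (range F) \<in> sets (measure_add M N)"
    have "(\<Sum>i. emeasure M (F i) + emeasure N (F i)) = (\<Sum>i. emeasure M (F i)) + (\<Sum>i. emeasure N (F i))"
      by (intro suminf_add[symmetric] summableI)
    also have "\<dots> = emeasure M (\<Union> (range F)) + emeasure N (\<Union> (range F))"
      using F assms by (simp add: suminf_emeasure)
    finally show "(\<Sum>i. emeasure M (F i) + emeasure N (F i)) = emeasure M (\<Union> (range F)) + emeasure N (\<Union> (range F))" .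
  qed
qed (use assms in \<open>auto simp: positive_def\<close>)

lemma nn_integral_measure_add:
  assumes [measurable_cong]: "sets M = sets borel" "sets N = sets borel"
    and f: "f \<in> borel_measurable borel"
  shows "(\<integral>\<^sup>+x. f x \<partial>measure_add M N) = (\<integral>\<^sup>+x. f x \<partial>M) + (\<integral>\<^sup>+x. f x \<partial>N)"
  using f
proof (induction rule: borel_measurable_induct)
  case (cong f g)
  hence "f = g" by (simp add: fun_eq_iff)
  thus ?case using cong by simp
next
  case (set A)
  thus ?case using assms by (simp add: emeasure_measure_add)
next
  case (mult u c)
  have [measurable]: "u \<in> borel_measurable borel" by fact
  show ?case using mult by (simp add: nn_integral_cmult distrib_left)
next
  case (add u v)
  have [measurable]: "u \<in> borel_measurable borel" "v \<in> borel_measurable borel" by fact+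
  show ?case using add by (simp add: nn_integral_add ac_simps)
next
  case (seq U)
  have [measurable]: "U i \<in> borel_measurable borel" for i by fact
  have eq: "(\<integral>\<^sup>+x. (SUP i. U i) x \<partial>K) = (SUP i. \<integral>\<^sup>+x. U i x \<partial>K)" if K: "sets K = sets borel" for K
  proof -
    have "U i \<in> borel_measurable K" for i using K by (simp cong: measurable_cong_sets)
    thus ?thesis using \<open>incseq U\<close> by (simp add: SUP_apply image_comp nn_integral_monotone_convergence_SUP)
  qed
  have mono: "incseq (\<lambda>i. \<integral>\<^sup>+x. U i x \<partial>K)" for K
    using \<open>incseq U\<close> by (auto simp: incseq_def le_fun_def intro!: nn_integral_mono)
  show ?case
    unfolding eq[OF sets_measure_add] eq[OF assms(1)] eq[OF assms(2)] seq.IH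
    by (rule ennreal_SUP_add[OF mono mono])
qed

lemma has_bochner_integral_measure_add:
  fixes f :: "real \<Rightarrow> real"
  assumes "sets M = sets borel" "sets N = sets borel" "f \<in> borel_measurable borel" "integrable M f" "integrable N f"
  shows "has_bochner_integral (measure_add M N) f ((LINT x|M. f x) + (LINT x|N. f x))"
proof -
  have i: "integrable (measure_add M N) f"
    using assms by (subst integrable_iff_bounded) (auto simp: nn_integral_measure_add integrable_iff_bounded)
  have fin: "(\<integral>\<^sup>+x. ennreal (g x) \<partial>K) < \<infinity>" if "integrable K f" "g = f \<or> g = (\<lambda>x. - f x)" for K g
  proof -
    have "(\<integral>\<^sup>+x. ennreal (g x) \<partial>K) \<le> (\<integral>\<^sup>+x. ennreal (norm (f x)) \<partial>K)"
      using that(2) by (intro nn_integral_mono ennreal_leI) auto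
    also have "\<dots> < \<infinity>" using that(1) by (simp only: integrable_iff_bounded)
    finally show ?thesis .
  qed
  have "(LINT x|measure_add M N. f x) = (LINT x|M. f x) + (LINT x|N. f x)"
    unfolding real_lebesgue_integral_def[OF i] real_lebesgue_integral_def[OF assms(4)] real_lebesgue_integral_def[OF assms(5)]
    using assms(1-3) fin[OF assms(4), of f] fin[OF assms(5), of f] fin[OF assms(4), of "\<lambda>x. - f x"] fin[OF assms(5), of "\<lambda>x. - f x"]
    by (simp add: nn_integral_measure_add enn2real_plus)
  thus ?thesis using i by (simp add: has_bochner_integral_iff)
qed

lemma AE_measure_add:
  assumes "sets M = sets borel" "sets N = sets borel" "{x. P x} \<in> sets borel" "AE x in M. P x" "AE x in N. P x"
  shows "AE x in measure_add M N. P x"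
proof -
  have c: "{x. \<not> P x} \<in> sets borel" using borel_comp[OF assms(3)] by (simp add: Collect_neg_eq)
  have sp: "space M = UNIV" "space N = UNIV" "space (measure_add M N) = UNIV"
    using sets_eq_imp_space_eq[OF assms(1)] sets_eq_imp_space_eq[OF assms(2)] sets_eq_imp_space_eq[OF sets_measure_add] by auto
  have "emeasure M {x. \<not> P x} = 0" "emeasure N {x. \<not> P x} = 0"
    using assms(4,5) c assms(1,2) sp by (auto simp: AE_iff_measurable[OF _ refl])
  hence "emeasure (measure_add M N) {x. \<not> P x} = 0" using c by (simp add: emeasure_measure_add assms)
  thus ?thesis using c sp by (subst AE_iff_measurable[OF _ refl]) auto
qed

text \<open>
  If \<open>\<phi>\<close> has the same moments as \<open>\<mu>\<close>, but a smaller integral of \<open>1 / (x + a)\<close>, then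
  \<open>\<mu> / (x + a)\<close> and \<open>\<phi> / (x + a) + m \<delta>\<^bsub>-a\<^esub>\<close> have the same moments, where \<open>m\<close> is the
  difference of the two integrals.
\<close>

lemma competitor_measure:
  assumes \<mu>: "\<mu> \<in> V s" and \<phi>: "\<phi> \<in> V s" and a: "a \<ge> 0" and \<delta>: "\<delta> > 0"
    and \<mu>a: "AE x in \<mu>. x + a \<ge> \<delta>" and \<phi>a: "AE x in \<phi>. x + a > 0"
    and int: "integrable \<phi> (\<lambda>x. 1 / (x + a))"
    and less: "(LINT x|\<phi>. 1 / (x + a)) < (LINT x|\<mu>. 1 / (x + a))"
  obtains \<kappa> where "has_moments \<kappa>" "moments \<kappa> = moments (weighted (1/2) \<mu>)" "\<kappa> \<noteq> weighted (1/2) \<mu>"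
    "(AE x in \<mu>. x \<ge> 0) \<Longrightarrow> (AE x in \<phi>. x \<ge> 0) \<Longrightarrow> a = 0 \<Longrightarrow> (AE x in \<kappa>. x \<ge> 0)"
proof -
  note hm\<mu> = V_has_moments[OF \<mu>] and hm\<phi> = V_has_moments[OF \<phi>]
  have [measurable_cong]: "sets \<mu> = sets borel" "sets \<phi> = sets borel"
    using has_momentsD(1)[OF hm\<mu>] has_momentsD(1)[OF hm\<phi>] by auto
  \<comment> \<open>Chosen so that c / (x + a) stays below the weight where x + a >= \<delta>: there
    sqrt(1 + x^2) <= 1 + \<bar>x\<bar> <= (x + a) + (1 + a) <= (x + a) / c.\<close>
  define c where "c = 1 / (1 + (1 + a) / \<delta>)"
  define d where "d = (LINT x|\<mu>. 1 / (x + a)) - (LINT x|\<phi>. 1 / (x + a))"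
  have c: "c > 0" unfolding c_def using a \<delta> by (simp add: add_pos_nonneg)
  have d: "d > 0" using less by (simp add: d_def)
  \<comment> \<open>The weight is split into c / (x + a) and a nonnegative rest \<open>g3\<close>.
    Only the first part is exchanged, for \<open>g1\<close> on \<phi> and the mass c d at -a. The
    absolute value and the maximum change nothing almost everywhere.\<close>
  define g1 where "g1 x = c * \<bar>1 / (x + a)\<bar>" for x
  define g3 where "g3 x = max 0 (wt (1/2) x - c / (x + a))" for x
  have [measurable]: "g1 \<in> borel_measurable borel" "g3 \<in> borel_measurable borel"
    unfolding g1_def g3_def by measurable
  have cmp: "c / (x + a) \<le> wt (1/2) x" if "x + a \<ge> \<delta>" for x
  proof -
    have "sqrt (1 + x\<^sup>2) \<le> 1 + \<bar>x\<bar>" by (rule real_le_lsqrt) (auto simp: power2_eq_square algebra_simps)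
    also have "\<dots> \<le> (x + a) + (1 + a)" using a that \<delta> by linarith
    also have "(1 + a) \<le> (1 + a) / \<delta> * (x + a)"
    proof -
      have "(1 + a) * \<delta> \<le> (1 + a) * (x + a)" using that a by (intro mult_left_mono) auto
      thus ?thesis using \<delta> by (simp add: field_simps)
    qed
    finally have "sqrt (1 + x\<^sup>2) \<le> (x + a) / c" by (simp add: c_def algebra_simps)
    moreover have "sqrt (1 + x\<^sup>2) > 0" by (simp add: add_pos_nonneg)
    ultimately show ?thesis using c that \<delta> by (simp add: wt_half field_simps)
  qed
  define M1 where "M1 = density \<phi> (\<lambda>x. ennreal (g1 x))"
  define M2 where "M2 = density (return borel (- a)) (\<lambda>x. ennreal (c * d))"
  define M3 where "M3 = density \<mu> (\<lambda>x. ennreal (g3 x))"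
  have sets [simp]: "sets M1 = sets borel" "sets M2 = sets borel" "sets M3 = sets borel"
    by (simp_all add: M1_def M2_def M3_def has_momentsD(1)[OF hm\<mu>] has_momentsD(1)[OF hm\<phi>])
  define \<kappa> where "\<kappa> = measure_add M1 (measure_add M2 M3)"
  have pow: "x ^ n = (x + a) * poly (synthetic_div (monom 1 n) (- a)) x + (- a) ^ n" for x :: real and n
    using poly_eq_synthetic_div[of "monom 1 n" x "- a"] by (simp add: poly_monom algebra_simps)
  let ?q = "\<lambda>n. synthetic_div (monom 1 n) (- a)"
  have I\<mu>: "integrable \<mu> (\<lambda>x. 1 / (x + a))"
  proof (rule finite_measure.integrable_const_bound[OF has_momentsD(3)[OF hm\<mu>], where B = "1 / \<delta>"])
    show "AE x in \<mu>. norm (1 / (x + a)) \<le> 1 / \<delta>"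
      using \<mu>a by eventually_elim (use \<delta> in \<open>auto simp: frac_le\<close>)
  qed measurable
  \<comment> \<open>Dividing x^n by x + a leaves the remainder (-a)^n, so for two solutions the
    moments of d\<rho> / (x + a) differ by (-a)^n times one constant: the moments of a point mass at
    -a.\<close>
  have key: "integrable \<rho> (\<lambda>x. x ^ n / (x + a))"
    "(LINT x|\<rho>. x ^ n / (x + a)) = moment_functional s (?q n) + (- a) ^ n * (LINT x|\<rho>. 1 / (x + a))"
    if \<rho>: "\<rho> \<in> V s" "AE x in \<rho>. x + a > 0" "integrable \<rho> (\<lambda>x. 1 / (x + a))" for \<rho> n
  proof -
    note h = V_has_moments[OF \<rho>(1)]
    have [measurable_cong]: "sets \<rho> = sets borel" by (rule has_momentsD(1)[OF h])
    have eq: "AE x in \<rho>. x ^ n / (x + a) = poly (?q n) x + (- a) ^ n * (1 / (x + a))"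
      using \<rho>(2)
    proof eventually_elim
      case (elim x)
      have "x ^ n / (x + a) = ((x + a) * poly (?q n) x + (- a) ^ n) / (x + a)" using pow[of x n] by (rule arg_cong)
      thus ?case using elim by (simp add: add_divide_distrib)
    qed
    have i: "integrable \<rho> (\<lambda>x. poly (?q n) x + (- a) ^ n * (1 / (x + a)))"
      using integrable_real_poly[OF h] \<rho>(3) by (intro Bochner_Integration.integrable_add integrable_mult_right)
    show "integrable \<rho> (\<lambda>x. x ^ n / (x + a))"
      by (subst integrable_cong_AE[OF _ _ eq]) (use i in measurable)
    have "(LINT x|\<rho>. x ^ n / (x + a)) = (LINT x|\<rho>. poly (?q n) x + (- a) ^ n * (1 / (x + a)))"
      by (rule integral_cong_AE[OF _ _ eq]) measurable
    also have "\<dots> = (LINT x|\<rho>. poly (?q n) x) + (- a) ^ n * (LINT x|\<rho>. 1 / (x + a))"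
      using integrable_real_poly[OF h, of "?q n"] \<rho>(3)
      by (subst Bochner_Integration.integral_add) (auto simp del: times_divide_eq_right mult_1_right intro!: integrable_mult_right)
    finally show "(LINT x|\<rho>. x ^ n / (x + a)) = moment_functional s (?q n) + (- a) ^ n * (LINT x|\<rho>. 1 / (x + a))"
      using integral_real_poly[OF h, of "?q n"] V_moments[OF \<rho>(1)] by simp
  qed
  have \<mu>a': "AE x in \<mu>. x + a > 0" using \<mu>a by eventually_elim (use \<delta> in auto)
  have pm [measurable]: "(\<lambda>x::real. x ^ n) \<in> borel_measurable \<rho>" if "sets \<rho> = sets borel" for \<rho> n
    using that by (simp cong: measurable_cong_sets)
  have 1: "integrable M1 (\<lambda>x. x ^ n)" "(LINT x|M1. x ^ n) = c * (LINT x|\<phi>. x ^ n / (x + a))" for n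
  proof -
    have eq: "AE x in \<phi>. g1 x * x ^ n = c * (x ^ n / (x + a))"
      using \<phi>a by eventually_elim (auto simp: g1_def)
    have "integrable \<phi> (\<lambda>x. g1 x * x ^ n)"
      by (subst integrable_cong_AE[OF _ _ eq]) (use integrable_mult_right[OF key(1)[OF \<phi> \<phi>a int], of c n] in \<open>simp_all only:, measurable\<close>)
    thus "integrable M1 (\<lambda>x. x ^ n)"
      unfolding M1_def using c by (subst integrable_real_density) (auto simp: g1_def)
    have "(LINT x|M1. x ^ n) = (LINT x|\<phi>. g1 x * x ^ n)"
      unfolding M1_def using c by (subst integral_real_density) (auto simp: g1_def)
    also have "\<dots> = (LINT x|\<phi>. c * (x ^ n / (x + a)))" by (rule integral_cong_AE[OF _ _ eq]) measurable
    also have "\<dots> = c * (LINT x|\<phi>. x ^ n / (x + a))" by (rule integral_mult_right_zero)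
    finally show "(LINT x|M1. x ^ n) = c * (LINT x|\<phi>. x ^ n / (x + a))" .
  qed
  have 2: "integrable M2 (\<lambda>x. x ^ n)" "(LINT x|M2. x ^ n) = c * d * (- a) ^ n" for n
  proof -
    interpret R: prob_space "return borel (- a)" by (intro prob_space_return) simp
    have "integrable (return borel (- a)) (\<lambda>x. x ^ n)"
      by (rule R.integrable_const_bound[where B = "\<bar>(- a) ^ n\<bar>"]) (auto simp: AE_return)
    thus "integrable M2 (\<lambda>x. x ^ n)"
      unfolding M2_def using c d by (subst integrable_real_density) auto
    show "(LINT x|M2. x ^ n) = c * d * (- a) ^ n"
      unfolding M2_def using c d by (subst integral_density_const) (auto simp: integral_return)
  qed
  define W where "W = weighted (1/2) \<mu>"
  have Wint: "integrable \<mu> (\<lambda>x. wt (1/2) x * x ^ n)" "(LINT x|W. x ^ n) = (LINT x|\<mu>. wt (1/2) x * x ^ n)" for n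
  proof -
    have "AE x in \<mu>. wt (1/2) x \<le> 1 * (1 + x\<^sup>2)" using wt_le_1[of "1/2"] by (intro AE_I2) (simp add: add_increasing2)
    from has_moments_density(2)[OF hm\<mu> borel_measurable_wt _ this, of "monom 1 n"]
    show "integrable \<mu> (\<lambda>x. wt (1/2) x * x ^ n)" using wt_pos less_imp_le by (auto simp: poly_monom)
    show "(LINT x|W. x ^ n) = (LINT x|\<mu>. wt (1/2) x * x ^ n)"
      unfolding W_def weighted_eq using wt_pos[of "1/2", THEN less_imp_le] by (subst integral_real_density) auto
  qed
  have 3: "integrable M3 (\<lambda>x. x ^ n)" "(LINT x|M3. x ^ n) = (LINT x|W. x ^ n) - c * (LINT x|\<mu>. x ^ n / (x + a))" for n
  proof -
    have eq: "AE x in \<mu>. g3 x * x ^ n = wt (1/2) x * x ^ n - c * (x ^ n / (x + a))"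
      using \<mu>a by eventually_elim (use cmp in \<open>auto simp: g3_def max_def algebra_simps\<close>)
    have i: "integrable \<mu> (\<lambda>x. wt (1/2) x * x ^ n - c * (x ^ n / (x + a)))"
      using Wint(1) key(1)[OF \<mu> \<mu>a' I\<mu>] by (intro Bochner_Integration.integrable_diff integrable_mult_right)
    have "integrable \<mu> (\<lambda>x. g3 x * x ^ n)"
      by (subst integrable_cong_AE[OF _ _ eq]) (use i in auto)
    thus "integrable M3 (\<lambda>x. x ^ n)"
      unfolding M3_def by (subst integrable_real_density) (auto simp: g3_def)
    have "(LINT x|M3. x ^ n) = (LINT x|\<mu>. g3 x * x ^ n)"
      unfolding M3_def by (subst integral_real_density) (auto simp: g3_def)
    also have "\<dots> = (LINT x|\<mu>. wt (1/2) x * x ^ n - c * (x ^ n / (x + a)))" by (rule integral_cong_AE[OF _ _ eq]) measurable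
    also have "\<dots> = (LINT x|\<mu>. wt (1/2) x * x ^ n) - c * (LINT x|\<mu>. x ^ n / (x + a))"
      using Wint(1) key(1)[OF \<mu> \<mu>a' I\<mu>, of n]
      by (subst Bochner_Integration.integral_diff) (auto simp del: times_divide_eq_right intro!: integrable_mult_right)
    finally show "(LINT x|M3. x ^ n) = (LINT x|W. x ^ n) - c * (LINT x|\<mu>. x ^ n / (x + a))" by (simp add: Wint(2))
  qed
  have hb: "has_bochner_integral \<kappa> (\<lambda>x. x ^ n) ((LINT x|M1. x ^ n) + ((LINT x|M2. x ^ n) + (LINT x|M3. x ^ n)))" for n
  proof -
    have h23: "has_bochner_integral (measure_add M2 M3) (\<lambda>x. x ^ n) ((LINT x|M2. x ^ n) + (LINT x|M3. x ^ n))"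
      by (rule has_bochner_integral_measure_add) (auto simp: 2 3)
    show ?thesis
      unfolding \<kappa>_def has_bochner_integral_integral_eq[OF h23, symmetric]
      by (rule has_bochner_integral_measure_add) (use integrable.intros[OF h23] in \<open>auto simp: 1\<close>)
  qed
  have hm\<kappa>: "has_moments \<kappa>"
    unfolding has_moments_def using integrable.intros[OF hb] by (auto simp: \<kappa>_def)
  moreover have "moments \<kappa> = moments (weighted (1/2) \<mu>)"
  proof
    fix n
    show "moments \<kappa> n = moments (weighted (1/2) \<mu>) n"
      unfolding moments_def has_bochner_integral_integral_eq[OF hb] 1 2 3 key(2)[OF \<phi> \<phi>a int] key(2)[OF \<mu> \<mu>a' I\<mu>] W_def[symmetric]
      by (simp add: d_def algebra_simps)
  qed
  \<comment> \<open>The atom at -a tells the two apart, since \<mu> gives no mass to -a.\<close>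
  moreover have "\<kappa> \<noteq> weighted (1/2) \<mu>"
  proof
    assume eq: "\<kappa> = weighted (1/2) \<mu>"
    have "emeasure M2 {- a} \<le> emeasure \<kappa> {- a}"
    proof -
      have "emeasure \<kappa> {- a} = emeasure M2 {- a} + (emeasure M1 {- a} + emeasure M3 {- a})"
        unfolding \<kappa>_def by (simp add: emeasure_measure_add ac_simps)
      thus ?thesis by (simp only:) simp
    qed
    moreover have "emeasure M2 {- a} = ennreal (c * d)"
      unfolding M2_def by (subst emeasure_density) (auto simp: nn_integral_return)
    moreover have "emeasure \<kappa> {- a} = 0"
    proof -
      have "AE x in \<mu>. x \<noteq> - a" using \<mu>a' by eventually_elim auto
      hence "AE x in weighted (1/2) \<mu>. x \<noteq> - a" by (rule AE_weighted[OF has_momentsD(1)[OF hm\<mu>]])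
      moreover have "{x \<in> space (weighted (1/2) \<mu>). \<not> x \<noteq> - a} = {- a}"
        by (auto simp: weighted_eq has_momentsD(2)[OF hm\<mu>])
      moreover have "{- a} \<in> sets (weighted (1/2) \<mu>)" by (simp add: weighted_eq has_momentsD(1)[OF hm\<mu>])
      ultimately show ?thesis unfolding eq by (subst (asm) AE_iff_measurable) auto
    qed
    moreover have "c * d > 0" using c d by simp
    ultimately show False by (simp add: ennreal_eq_0_iff)
  qed
  moreover have "AE x in \<kappa>. x \<ge> 0" if "AE x in \<mu>. x \<ge> 0" "AE x in \<phi>. x \<ge> 0" "a = 0"
    unfolding \<kappa>_def
  proof (intro AE_measure_add)
    show "AE x in M1. x \<ge> 0" unfolding M1_def using that(2) by (subst AE_density) auto
    show "AE x in M2. x \<ge> 0" unfolding M2_def using that(3) by (subst AE_density) (auto simp: AE_return)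
    show "AE x in M3. x \<ge> 0" unfolding M3_def using that(1) by (subst AE_density) auto
  qed auto
  ultimately show ?thesis by (rule that)
qed

section \<open>Stieltjes moment sequences\<close>

lemma V_Stieltjes_iff: "\<mu> \<in> V_Stieltjes s \<longleftrightarrow> \<mu> \<in> V s \<and> (AE x in \<mu>. x \<ge> 0)"
  using AE_msupport_iff_closed[of \<mu> "{0..}"] has_momentsD(1)[OF V_has_moments]
  by (auto simp: V_Stieltjes_def)

section \<open>Interpolation of 1 / (x + a) and determinacy\<close>

text \<open>For q(b) nonzero this is (1 - q(x) / q(b)) / (x - b), the polynomial that agrees with 1
  / (x - b) at the zeros of q.\<close>

definition interp :: "real poly \<Rightarrow> real \<Rightarrow> real poly" where
  "interp q b = smult (- 1 / poly q b) (synthetic_div q b)"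

lemma interp_mult:
  assumes "poly q b \<noteq> 0"
  shows "[:-b, 1:] * interp q b = 1 - smult (1 / poly q b) q"
proof (rule poly_ext)
  fix x
  have "poly ([:-b, 1:] * interp q b) x = - 1 / poly q b * ((x - b) * poly (synthetic_div q b) x)"
    by (simp add: interp_def algebra_simps)
  also have "\<dots> = - 1 / poly q b * (poly q x - poly q b)" by (simp add: poly_eq_synthetic_div)
  also have "\<dots> = poly (1 - smult (1 / poly q b) q) x" using assms by (simp add: field_simps)
  finally show "poly ([:-b, 1:] * interp q b) x = poly (1 - smult (1 / poly q b) q) x" .
qed

lemma degree_interp: "degree (interp q b) \<le> degree q - 1"
  unfolding interp_def by (rule order_trans[OF degree_smult_le]) (simp add: degree_synthetic_div)

text \<open>If q is orthogonal to p with respect to u, then \<open>interp q b\<close> acts like 1 /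
  (x - b) when tested against (x - b) p. Later p is the interpolant itself, with u = 1 for the
  Friedrichs and u = x for the Krein solution.\<close>

lemma interp_orth:
  assumes "poly q b \<noteq> 0" "moment_functional s (u * q * p) = 0"
  shows "moment_functional s (u * [:-b, 1:] * interp q b * p) = moment_functional s (u * p)"
proof -
  have "u * [:-b, 1:] * interp q b * p = u * ([:-b, 1:] * interp q b) * p" by (simp only: mult_ac)
  also have "\<dots> = u * p - smult (1 / poly q b) (u * q * p)"
    unfolding interp_mult[OF assms(1)] by (simp add: algebra_simps)
  finally show ?thesis using assms(2) by (simp add: moment_functional_linear)
qed

lemma quadrature_converges_AE_nonneg:
  assumes \<mu>: "has_moments \<mu>" and qc: "quadrature_converges Z m \<mu>" and nonneg: "\<And>n y. y \<in> Z n \<Longrightarrow> y \<ge> 0"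
  shows "AE x in \<mu>. x \<ge> 0"
proof -
  define h where "h x = min 1 (max 0 (- x))" for x :: real
  have cont: "continuous_on UNIV h" unfolding h_def by (intro continuous_intros)
  have bd: "\<bar>h x\<bar> \<le> 1" for x by (auto simp: h_def)
  have "(\<Sum>y\<in>Z n. m n y * h y) = 0" for n
    using nonneg by (intro sum.neutral) (auto simp: h_def)
  hence "(LINT x|\<mu>. h x) = 0"
    using quadrature_convergesD[OF qc cont bd] by (simp add: LIMSEQ_const_iff)
  moreover have "integrable \<mu> h"
    by (rule integrable_bounded_continuous[OF has_momentsD(3,1)[OF \<mu>] cont bd])
  ultimately have "AE x in \<mu>. h x = 0"
    by (subst (asm) integral_nonneg_eq_0_iff_AE) (auto simp: h_def)
  thus ?thesis by eventually_elim (auto simp: h_def min_def max_def split: if_splits)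
qed

text \<open>Expanding the square gives u / (x + a) - 2 u \<pi> + u (x + a) \<pi>^2, and the normal
  equation assumed for \<pi> merges the last two terms. The error is thus the gap between an
  integral and a number that depends on the moments only, the same for all solutions.\<close>

lemma integral_approximant_square:
  assumes \<nu>: "\<nu> \<in> V s" and ae: "AE x in \<nu>. x + a \<ge> \<delta> \<and> poly u x \<ge> 0" and \<delta>: "\<delta> > 0"
    and \<pi>: "moment_functional s (u * [:a, 1:] * \<pi> * \<pi>) = moment_functional s (u * \<pi>)"
  shows "integrable \<nu> (\<lambda>x. poly u x / (x + a))"
    "integrable \<nu> (\<lambda>x. poly u x * (x + a) * (1 / (x + a) - poly \<pi> x)\<^sup>2)"
    "(LINT x|\<nu>. poly u x * (x + a) * (1 / (x + a) - poly \<pi> x)\<^sup>2) =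
      (LINT x|\<nu>. poly u x / (x + a)) - moment_functional s (u * \<pi>)"
proof -
  note hm = V_has_moments[OF \<nu>]
  have [measurable_cong]: "sets \<nu> = sets borel" by (rule has_momentsD(1)[OF hm])
  show i: "integrable \<nu> (\<lambda>x. poly u x / (x + a))"
  proof (rule Bochner_Integration.integrable_bound)
    show "integrable \<nu> (\<lambda>x. \<bar>poly u x\<bar> / \<delta>)"
      using integrable_abs[OF integrable_real_poly[OF hm, of u]] by simp
    show "AE x in \<nu>. norm (poly u x / (x + a)) \<le> norm (\<bar>poly u x\<bar> / \<delta>)"
      using ae by eventually_elim (use \<delta> in \<open>auto simp: frac_le\<close>)
  qed measurable
  let ?g = "\<lambda>x. poly u x / (x + a) - 2 * poly (u * \<pi>) x + poly (u * [:a, 1:] * \<pi> * \<pi>) x"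
  have eq: "AE x in \<nu>. poly u x * (x + a) * (1 / (x + a) - poly \<pi> x)\<^sup>2 = ?g x"
    using ae
  proof eventually_elim
    case (elim x)
    hence "x + a \<noteq> 0" using \<delta> by auto
    moreover have "U * w * (1 / w - p)\<^sup>2 = U / w - 2 * (U * p) + U * w * p * p" if "w \<noteq> 0" for U w p :: real
      using that by (simp add: power2_eq_square field_simps)
    moreover have "poly [:a, 1:] x = x + a" by simp
    ultimately show ?case by (simp only: poly_mult)
  qed
  have ig: "integrable \<nu> ?g"
    using i integrable_real_poly[OF hm] by (intro Bochner_Integration.integrable_add Bochner_Integration.integrable_diff integrable_mult_right)
  show "integrable \<nu> (\<lambda>x. poly u x * (x + a) * (1 / (x + a) - poly \<pi> x)\<^sup>2)"
    by (subst integrable_cong_AE[OF _ _ eq]) (use ig in \<open>simp_all only:, measurable\<close>)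
  have "(LINT x|\<nu>. poly u x * (x + a) * (1 / (x + a) - poly \<pi> x)\<^sup>2) = (LINT x|\<nu>. ?g x)"
    by (rule integral_cong_AE[OF _ _ eq]) measurable
  also have "\<dots> = (LINT x|\<nu>. poly u x / (x + a)) - 2 * (LINT x|\<nu>. poly (u * \<pi>) x) + (LINT x|\<nu>. poly (u * [:a, 1:] * \<pi> * \<pi>) x)"
    using i integrable_real_poly[OF hm, of "u * \<pi>"] integrable_real_poly[OF hm, of "u * [:a, 1:] * \<pi> * \<pi>"]
    by (simp del: poly_mult)
  also have "\<dots> = (LINT x|\<nu>. poly u x / (x + a)) - moment_functional s (u * \<pi>)"
    unfolding integral_real_poly[OF hm] V_moments[OF \<nu>] \<pi> by simp
  finally show "(LINT x|\<nu>. poly u x * (x + a) * (1 / (x + a) - poly \<pi> x)\<^sup>2) =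
      (LINT x|\<nu>. poly u x / (x + a)) - moment_functional s (u * \<pi>)" .
qed

lemma wt_half_le:
  assumes "x \<ge> 0"
  shows "wt (1/2) x \<le> 2 / (x + 1)"
proof -
  have "4 * ((x + 1) / 2)\<^sup>2 = x\<^sup>2 + 2 * x + 1" by (simp add: power2_eq_square field_simps)
  moreover have "2 * x \<le> x\<^sup>2 + 1" using sum_squares_bound[of x 1] by simp
  moreover have "x\<^sup>2 \<ge> 0" by simp
  ultimately have "((x + 1) / 2)\<^sup>2 \<le> 1 + x\<^sup>2" by linarith
  hence "(x + 1) / 2 \<le> sqrt (1 + x\<^sup>2)" by (rule real_le_rsqrt)
  moreover have "sqrt (1 + x\<^sup>2) > 0" by (simp add: add_pos_nonneg)
  ultimately show ?thesis using assms by (simp add: wt_half field_simps)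
qed

text \<open>
  The polynomials \<open>1 - (x + 1) \<pi>\<close> take the value 1 at \<open>-1\<close> and become arbitrarily small in the
  weighted space, so that this point evaluation is unbounded.
\<close>

lemma determinate_if_approximants:
  assumes \<mu>: "\<mu> \<in> V s" "AE x in \<mu>. x \<ge> 0" and u: "u \<noteq> 0" "AE x in \<mu>. 0 \<le> poly u x \<and> poly u x \<le> 1 + x\<^sup>2" and \<alpha>: "\<alpha> \<ge> 1/2"
    and ap: "\<And>e. e > 0 \<Longrightarrow> \<exists>\<pi>. moment_functional s (u * [:1, 1:] * \<pi> * \<pi>) = moment_functional s (u * \<pi>) \<and>
      \<bar>(LINT x|\<mu>. poly u x / (x + 1)) - moment_functional s (u * \<pi>)\<bar> < e"
  shows "density \<mu> (\<lambda>x. ennreal (wt \<alpha> x * \<bar>poly u x\<bar>)) \<in> M_det"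
proof (rule determinateI[where b = "-1"])
  note hm = V_has_moments[OF \<mu>(1)]
  have [measurable_cong]: "sets \<mu> = sets borel" by (rule has_momentsD(1)[OF hm])
  show "density \<mu> (\<lambda>x. ennreal (wt \<alpha> x * \<bar>poly u x\<bar>)) \<in> Mstar"
  proof (rule Mstar_density[where C = 1 and q = u])
    show "\<mu> \<in> Mstar" using \<mu>(1) by (simp add: V_def)
    show "AE x in \<mu>. wt \<alpha> x * \<bar>poly u x\<bar> \<le> 1 * (1 + x\<^sup>2)"
      using u(2)
    proof eventually_elim
      case (elim x)
      have "wt \<alpha> x * \<bar>poly u x\<bar> \<le> 1 * \<bar>poly u x\<bar>" using \<alpha> by (intro mult_right_mono wt_le_1) auto
      thus ?case using elim by simp
    qed
  qed (use u(1) wt_pos in \<open>auto simp: less_imp_le\<close>)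
  fix e :: real assume "e > 0"
  then obtain \<pi> where \<pi>: "moment_functional s (u * [:1, 1:] * \<pi> * \<pi>) = moment_functional s (u * \<pi>)"
      "\<bar>(LINT x|\<mu>. poly u x / (x + 1)) - moment_functional s (u * \<pi>)\<bar> < e / 2"
    using ap[of "e / 2"] by auto
  define R where "R = 1 - [:1, 1:] * \<pi>"
  have ae: "AE x in \<mu>. x + 1 \<ge> 1 \<and> poly u x \<ge> 0" using \<mu>(2) u(2) by eventually_elim auto
  note I = integral_approximant_square[OF \<mu>(1) ae _ \<pi>(1), simplified]
  have le: "AE x in \<mu>. wt \<alpha> x * \<bar>poly u x\<bar> * (poly R x)\<^sup>2 \<le> 2 * (poly u x * (x + 1) * (1 / (x + 1) - poly \<pi> x)\<^sup>2)"
    using ae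
  proof eventually_elim
    case (elim x)
    have x1: "x + 1 > 0" using elim by simp
    have R: "poly R x = (x + 1) * (1 / (x + 1) - poly \<pi> x)" using x1 by (simp add: R_def field_simps)
    \<comment> \<open>Of the two factors x + 1 in \<open>(poly R x)\<^sup>2\<close> the weight
      absorbs one; the other is the one in the approximation error. This is where \<alpha> >= 1/2
      enters.\<close>
    have "wt \<alpha> x \<le> 2 / (x + 1)" using wt_le_half[OF \<alpha>, of x] wt_half_le[of x] elim by simp
    hence "wt \<alpha> x * (poly u x * (poly R x)\<^sup>2) \<le> 2 / (x + 1) * (poly u x * (poly R x)\<^sup>2)"
      using elim by (intro mult_right_mono) auto
    also have "\<dots> = 2 * (poly u x * (x + 1) * (1 / (x + 1) - poly \<pi> x)\<^sup>2)"
      unfolding R power_mult_distrib using x1 by (simp add: power2_eq_square[of "x + 1"])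
    finally show ?case using elim by (simp add: mult.assoc)
  qed
  have "(LINT x|density \<mu> (\<lambda>x. ennreal (wt \<alpha> x * \<bar>poly u x\<bar>)). (poly R x)\<^sup>2) = (LINT x|\<mu>. wt \<alpha> x * \<bar>poly u x\<bar> * (poly R x)\<^sup>2)"
    using wt_pos[of \<alpha>, THEN less_imp_le] by (subst integral_real_density) auto
  also have "\<dots> \<le> (LINT x|\<mu>. 2 * (poly u x * (x + 1) * (1 / (x + 1) - poly \<pi> x)\<^sup>2))"
  proof (rule integral_mono_AE')
    show "integrable \<mu> (\<lambda>x. 2 * (poly u x * (x + 1) * (1 / (x + 1) - poly \<pi> x)\<^sup>2))"
      by (rule integrable_mult_right[OF I(2)])
    show "AE x in \<mu>. 0 \<le> 2 * (poly u x * (x + 1) * (1 / (x + 1) - poly \<pi> x)\<^sup>2)"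
      using ae by eventually_elim auto
  qed (rule le)
  also have "\<dots> = 2 * (LINT x|\<mu>. poly u x * (x + 1) * (1 / (x + 1) - poly \<pi> x)\<^sup>2)" by (rule integral_mult_right_zero)
  also have "\<dots> < e" unfolding I(3) using le_less_trans[OF abs_ge_self \<pi>(2)] by (simp add: pos_less_divide_eq mult.commute)
  finally show "\<exists>p. poly p (- 1) = 1 \<and> (LINT x|density \<mu> (\<lambda>x. ennreal (wt \<alpha> x * \<bar>poly u x\<bar>)). (poly p x)\<^sup>2) < e"
    by (intro exI[of _ R]) (simp add: R_def)
qed

section \<open>Positivity on the half-line and Gauss quadrature of 1/x\<close>

locale stieltjes_sequence = indeterminate_sequence +
  assumes stieltjes: "V_Stieltjes s \<noteq> {}"
begin

lemma L_pos:
  assumes "p \<noteq> 0" "\<And>x. x \<ge> 0 \<Longrightarrow> poly p x \<ge> (0::real)"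
  shows "L p > 0"
proof -
  obtain \<sigma> where \<sigma>: "\<sigma> \<in> V s" "AE x in \<sigma>. x \<ge> 0" using stieltjes by (auto simp: V_Stieltjes_iff)
  note hm = V_has_moments[OF \<sigma>(1)]
  have nn: "AE x in \<sigma>. poly p x \<ge> 0" using \<sigma>(2) by eventually_elim (rule assms(2))
  have "L p = (LINT x|\<sigma>. poly p x)" using integral_real_poly[OF hm] V_moments[OF \<sigma>(1)] by simp
  moreover have "(LINT x|\<sigma>. poly p x) \<ge> 0" by (rule integral_nonneg_AE[OF nn])
  moreover have "(LINT x|\<sigma>. poly p x) \<noteq> 0"
  proof
    assume "(LINT x|\<sigma>. poly p x) = 0"
    hence "AE x in \<sigma>. poly p x = 0"
      by (subst (asm) integral_nonneg_eq_0_iff_AE[OF integrable_real_poly[OF hm] nn])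
    hence "L (p * p) = 0" using AE_poly_zero_iff_square[OF hm] V_moments[OF \<sigma>(1)] by simp
    thus False using L_square_pos[OF assms(1)] by simp
  qed
  ultimately show ?thesis by simp
qed

lemma L_nonneg: "(\<And>x. x \<ge> 0 \<Longrightarrow> poly p x \<ge> (0::real)) \<Longrightarrow> L p \<ge> 0"
  using L_pos[of p] by (cases "p = 0") (auto intro: less_imp_le)

text \<open>For y <= 0 the product Q r = (x - y) r^2 would be nonnegative on the half-line, yet Q is
  orthogonal to r. The argument needs deg Q <= n, so that r has degree below n.\<close>

lemma quasi_orthogonal_root_pos:
  assumes Q: "Q \<noteq> 0" "degree Q \<le> n" and orth: "\<And>r. degree r < n \<Longrightarrow> L (Q * r) = 0" and y: "poly Q y = (0::real)"
  shows "y > 0"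
proof (rule ccontr)
  assume "\<not> y > 0"
  hence y0: "y \<le> 0" by simp
  obtain r where r: "Q = [:-y, 1:] * r" using y unfolding poly_eq_0_iff_dvd by (elim dvdE)
  have r0: "r \<noteq> 0" using Q r by auto
  have "degree Q = Suc (degree r)" unfolding r using r0 by (subst degree_mult_eq) auto
  hence "L (Q * r) = 0" using Q by (intro orth) simp
  moreover have "L (Q * r) > 0"
  proof (rule L_pos)
    show "Q * r \<noteq> 0" using Q r0 by simp
    show "poly (Q * r) x \<ge> 0" if "x \<ge> 0" for x
    proof -
      have "poly (Q * r) x = (x - y) * (poly r x * poly r x)" by (simp add: r algebra_simps)
      also have "\<dots> \<ge> 0" using that y0 by simp
      finally show ?thesis .
    qed
  qed
  ultimately show False by simp
qed

lemma op_root_pos: "poly (op n) y = 0 \<Longrightarrow> y > 0"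
proof (rule quasi_orthogonal_root_pos[of "op n" n])
  show "op n \<noteq> 0" using L_orthonormal_real[of n n] by auto
  show "L (op n * r) = 0" if "degree r < n" for r using op_orth_lower[OF that] by simp
qed auto

lemma pfun_0_nonzero: "pfun s n (0::real) \<noteq> 0"
  using op_root_pos[of n 0] by (auto simp: pfun_real)

text \<open>The value for 1/x of the Gauss formula with the zeros of p_n as nodes: by
  \<open>L_gauss_poly\<close> it integrates the interpolant of 1/x at these zeros.\<close>

definition gauss_value :: "nat \<Rightarrow> real" where
  "gauss_value n = - qfun s n 0 / pfun s n 0"

definition gauss_poly :: "nat \<Rightarrow> real poly" where
  "gauss_poly n = interp (op n) 0"

lemma L_gauss_poly: "L (gauss_poly n) = gauss_value n"
  by (simp add: gauss_poly_def interp_def gauss_value_def moment_functional_linear qfun_eq second_kind_def pfun_real)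

lemma gauss_poly_mult:
  assumes "degree \<pi> < n"
  shows "L ([:0, 1:] * gauss_poly n * \<pi>) = L \<pi>"
proof -
  have "poly (op n) 0 \<noteq> 0" using pfun_0_nonzero[of n] by (simp add: pfun_real)
  moreover have "L (1 * op n * \<pi>) = 0" using op_orth_lower[OF assms] by simp
  ultimately show ?thesis using interp_orth[of "op n" 0 s 1 \<pi>] by (simp add: gauss_poly_def)
qed

text \<open>Completing the square around \<rho> = \<open>gauss_poly n\<close>, since x (\<pi> -
  \<rho>)^2 has nonnegative integral. The Gauss value is the maximum over degrees below n and
  therefore increases with n.\<close>

lemma gauss_variational:
  assumes "degree \<pi> < n"
  shows "2 * L \<pi> - L ([:0, 1:] * \<pi> * \<pi>) \<le> gauss_value n"
proof -
  let ?x = "[:0, 1:] :: real poly"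
  define \<rho> where "\<rho> = gauss_poly n"
  have d: "degree \<rho> < n" using assms degree_interp[of "op n" 0] by (simp add: \<rho>_def gauss_poly_def)
  have "0 \<le> L (?x * (\<pi> - \<rho>) * (\<pi> - \<rho>))"
    by (rule L_nonneg) (simp add: mult.assoc)
  also have "?x * (\<pi> - \<rho>) * (\<pi> - \<rho>) = ?x * \<pi> * \<pi> - ?x * \<rho> * \<pi> - ?x * \<rho> * \<pi> + ?x * \<rho> * \<rho>"
    by (simp add: algebra_simps)
  also have "L \<dots> = L (?x * \<pi> * \<pi>) - 2 * L \<pi> + L \<rho>"
    unfolding moment_functional_linear \<rho>_def gauss_poly_mult[OF assms] gauss_poly_mult[OF d[unfolded \<rho>_def]] by simp
  finally show ?thesis by (simp add: \<rho>_def L_gauss_poly)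
qed

lemma gauss_value_mono: "n > 0 \<Longrightarrow> gauss_value n \<le> gauss_value (Suc n)"
proof -
  assume n: "n > 0"
  have d: "degree (gauss_poly n) < n" using n degree_interp[of "op n" 0] by (simp add: gauss_poly_def)
  have "gauss_value n = 2 * L (gauss_poly n) - L ([:0, 1:] * gauss_poly n * gauss_poly n)"
    unfolding gauss_poly_mult[OF d] L_gauss_poly by simp
  also have "\<dots> \<le> gauss_value (Suc n)" using d by (intro gauss_variational) simp
  finally show ?thesis .
qed

lemma gauss_value_pos: "n > 0 \<Longrightarrow> gauss_value n > 0"
proof -
  assume n: "n > 0"
  have s1: "s 1 > 0" using L_pos[of "[:0, 1:]"] by (simp add: moment_functional_def)
  \<comment> \<open>The constant s_0 / s_1 maximises the variational expression 2 c s_0 - c^2 s_1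
    among constants c.\<close>
  have "0 < s 0 * s 0 / s 1" using s1 mass_pos by simp
  also have "\<dots> = 2 * L [:s 0 / s 1:] - L ([:0, 1:] * [:s 0 / s 1:] * [:s 0 / s 1:])"
    using s1 by (simp add: moment_functional_def field_simps)
  also have "\<dots> \<le> gauss_value n" using n by (intro gauss_variational) simp
  finally show ?thesis .
qed

definition ratio :: "nat \<Rightarrow> real" where
  "ratio n = pfun s n 0 / qfun s n 0"

lemma ratio_eq: "n > 0 \<Longrightarrow> ratio n = - 1 / gauss_value n"
  by (simp add: ratio_def gauss_value_def)

lemma qfun_0_nonzero: "n > 0 \<Longrightarrow> qfun s n (0::real) \<noteq> 0"
  using gauss_value_pos[of n] by (auto simp: gauss_value_def)

lemma ratio_tendsto: "ratio \<longlonglongrightarrow> alpha_lim s"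
  and ratio_le_alpha: "n > 0 \<Longrightarrow> ratio n \<le> alpha_lim s"
  and alpha_lim_nonpos: "alpha_lim s \<le> 0"
proof -
  \<comment> \<open>The index starts at 1 because q_0 = 0, so that \<open>ratio 0\<close> is 0 by
    division by zero.\<close>
  have inc: "incseq (\<lambda>n. ratio (Suc n))"
  proof (rule incseq_SucI)
    fix n
    show "ratio (Suc n) \<le> ratio (Suc (Suc n))"
      using gauss_value_mono[of "Suc n"] gauss_value_pos[of "Suc n"] gauss_value_pos[of "Suc (Suc n)"]
      by (simp add: ratio_eq field_simps)
  qed
  have neg: "ratio (Suc n) \<le> 0" for n using gauss_value_pos[of "Suc n"] by (simp add: ratio_eq)
  obtain l where l: "(\<lambda>n. ratio (Suc n)) \<longlonglongrightarrow> l" "\<And>n. ratio (Suc n) \<le> l"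
    using incseq_convergent[OF inc, of 0] neg by blast
  have "ratio \<longlonglongrightarrow> l" using l(1) by (simp add: filterlim_sequentially_Suc)
  moreover have "alpha_lim s = lim ratio" by (simp add: alpha_lim_def ratio_def[abs_def])
  ultimately have l_eq: "alpha_lim s = l" by (simp add: limI)
  show "ratio \<longlonglongrightarrow> alpha_lim s" using \<open>ratio \<longlonglongrightarrow> l\<close> l_eq by simp
  show "n > 0 \<Longrightarrow> ratio n \<le> alpha_lim s" using l(2)[of "n - 1"] l_eq by simp
  show "alpha_lim s \<le> 0" using LIMSEQ_le_const2[OF l(1), of 0] neg l_eq by auto
qed

text \<open>All Gauss values stay below F = -1 / \<open>alpha_lim s\<close>, so the variational
  bound loses its restriction on the degree.\<close>

lemma variational_le_Friedrichs:
  assumes "Friedrichs s = ereal F"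
  shows "2 * L \<pi> - L ([:0, 1:] * \<pi> * \<pi>) \<le> F"
proof -
  have \<alpha>: "alpha_lim s < 0" and F: "F = - 1 / alpha_lim s"
    using assms by (auto simp: Friedrichs_def split: if_splits)
  let ?n = "Suc (degree \<pi>)"
  have "2 * L \<pi> - L ([:0, 1:] * \<pi> * \<pi>) \<le> gauss_value ?n" by (rule gauss_variational) simp
  also have "\<dots> \<le> F"
    using ratio_le_alpha[of ?n] gauss_value_pos[of ?n] \<alpha> by (simp add: F ratio_eq field_simps)
  finally show ?thesis .
qed

section \<open>The Friedrichs and Krein solutions as limits of quadratures\<close>

text \<open>With \<tau> = 1 this \<epsilon> annihilates the coefficient of p_(n+2) in
  \<open>kpoly\<close>, so \<open>qpoly\<close> drops to degree n + 2 and becomes a multiple of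
  p_(n+2): the nodes are Gauss nodes. Normalising \<tau> rather than \<epsilon> keeps the limit pair
  meaningful when \<open>alpha_lim s\<close> is 0 and F infinite.\<close>

definition gauss_param :: "nat \<Rightarrow> real" where
  "gauss_param n = - ratio (n + 2)"

text \<open>The Gauss nodes are positive, so the limit lives on the half-line. The interpolant \<pi>
  of 1 / (x + a) at the nodes satisfies the normal equation by orthogonality, and
  \<open>L \<pi>\<close> is the Gauss sum of 1 / (x + a), which comes close to the integral.\<close>

lemma friedrichs_solution:
  "\<exists>\<phi> f. \<phi> \<in> V s \<and> (AE x in \<phi>. x \<ge> 0) \<and> mu_F s = \<phi> \<and>
    extremal_at \<phi> 0 (par_eps (Friedrichs s)) (par_tau (Friedrichs s)) f \<and>
    (\<forall>a>0. \<forall>e>0. \<exists>\<pi>. L ([:a, 1:] * \<pi> * \<pi>) = L \<pi> \<and> \<bar>(LINT x|\<phi>. 1 / (x + a)) - L \<pi>\<bar> < e)"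
proof -
  let ?tau = "\<lambda>_::nat. 1::real"
  define \<alpha> where "\<alpha> = alpha_lim s"
  define Q where "Q n = qpoly 0 (gauss_param n) (?tau n) (n + 2)" for n
  have lim: "gauss_param \<longlonglongrightarrow> - \<alpha>"
    unfolding gauss_param_def[abs_def] \<alpha>_def by (intro tendsto_intros LIMSEQ_ignore_initial_segment ratio_tendsto)
  obtain \<phi> m r where \<phi>: "\<phi> \<in> V s" and ext: "extremal_at \<phi> 0 (- \<alpha>) 1 (kfun 0 (- \<alpha>) 1)"
    and r: "strict_mono (r :: nat \<Rightarrow> nat)" and m: "\<forall>n. \<forall>y\<in>{y. poly (Q n) y = 0}. m n y > (0::real)"
    and exact: "\<forall>n p. degree p \<le> n + 2 \<longrightarrow> (\<Sum>y | poly (Q n) y = 0. m n y * poly p y) = L p"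
    and qc: "quadrature_converges ((\<lambda>n. {y. poly (Q n) y = 0}) \<circ> r) (m \<circ> r) \<phi>"
    using extremal_exists[OF lim tendsto_const[of 1], of 0] unfolding Q_def by auto
  note hm = V_has_moments[OF \<phi>]
  have Q0: "Q n \<noteq> 0" for n unfolding Q_def by (rule qpoly_nonzero) simp
  have orth: "L (Q n * p) = 0" if "degree p < n + 2" for n p unfolding Q_def by (rule qpoly_orth[OF that])
  have degQ: "degree (Q n) \<le> n + 2" for n
  proof -
    have "kcoeff 0 (gauss_param n) 1 (n + 2) = 0"
      using qfun_0_nonzero[of "n + 2"] by (simp add: kcoeff_def gauss_param_def ratio_def)
    hence "kpoly 0 (gauss_param n) 1 (Suc (n + 2)) = kpoly 0 (gauss_param n) 1 (Suc (n + 1))"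
      by (simp add: kpoly_def)
    hence "degree (kpoly 0 (gauss_param n) 1 (Suc (n + 2))) \<le> n + 1" using degree_kpoly[of 0 "gauss_param n" 1 "n + 1"] by simp
    hence "degree ([:-0, 1:] * kpoly 0 (gauss_param n) 1 (Suc (n + 2))) \<le> n + 2"
      using degree_mult_le[of "[:-0, 1:]" "kpoly 0 (gauss_param n) 1 (Suc (n + 2))"] by (simp del: mult_pCons_left)
    thus ?thesis unfolding Q_def qpoly_def by (intro degree_diff_le) auto
  qed
  have pos: "y > 0" if "poly (Q n) y = 0" for n y
    by (rule quasi_orthogonal_root_pos[OF Q0 degQ orth that])
  have nonneg: "AE x in \<phi>. x \<ge> 0"
    by (rule quadrature_converges_AE_nonneg[OF hm qc]) (use pos less_imp_le in auto)
  have approx: "\<exists>\<pi>. L ([:a, 1:] * \<pi> * \<pi>) = L \<pi> \<and> \<bar>(LINT x|\<phi>. 1 / (x + a)) - L \<pi>\<bar> < e" if a: "a > 0" and e: "e > 0" for a e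
  proof -
    \<comment> \<open>A bounded continuous function that agrees with 1 / (x + a) on the half-line;
      weak convergence cannot be applied across the pole at -a.\<close>
    define h where "h x = 1 / (max 0 x + a)" for x :: real
    have cont: "continuous_on UNIV h" unfolding h_def using a by (intro continuous_intros) (auto simp: max_def)
    have bd: "\<bar>h x\<bar> \<le> 1 / a" for x unfolding h_def using a by (auto simp: max_def frac_le)
    have "(LINT x|\<phi>. h x) = (LINT x|\<phi>. 1 / (x + a))"
    proof (intro integral_cong_AE)
      show "h \<in> borel_measurable \<phi>" by (rule borel_measurable_has_moments[OF hm borel_measurable_continuous_onI[OF cont]])
      show "(\<lambda>x. 1 / (x + a)) \<in> borel_measurable \<phi>" by (rule borel_measurable_has_moments[OF hm]) measurable
      show "AE x in \<phi>. h x = 1 / (x + a)" using nonneg by eventually_elim (simp add: h_def)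
    qed
    hence "(\<lambda>n. \<Sum>y | poly (Q (r n)) y = 0. m (r n) y * h y) \<longlonglongrightarrow> (LINT x|\<phi>. 1 / (x + a))"
      using quadrature_convergesD[OF qc cont bd] by simp
    from tendstoD[OF this e] obtain n where
      n: "\<bar>(\<Sum>y | poly (Q (r n)) y = 0. m (r n) y * h y) - (LINT x|\<phi>. 1 / (x + a))\<bar> < e"
      by (auto simp: eventually_sequentially dist_real_def)
    define q where "q = Q (r n)"
    define c where "c = poly q (- a)"
    have c: "c \<noteq> 0" using pos[of "r n" "- a"] a by (auto simp: c_def q_def)
    define \<pi> where "\<pi> = interp q (- a)"
    have p1: "[:a, 1:] * \<pi> = 1 - smult (1 / c) q" using interp_mult[of q "- a"] c by (simp add: \<pi>_def c_def)
    have dp: "degree \<pi> < r n + 2" using degQ[of "r n"] degree_interp[of q "- a"] by (simp add: \<pi>_def q_def)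
    have 1: "L ([:a, 1:] * \<pi> * \<pi>) = L \<pi>"
      using interp_orth[of q "- a" s 1 \<pi>, folded \<pi>_def] orth[OF dp, folded q_def] c by (simp add: c_def)
    have "L \<pi> = (\<Sum>y | poly (Q (r n)) y = 0. m (r n) y * poly \<pi> y)" using exact dp by simp
    also have "\<dots> = (\<Sum>y | poly (Q (r n)) y = 0. m (r n) y * h y)"
    proof (intro sum.cong refl arg_cong2[where f = "(*)"])
      fix y assume "y \<in> {y. poly (Q (r n)) y = 0}"
      hence y: "poly q y = 0" "y > 0" using pos by (auto simp: q_def)
      have "poly ([:a, 1:] * \<pi>) y = 1" unfolding p1 using y by simp
      hence "(y + a) * poly \<pi> y = 1" by (simp add: algebra_simps)
      thus "poly \<pi> y = h y" using y a by (simp add: h_def field_simps)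
    qed
    finally have "\<bar>(LINT x|\<phi>. 1 / (x + a)) - L \<pi>\<bar> < e" using n by (subst abs_minus_commute) simp
    thus ?thesis using 1 by blast
  qed
  have ext': "\<exists>f. extremal_at \<phi> 0 (par_eps (Friedrichs s)) (par_tau (Friedrichs s)) f"
  proof (cases "\<alpha> < 0")
    case True
    have "Friedrichs s = ereal (- 1 / \<alpha>)" using True by (simp add: Friedrichs_def \<alpha>_def)
    moreover have "extremal_at \<phi> 0 1 (- 1 / \<alpha>) (\<lambda>x. - 1 / \<alpha> * kfun 0 (- \<alpha>) 1 x)"
      using extremal_at_scale[OF ext, of "- 1 / \<alpha>"] True by simp
    ultimately show ?thesis by (auto simp: par_eps_def par_tau_def)
  next
    case False
    hence "\<alpha> = 0" using alpha_lim_nonpos by (simp add: \<alpha>_def)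
    moreover from this have "Friedrichs s = \<infinity>" by (simp add: Friedrichs_def \<alpha>_def)
    ultimately show ?thesis using ext by (auto simp: par_eps_def par_tau_def)
  qed
  then obtain f where f: "extremal_at \<phi> 0 (par_eps (Friedrichs s)) (par_tau (Friedrichs s)) f" by blast
  have "mu_F s = \<phi>" unfolding mu_F_def by (rule mu_ext_eqI[OF \<phi> f])
  thus ?thesis using \<phi> nonneg f approx by blast
qed

text \<open>For \<epsilon> = 0 and b = 0 the node polynomial is x P, a Gauss-Radau formula with
  fixed node 0. Its factor P is orthogonal to lower degrees with respect to x d\<mu>, so the
  Friedrichs argument applies with u = x; at the node 0 both sides carry the factor x and agree
  trivially.\<close>

lemma krein_solution:
  "\<exists>\<mu>. \<mu> \<in> V s \<and> (AE x in \<mu>. x \<ge> 0) \<and> mu_K s = \<mu> \<and>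
    (\<forall>e>0. \<exists>\<pi>. L ([:0, 1:] * [:1, 1:] * \<pi> * \<pi>) = L ([:0, 1:] * \<pi>) \<and> \<bar>(LINT x|\<mu>. x / (x + 1)) - L ([:0, 1:] * \<pi>)\<bar> < e)"
proof -
  let ?x = "[:0, 1:] :: real poly"
  define P where "P n = kpoly 0 0 1 (Suc (n + 2))" for n :: nat
  define Q where "Q n = qpoly 0 0 1 (n + 2)" for n :: nat
  have QP: "Q n = ?x * P n" for n by (simp add: Q_def qpoly_def P_def)
  obtain \<mu> m r where \<mu>: "\<mu> \<in> V s" and ext: "extremal_at \<mu> 0 0 1 (kfun 0 0 1)"
    and r: "strict_mono (r :: nat \<Rightarrow> nat)" and m: "\<forall>n. \<forall>y\<in>{y. poly (Q n) y = 0}. m n y > (0::real)"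
    and exact: "\<forall>n p. degree p \<le> n + 2 \<longrightarrow> (\<Sum>y | poly (Q n) y = 0. m n y * poly p y) = L p"
    and qc: "quadrature_converges ((\<lambda>n. {y. poly (Q n) y = 0}) \<circ> r) (m \<circ> r) \<mu>"
    using extremal_exists[OF tendsto_const[of 0] tendsto_const[of 1], of 0] unfolding Q_def by auto
  note hm = V_has_moments[OF \<mu>]
  have P0: "P n \<noteq> 0" for n unfolding P_def by (rule kpoly_nonzero) simp
  have orth: "L (Q n * p) = 0" if "degree p < n + 2" for n p unfolding Q_def by (rule qpoly_orth[OF that])
  have degP: "degree (P n) \<le> n + 2" for n unfolding P_def by (rule degree_kpoly)
  have nnP: "y \<ge> 0" if root: "poly (P n) y = 0" for n y
  proof (rule ccontr)
    assume "\<not> y \<ge> 0"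
    hence y: "y < 0" by simp
    obtain g where g: "P n = [:-y, 1:] * g" using root unfolding poly_eq_0_iff_dvd by (elim dvdE)
    have g0: "g \<noteq> 0" using P0 g by auto
    have "degree (P n) = Suc (degree g)" unfolding g using g0 by (subst degree_mult_eq) auto
    hence "L (Q n * g) = 0" using degP[of n] by (intro orth) simp
    moreover have "L (Q n * g) > 0"
    proof (rule L_pos)
      show "Q n * g \<noteq> 0" using P0[of n] g0 by (simp add: QP del: mult_pCons_left)
      show "poly (Q n * g) x \<ge> 0" if "x \<ge> 0" for x
      proof -
        have "poly (Q n * g) x = x * (x - y) * (poly g x * poly g x)" by (simp add: QP g algebra_simps)
        also have "\<dots> \<ge> 0" using that y by simp
        finally show ?thesis .
      qed
    qed
    ultimately show False by simp
  qed
  have nn: "y \<ge> 0" if "poly (Q n) y = 0" for n y using that nnP[of n y] by (auto simp: QP)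
  have nonneg: "AE x in \<mu>. x \<ge> 0"
    by (rule quadrature_converges_AE_nonneg[OF hm qc]) (use nn in auto)
  have approx: "\<exists>\<pi>. L (?x * [:1, 1:] * \<pi> * \<pi>) = L (?x * \<pi>) \<and> \<bar>(LINT x|\<mu>. x / (x + 1)) - L (?x * \<pi>)\<bar> < e" if e: "e > 0" for e
  proof -
    define h where "h x = max 0 x / (max 0 x + 1)" for x :: real
    have cont: "continuous_on UNIV h" unfolding h_def by (intro continuous_intros) (auto simp: max_def)
    have bd: "\<bar>h x\<bar> \<le> 1" for x unfolding h_def by (auto simp: max_def)
    have "(LINT x|\<mu>. h x) = (LINT x|\<mu>. x / (x + 1))"
    proof (intro integral_cong_AE)
      show "h \<in> borel_measurable \<mu>" by (rule borel_measurable_has_moments[OF hm borel_measurable_continuous_onI[OF cont]])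
      show "(\<lambda>x. x / (x + 1)) \<in> borel_measurable \<mu>" by (rule borel_measurable_has_moments[OF hm]) measurable
      show "AE x in \<mu>. h x = x / (x + 1)" using nonneg by eventually_elim (simp add: h_def)
    qed
    hence "(\<lambda>n. \<Sum>y | poly (Q (r n)) y = 0. m (r n) y * h y) \<longlonglongrightarrow> (LINT x|\<mu>. x / (x + 1))"
      using quadrature_convergesD[OF qc cont bd] by simp
    from tendstoD[OF this e] obtain n where
      n: "\<bar>(\<Sum>y | poly (Q (r n)) y = 0. m (r n) y * h y) - (LINT x|\<mu>. x / (x + 1))\<bar> < e"
      by (auto simp: eventually_sequentially dist_real_def)
    define q where "q = P (r n)"
    define c where "c = poly q (- 1)"
    have c: "c \<noteq> 0" using nnP[of "r n" "- 1"] by (auto simp: c_def q_def)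
    define \<pi> where "\<pi> = interp q (- 1)"
    have p1: "[:1, 1:] * \<pi> = 1 - smult (1 / c) q" using interp_mult[of q "- 1"] c by (simp add: \<pi>_def c_def)
    have dp: "degree \<pi> < r n + 2" using degP[of "r n"] degree_interp[of q "- 1"] by (simp add: \<pi>_def q_def)
    have 1: "L (?x * [:1, 1:] * \<pi> * \<pi>) = L (?x * \<pi>)"
      using interp_orth[of q "- 1" s ?x \<pi>, folded \<pi>_def] orth[OF dp, unfolded QP, folded q_def] c by (simp add: c_def)
    have "degree (?x * \<pi>) \<le> r n + 2" using degree_mult_le[of ?x \<pi>] dp by simp
    hence "L (?x * \<pi>) = (\<Sum>y | poly (Q (r n)) y = 0. m (r n) y * poly (?x * \<pi>) y)" by (rule exact[rule_format, symmetric])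
    also have "\<dots> = (\<Sum>y | poly (Q (r n)) y = 0. m (r n) y * h y)"
    proof (intro sum.cong refl arg_cong2[where f = "(*)"])
      fix y assume "y \<in> {y. poly (Q (r n)) y = 0}"
      hence y: "poly (Q (r n)) y = 0" "y \<ge> 0" using nn by auto
      show "poly (?x * \<pi>) y = h y"
      proof (cases "y = 0")
        case False
        hence "poly q y = 0" using y by (simp add: QP q_def)
        hence "poly ([:1, 1:] * \<pi>) y = 1" unfolding p1 by simp
        hence "(y + 1) * poly \<pi> y = 1" by (simp add: algebra_simps)
        thus ?thesis using y by (simp add: h_def field_simps)
      qed (simp add: h_def)
    qed
    finally have "\<bar>(LINT x|\<mu>. x / (x + 1)) - L (?x * \<pi>)\<bar> < e" using n by (subst abs_minus_commute) (simp only:)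
    thus ?thesis using 1 by blast
  qed
  have "mu_K s = \<mu>" unfolding mu_K_def
    by (rule mu_ext_eqI[OF \<mu>]) (use ext in \<open>simp add: par_eps_def par_tau_def\<close>)
  thus ?thesis using \<mu> nonneg approx by blast
qed

end

section \<open>Uniqueness of the parameter, negative nodes and supports\<close>

text \<open>A finite parameter forces f = 1/x almost everywhere, hence no mass at 0, and equals the
  integral of 1/x; the parameter \<infinity> forces an atom at 0.\<close>

lemma (in indeterminate_sequence) parameter_unique:
  assumes hm: "has_moments \<mu>" and f: "extremal_at \<mu> 0 (par_eps t) (par_tau t) f"
    and g: "extremal_at \<mu> 0 (par_eps t') (par_tau t') g" and t: "t \<noteq> - \<infinity>" "t' \<noteq> - \<infinity>"
  shows "t = t'"
proof -
  have no: False if f: "extremal_at \<mu> 0 1 \<tau> f" and g: "extremal_at \<mu> 0 0 1 g" for f g \<tau>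
  proof -
    have "AE x in \<mu>. (x - 0) * f x = 1" "AE x in \<mu>. (x - 0) * g x = 0"
      using f g by (auto simp: extremal_at_def)
    hence "AE x in \<mu>. g x = 0" by eventually_elim auto
    hence "(LINT x|\<mu>. g x) = 0" by (rule integral_eq_zero_AE)
    thus False using g by (simp add: extremal_at_def)
  qed
  show ?thesis
  proof (cases t; cases t')
    fix u v assume uv: "t = ereal u" "t' = ereal v"
    have ae: "AE x in \<mu>. (x - 0) * f x = 1" "AE x in \<mu>. (x - 0) * g x = 1"
      using f g by (auto simp: uv extremal_at_def par_eps_def)
    have "(LINT x|\<mu>. f x) = (LINT x|\<mu>. g x)"
    proof (rule integral_cong_AE)
      show "f \<in> borel_measurable \<mu>" "g \<in> borel_measurable \<mu>"
        using f g by (auto simp: extremal_at_def poly_approximable_def sq_integrable_def)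
      show "AE x in \<mu>. f x = g x" using ae
      proof eventually_elim
        case (elim x)
        hence "x \<noteq> 0" by auto
        thus ?case using elim by (metis diff_zero mult_left_cancel)
      qed
    qed
    thus ?thesis using f g by (simp add: uv extremal_at_def par_tau_def)
  next
    fix u assume "t = ereal u" "t' = \<infinity>"
    thus ?thesis using no f g by (auto simp: par_eps_def par_tau_def)
  next
    fix u assume "t = \<infinity>" "t' = ereal u"
    thus ?thesis using no f g by (auto simp: par_eps_def par_tau_def)
  qed (use t in auto)
qed

context stieltjes_sequence
begin

text \<open>Dividing out two distinct negative zeros leaves h of degree below n, and (x - y0) (x -
  y1) h^2 is nonnegative on the half-line, against orthogonality.\<close>

lemma negative_root_unique:
  assumes ne: "\<epsilon> \<noteq> 0 \<or> \<tau> \<noteq> 0" and n: "n > 0"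
    and y: "poly (qpoly b \<epsilon> \<tau> n) y0 = 0" "poly (qpoly b \<epsilon> \<tau> n) y1 = 0" "y0 < 0" "y1 < 0"
  shows "y0 = y1"
proof (rule ccontr)
  assume "y0 \<noteq> y1"
  define Q where "Q = qpoly b \<epsilon> \<tau> n"
  have Q0: "Q \<noteq> 0" unfolding Q_def by (rule qpoly_nonzero[OF ne])
  obtain g where g: "Q = [:-y0, 1:] * g" using y(1) unfolding Q_def[symmetric] poly_eq_0_iff_dvd by (elim dvdE)
  have "(y1 - y0) * poly g y1 = 0" using y(2) unfolding Q_def[symmetric] g by (simp add: algebra_simps)
  hence "poly g y1 = 0" using \<open>y0 \<noteq> y1\<close> by simp
  then obtain h where h: "g = [:-y1, 1:] * h" unfolding poly_eq_0_iff_dvd by (elim dvdE)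
  have h0: "h \<noteq> 0" using Q0 g h by auto
  have "g \<noteq> 0" using Q0 g by auto
  have "degree g = Suc (degree h)" unfolding h using h0 by (subst degree_mult_eq) auto
  moreover have "degree Q = Suc (degree g)" unfolding g using \<open>g \<noteq> 0\<close> by (subst degree_mult_eq) auto
  moreover have "degree Q \<le> Suc n" unfolding Q_def by (rule degree_qpoly)
  ultimately have "degree h < n" by simp
  hence "L (Q * h) = 0" unfolding Q_def by (rule qpoly_orth)
  moreover have "L (Q * h) > 0"
  proof (rule L_pos)
    show "Q * h \<noteq> 0" using Q0 h0 by simp
    show "poly (Q * h) x \<ge> 0" if "x \<ge> 0" for x
    proof -
      have "poly (Q * h) x = (x - y0) * (x - y1) * (poly h x * poly h x)" by (simp add: g h algebra_simps)
      also have "\<dots> \<ge> 0" using that y by simp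
      finally show ?thesis .
    qed
  qed
  ultimately show False by simp
qed

text \<open>A negative zero y makes h = y Q / (x - y) a polynomial with h(0) = 1, so h = 1 - x
  \<pi>. Orthogonality of Q to \<pi> evaluates the variational expression at \<pi> as t - L(h^2) /
  y. As y < 0 this exceeds t, hence F, which \<open>variational_le_Friedrichs\<close>
  forbids.\<close>

lemma no_negative_root:
  assumes F: "Friedrichs s = ereal F" and t: "F < t" and n: "n > 0"
    and y: "poly (qpoly 0 1 t n) y = 0"
  shows "y \<ge> 0"
proof (rule ccontr)
  assume "\<not> y \<ge> 0"
  hence y0: "y < 0" by simp
  let ?x = "[:0, 1:] :: real poly"
  define Q where "Q = qpoly 0 1 t n"
  define P where "P = kpoly 0 1 t (Suc n)"
  have Q0: "Q \<noteq> 0" unfolding Q_def by (rule qpoly_nonzero) simp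
  obtain g where g: "Q = [:-y, 1:] * g" using y unfolding Q_def[symmetric] poly_eq_0_iff_dvd by (elim dvdE)
  have g0: "g \<noteq> 0" using Q0 g by auto
  have "degree Q = Suc (degree g)" unfolding g using g0 by (subst degree_mult_eq) auto
  moreover have "degree Q \<le> Suc n" unfolding Q_def by (rule degree_qpoly)
  ultimately have dg: "degree g \<le> n" by simp
  define h where "h = smult y g"
  define \<pi> where "\<pi> = - synthetic_div h 0"
  have "poly Q 0 = - 1" by (simp add: Q_def poly_qpoly)
  hence "y * poly g 0 = 1" by (simp add: g)
  hence h1: "poly h 0 = 1" by (simp add: h_def)
  have x\<pi>: "poly h x = 1 - x * poly \<pi> x" for x
    using poly_eq_synthetic_div[of h x 0] h1 by (simp add: \<pi>_def)
  have Qx: "y * poly Q x = (x - y) * poly h x" for x by (simp add: g h_def algebra_simps)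
  have P: "P = \<pi> + smult (1 / y) h"
  proof -
    have "?x * P = ?x * (\<pi> + smult (1 / y) h)"
    proof (rule poly_ext)
      fix x
      have "x * poly P x = poly Q x + 1" by (simp add: Q_def P_def poly_qpoly)
      also have "poly Q x = (x - y) * poly h x / y" using Qx[of x] y0 by (simp add: field_simps)
      also have "\<dots> + 1 = x * poly h x / y + (1 - poly h x)" using y0 by (simp add: field_simps)
      also have "1 - poly h x = x * poly \<pi> x" using x\<pi>[of x] by simp
      also have "x * poly h x / y + x * poly \<pi> x = x * (poly \<pi> x + 1 / y * poly h x)" by (simp add: algebra_simps)
      finally show "poly (?x * P) x = poly (?x * (\<pi> + smult (1 / y) h)) x" by simp
    qed
    thus ?thesis by (simp only: mult_cancel_left) simp
  qed
  have t_eq: "t = L \<pi> + L h / y"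
    using L_kpoly[of 0 1 t n] unfolding P_def[symmetric] P by (simp add: moment_functional_linear)
  have "L (Q * \<pi>) = 0"
    unfolding Q_def by (rule qpoly_orth) (use dg n in \<open>auto simp: \<pi>_def degree_synthetic_div h_def le_less_trans[OF degree_smult_le]\<close>)
  moreover have "smult y (Q * \<pi>) = h - h * h - smult y (h * \<pi>)"
  proof (rule poly_ext)
    fix x
    have "poly (smult y (Q * \<pi>)) x = (x - y) * poly h x * poly \<pi> x" using Qx[of x] by simp
    also have "\<dots> = poly h x * (x * poly \<pi> x) - y * (poly h x * poly \<pi> x)" by (simp add: algebra_simps)
    also have "x * poly \<pi> x = 1 - poly h x" using x\<pi>[of x] by simp
    finally show "poly (smult y (Q * \<pi>)) x = poly (h - h * h - smult y (h * \<pi>)) x" by (simp add: algebra_simps)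
  qed
  hence "y * L (Q * \<pi>) = L h - L (h * h) - y * L (h * \<pi>)" by (metis moment_functional_diff moment_functional_smult)
  ultimately have hp: "L (h * \<pi>) = (L h - L (h * h)) / y" using y0 by (simp add: field_simps)
  have "?x * \<pi> * \<pi> = \<pi> - h * \<pi>"
  proof (rule poly_ext)
    fix x
    have "poly (?x * \<pi> * \<pi>) x = (x * poly \<pi> x) * poly \<pi> x" by simp
    also have "x * poly \<pi> x = 1 - poly h x" using x\<pi>[of x] by simp
    finally show "poly (?x * \<pi> * \<pi>) x = poly (\<pi> - h * \<pi>) x" by (simp add: algebra_simps)
  qed
  hence "2 * L \<pi> - L (?x * \<pi> * \<pi>) = L \<pi> + L (h * \<pi>)" by (simp only: moment_functional_diff)
  also have "\<dots> = t - L (h * h) / y" by (simp add: hp t_eq diff_divide_distrib)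
  finally have "t - L (h * h) / y \<le> F" using variational_le_Friedrichs[OF F, of \<pi>] by simp
  moreover have "L (h * h) / y < 0"
    using y0 g0 L_square_pos[of h] by (simp add: divide_pos_neg h_def)
  ultimately show False using t by simp
qed

text \<open>Each quadrature has at most one negative node, so two negative points of the support
  would need two bumps that no formula charges simultaneously. The support is therefore bounded
  below, which is what allows a point -a to its left.\<close>

lemma mu_ext_structure:
  assumes t: "t \<noteq> - \<infinity>"
  shows "\<exists>\<mu>. \<mu> \<in> V s \<and> mu_ext s t = \<mu> \<and>
    extremal_at \<mu> 0 (par_eps t) (par_tau t) (kfun 0 (par_eps t) (par_tau t)) \<and> (\<exists>c. AE x in \<mu>. x \<ge> c) \<and>
    (Friedrichs s < t \<and> t < \<infinity> \<longrightarrow> (AE x in \<mu>. x \<ge> 0))"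
proof -
  define \<epsilon> where "\<epsilon> = par_eps t"
  define \<tau> where "\<tau> = par_tau t"
  have ne: "\<epsilon> \<noteq> 0 \<or> \<tau> \<noteq> 0" by (auto simp: \<epsilon>_def \<tau>_def par_eps_def par_tau_def)
  define Q where "Q n = qpoly 0 \<epsilon> \<tau> (n + 2)" for n :: nat
  define Z where "Z n = {y. poly (Q n) y = 0}" for n
  obtain \<mu> m r where \<mu>: "\<mu> \<in> V s" and ext: "extremal_at \<mu> 0 \<epsilon> \<tau> (kfun 0 \<epsilon> \<tau>)"
    and r: "strict_mono (r :: nat \<Rightarrow> nat)" and m: "\<forall>n. \<forall>y\<in>Z n. m n y > (0::real)"
    and qc: "quadrature_converges (Z \<circ> r) (m \<circ> r) \<mu>"
    using extremal_exists[OF tendsto_const[of \<epsilon>] tendsto_const[of \<tau>] ne ne, of 0]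
    unfolding Q_def[symmetric] Z_def[symmetric] by blast
  note hm = V_has_moments[OF \<mu>]
  note fin\<mu> = has_momentsD(3)[OF hm] and sets\<mu> = has_momentsD(1)[OF hm]
  have two: "y0 = y1" if "y0 \<in> Z n" "y1 \<in> Z n" "y0 < 0" "y1 < 0" for y0 y1 n
    using negative_root_unique[OF ne, of "n + 2" 0 y0 y1] that by (simp add: Z_def Q_def)
  have supp: False if y: "y0 \<in> msupport \<mu>" "y1 \<in> msupport \<mu>" "y0 < y1" "y1 < 0" for y0 y1
  proof -
    \<comment> \<open>Half the distance keeps the two bumps disjoint, and -y1 keeps them on the
      negative axis.\<close>
    define \<delta> where "\<delta> = min ((y1 - y0) / 2) (- y1)"
    have \<delta>: "\<delta> > 0" using y by (simp add: \<delta>_def)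
    define h where "h c x = max 0 (\<delta> - \<bar>x - c\<bar>)" for c x :: real
    have cont: "continuous_on UNIV (h c)" for c unfolding h_def by (intro continuous_intros)
    have bd: "\<bar>h c x\<bar> \<le> \<delta>" for c x using \<delta> by (auto simp: h_def)
    have pos: "(LINT x|\<mu>. h c x) > 0" if c: "c \<in> msupport \<mu>" for c
    proof -
      have i: "integrable \<mu> (h c)" by (rule integrable_bounded_continuous[OF fin\<mu> sets\<mu> cont bd])
      have nn: "AE x in \<mu>. h c x \<ge> 0" by (simp add: h_def)
      have "(LINT x|\<mu>. h c x) \<noteq> 0"
      proof
        assume "(LINT x|\<mu>. h c x) = 0"
        hence "AE x in \<mu>. h c x = 0" by (subst (asm) integral_nonneg_eq_0_iff_AE[OF i nn])
        hence "AE x in \<mu>. x \<in> - ball c \<delta>"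
          by eventually_elim (auto simp: h_def dist_real_def abs_minus_commute max_def split: if_splits)
        hence "msupport \<mu> \<subseteq> - ball c \<delta>" by (intro msupport_subset_closed[OF sets\<mu>]) auto
        thus False using c \<delta> by auto
      qed
      moreover have "(LINT x|\<mu>. h c x) \<ge> 0" by (rule integral_nonneg_AE[OF nn])
      ultimately show ?thesis by simp
    qed
    define E where "E c n = (\<Sum>y\<in>(Z \<circ> r) n. (m \<circ> r) n y * h c y)" for c n
    have E: "E c \<longlonglongrightarrow> (LINT x|\<mu>. h c x)" for c
      unfolding E_def by (rule quadrature_convergesD[OF qc cont bd])
    have Enz: "\<exists>u\<in>Z (r n). h c u \<noteq> 0" if "E c n \<noteq> 0" for c n
    proof (rule ccontr)
      assume "\<not> (\<exists>u\<in>Z (r n). h c u \<noteq> 0)"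
      hence "E c n = 0" unfolding E_def by (intro sum.neutral) auto
      thus False using that by simp
    qed
    have Ez: "E y0 n * E y1 n = 0" for n
    proof (rule ccontr)
      assume nz: "E y0 n * E y1 n \<noteq> 0"
      hence "E y0 n \<noteq> 0" "E y1 n \<noteq> 0" by auto
      then obtain u v where u: "u \<in> Z (r n)" "h y0 u \<noteq> 0" and v: "v \<in> Z (r n)" "h y1 v \<noteq> 0"
        using Enz by blast
      have u': "\<bar>u - y0\<bar> < \<delta>" and v': "\<bar>v - y1\<bar> < \<delta>" using u v by (auto simp: h_def max_def split: if_splits)
      have d: "\<delta> \<le> (y1 - y0) / 2" "\<delta> \<le> - y1"
        unfolding \<delta>_def by (rule min.cobounded1, rule min.cobounded2)
      have "u < y0 + \<delta>" "y1 - \<delta> < v" "v < y1 + \<delta>" using u' v' by (auto simp: abs_less_iff)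
      moreover have "2 * \<delta> \<le> y1 - y0" using d(1) by simp
      ultimately have "u < v" "v < 0" using d(2) by auto
      thus False using two[OF u(1) v(1)] by simp
    qed
    have "(\<lambda>n. 0) \<longlonglongrightarrow> (LINT x|\<mu>. h y0 x) * (LINT x|\<mu>. h y1 x)"
      using tendsto_mult[OF E[of y0] E[of y1]] unfolding Ez .
    hence "(LINT x|\<mu>. h y0 x) * (LINT x|\<mu>. h y1 x) = 0" by (simp add: LIMSEQ_const_iff)
    thus False using pos[OF y(1)] pos[OF y(2)] by simp
  qed
  have "\<exists>c. msupport \<mu> \<subseteq> {c..}"
  proof (cases "\<exists>y\<in>msupport \<mu>. y < 0")
    case True
    then obtain y where y: "y \<in> msupport \<mu>" "y < 0" by blast
    have "y \<le> x" if "x \<in> msupport \<mu>" for x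
      using supp[OF that y(1)] y(2) by (meson not_le)
    thus ?thesis by (intro exI[of _ y]) auto
  next
    case False
    thus ?thesis by (intro exI[of _ 0]) (auto simp: not_less)
  qed
  hence low: "\<exists>c. AE x in \<mu>. x \<ge> c"
    using AE_msupport_iff_closed[OF sets\<mu>, of "{_..}"] by auto
  have nonneg: "AE x in \<mu>. x \<ge> 0" if tF: "Friedrichs s < t" "t < \<infinity>"
  proof -
    obtain t' where t': "t = ereal t'" using tF t by (cases t) auto
    have "Friedrichs s \<noteq> - \<infinity>" by (simp add: Friedrichs_def)
    then obtain F where F: "Friedrichs s = ereal F" using tF by (cases "Friedrichs s") auto
    have "F < t'" using tF by (simp add: F t')
    have "\<epsilon> = 1" "\<tau> = t'" by (simp_all add: \<epsilon>_def \<tau>_def t' par_eps_def par_tau_def)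
    hence "y \<ge> 0" if "y \<in> Z n" for n y
      using no_negative_root[OF F \<open>F < t'\<close>, of "n + 2" y] that by (simp add: Z_def Q_def)
    thus ?thesis by (intro quadrature_converges_AE_nonneg[OF hm qc]) auto
  qed
  have "mu_ext s t = \<mu>" by (rule mu_ext_eqI[OF \<mu>]) (use ext in \<open>simp add: \<epsilon>_def \<tau>_def\<close>)
  thus ?thesis using \<mu> ext low nonneg by (auto simp: \<epsilon>_def \<tau>_def)
qed

lemma mu_F_V: "mu_F s \<in> V s" and mu_F_nonneg: "AE x in mu_F s. x \<ge> 0"
  and mu_F_extremal: "\<exists>f. extremal_at (mu_F s) 0 (par_eps (Friedrichs s)) (par_tau (Friedrichs s)) f"
  and mu_F_approximants: "a > 0 \<Longrightarrow> e > 0 \<Longrightarrow>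
    \<exists>\<pi>. L ([:a, 1:] * \<pi> * \<pi>) = L \<pi> \<and> \<bar>(LINT x|mu_F s. 1 / (x + a)) - L \<pi>\<bar> < e"
  using friedrichs_solution by auto

lemma mu_K_V: "mu_K s \<in> V s" and mu_K_nonneg: "AE x in mu_K s. x \<ge> 0"
  and mu_K_approximants: "e > 0 \<Longrightarrow> \<exists>\<pi>. L ([:0, 1:] * [:1, 1:] * \<pi> * \<pi>) = L ([:0, 1:] * \<pi>) \<and>
    \<bar>(LINT x|mu_K s. x / (x + 1)) - L ([:0, 1:] * \<pi>)\<bar> < e"
  using krein_solution by auto

lemma Friedrichs_neq_MInf: "Friedrichs s \<noteq> - \<infinity>"
  by (simp add: Friedrichs_def)

section \<open>Minimality of the Friedrichs solution\<close>

text \<open>The approximants of \<open>mu_F\<close> satisfy the normal equation for every solution,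
  so \<open>L \<pi>\<close> is a lower bound for each integral and can be brought arbitrarily close
  to that of \<open>mu_F\<close>. In case of equality the errors tend to 0; as x + a >= \<delta>,
  they do so without the factor x + a, and \<nu> is extremal at -a.\<close>

lemma mu_F_minimal:
  assumes \<nu>: "\<nu> \<in> V s" and a: "a > 0" and \<delta>: "\<delta> > 0" and ae: "AE x in \<nu>. x + a \<ge> \<delta>"
  shows "(LINT x|mu_F s. 1 / (x + a)) \<le> (LINT x|\<nu>. 1 / (x + a))"
    and "(LINT x|mu_F s. 1 / (x + a)) = (LINT x|\<nu>. 1 / (x + a)) \<Longrightarrow>
      extremal_at \<nu> (- a) 1 (LINT x|mu_F s. 1 / (x + a)) (\<lambda>x. 1 / (x + a))"
proof -
  note hm = V_has_moments[OF \<nu>]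
  have [measurable_cong]: "sets \<nu> = sets borel" by (rule has_momentsD(1)[OF hm])
  define G where "G = (LINT x|mu_F s. 1 / (x + a))"
  have ae1: "AE x in \<nu>. x + a \<ge> \<delta> \<and> poly 1 x \<ge> 0" using ae by simp
  have sq: "integrable \<nu> (\<lambda>x. (x + a) * (1 / (x + a) - poly \<pi> x)\<^sup>2)"
    "(LINT x|\<nu>. (x + a) * (1 / (x + a) - poly \<pi> x)\<^sup>2) = (LINT x|\<nu>. 1 / (x + a)) - L \<pi>"
    if "L ([:a, 1:] * \<pi> * \<pi>) = L \<pi>" for \<pi>
    using integral_approximant_square(2,3)[OF \<nu> ae1 \<delta>, of \<pi>] that by simp_all
  have nn: "AE x in \<nu>. (x + a) * (1 / (x + a) - poly \<pi> x)\<^sup>2 \<ge> 0" for \<pi>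
    using ae by eventually_elim (use \<delta> in auto)
  show le: "(LINT x|mu_F s. 1 / (x + a)) \<le> (LINT x|\<nu>. 1 / (x + a))"
  proof (rule field_le_epsilon)
    fix e :: real assume "e > 0"
    then obtain \<pi> where \<pi>: "L ([:a, 1:] * \<pi> * \<pi>) = L \<pi>" "\<bar>G - L \<pi>\<bar> < e"
      using mu_F_approximants[OF a] by (auto simp: G_def)
    have "0 \<le> (LINT x|\<nu>. 1 / (x + a)) - L \<pi>"
      unfolding sq(2)[OF \<pi>(1), symmetric] by (rule integral_nonneg_AE[OF nn])
    thus "(LINT x|mu_F s. 1 / (x + a)) \<le> (LINT x|\<nu>. 1 / (x + a)) + e"
      using \<pi>(2) unfolding G_def abs_less_iff by linarith
  qed
  assume eq: "(LINT x|mu_F s. 1 / (x + a)) = (LINT x|\<nu>. 1 / (x + a))"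
  have "sq_integrable \<nu> (\<lambda>x. 1 / (x + a))"
    unfolding sq_integrable_def
  proof
    show "integrable \<nu> (\<lambda>x. (1 / (x + a))\<^sup>2)"
    proof (rule finite_measure.integrable_const_bound[OF has_momentsD(3)[OF hm], where B = "(1 / \<delta>)\<^sup>2"])
      show "AE x in \<nu>. norm ((1 / (x + a))\<^sup>2) \<le> (1 / \<delta>)\<^sup>2"
        using ae
      proof eventually_elim
        case (elim x)
        have "(1 / (x + a))\<^sup>2 \<le> (1 / \<delta>)\<^sup>2" using elim \<delta> by (intro power_mono frac_le) auto
        thus ?case by simp
      qed
    qed measurable
  qed measurable
  moreover have "\<exists>p. (LINT x|\<nu>. (1 / (x + a) - poly p x)\<^sup>2) < e" if "e > 0" for e
  proof -
    obtain \<pi> where \<pi>: "L ([:a, 1:] * \<pi> * \<pi>) = L \<pi>" "\<bar>G - L \<pi>\<bar> < \<delta> * e"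
      using mu_F_approximants[OF a, of "\<delta> * e"] \<open>e > 0\<close> \<delta> by (auto simp: G_def)
    have "(LINT x|\<nu>. (1 / (x + a) - poly \<pi> x)\<^sup>2) \<le> (LINT x|\<nu>. 1 / \<delta> * ((x + a) * (1 / (x + a) - poly \<pi> x)\<^sup>2))"
    proof (rule integral_mono_AE')
      show "integrable \<nu> (\<lambda>x. 1 / \<delta> * ((x + a) * (1 / (x + a) - poly \<pi> x)\<^sup>2))"
        by (rule integrable_mult_right[OF sq(1)[OF \<pi>(1)]])
      show "AE x in \<nu>. (1 / (x + a) - poly \<pi> x)\<^sup>2 \<le> 1 / \<delta> * ((x + a) * (1 / (x + a) - poly \<pi> x)\<^sup>2)"
        using ae
      proof eventually_elim
        case (elim x)
        have "\<delta> * (1 / (x + a) - poly \<pi> x)\<^sup>2 \<le> (x + a) * (1 / (x + a) - poly \<pi> x)\<^sup>2"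
          using elim by (intro mult_right_mono) auto
        thus ?case using \<delta> by (simp add: pos_le_divide_eq mult.commute)
      qed
      show "AE x in \<nu>. 0 \<le> 1 / \<delta> * ((x + a) * (1 / (x + a) - poly \<pi> x)\<^sup>2)"
        using nn[of \<pi>] by eventually_elim (use \<delta> in simp)
    qed
    also have "\<dots> = 1 / \<delta> * (G - L \<pi>)"
      unfolding integral_mult_right_zero sq(2)[OF \<pi>(1)] using eq by (simp add: G_def)
    also have "\<dots> < 1 / \<delta> * (\<delta> * e)"
      using le_less_trans[OF abs_ge_self \<pi>(2)] \<delta> by (intro mult_strict_left_mono) auto
    also have "\<dots> = e" using \<delta> by simp
    finally show ?thesis by blast
  qed
  ultimately have "poly_approximable \<nu> (\<lambda>x. 1 / (x + a))" by (simp add: poly_approximable_def)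
  moreover have "AE x in \<nu>. (x - (- a)) * (1 / (x + a)) = 1"
    using ae by eventually_elim (use \<delta> in auto)
  ultimately show "extremal_at \<nu> (- a) 1 (LINT x|mu_F s. 1 / (x + a)) (\<lambda>x. 1 / (x + a))"
    using eq by (simp add: extremal_at_def)
qed

text \<open>Both measures are extremal at the same point -a with the same pair (1, \<tau>), so
  \<open>extremal_unique\<close> identifies them.\<close>

lemma mu_F_minimal_unique:
  assumes \<nu>: "\<nu> \<in> V s" and a: "a > 0" and \<delta>: "\<delta> > 0" and ae: "AE x in \<nu>. x + a \<ge> \<delta>"
    and eq: "(LINT x|mu_F s. 1 / (x + a)) = (LINT x|\<nu>. 1 / (x + a))"
  shows "\<nu> = mu_F s"
proof -
  have aeF: "AE x in mu_F s. x + a \<ge> a" using mu_F_nonneg by eventually_elim simp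
  show ?thesis
    by (rule extremal_unique[OF \<nu> mu_F_minimal(2)[OF \<nu> a \<delta> ae eq] mu_F_V mu_F_minimal(2)[OF mu_F_V a a aeF refl]])
qed

lemma weighted_mu_F_determinate:
  assumes "\<alpha> \<ge> 1/2"
  shows "weighted \<alpha> (mu_F s) \<in> M_det"
proof -
  have "density (mu_F s) (\<lambda>x. ennreal (wt \<alpha> x * \<bar>poly 1 x\<bar>)) \<in> M_det"
    by (rule determinate_if_approximants[OF mu_F_V mu_F_nonneg _ _ assms]) (use mu_F_approximants[of 1] in auto)
  thus ?thesis by (simp add: weighted_eq)
qed

text \<open>The Krein approximants show that \<open>mu_K\<close> minimises the integral of x / (x +
  1) on the half-line, hence maximises that of 1 / (x + 1), which \<open>mu_F\<close> minimises. For
  F = \<infinity> the two are the same measure, so every Stieltjes solution attains the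
  minimum.\<close>

lemma Stieltjes_unique_if_Friedrichs_infinite:
  assumes "Friedrichs s = \<infinity>" "\<nu> \<in> V_Stieltjes s"
  shows "\<nu> = mu_F s"
proof -
  have \<nu>: "\<nu> \<in> V s" "AE x in \<nu>. x \<ge> 0" using assms(2) by (auto simp: V_Stieltjes_iff)
  have KF: "mu_K s = mu_F s" by (simp add: mu_K_def mu_F_def assms(1))
  have ae: "AE x in \<nu>. x + 1 \<ge> 1" using \<nu>(2) by eventually_elim simp
  have part: "(LINT x|\<rho>. 1 / (x + 1)) = s 0 - (LINT x|\<rho>. x / (x + 1))" if \<rho>: "\<rho> \<in> V s" "AE x in \<rho>. x \<ge> 0" for \<rho>
  proof -
    note hm = V_has_moments[OF \<rho>(1)]
    have [measurable_cong]: "sets \<rho> = sets borel" by (rule has_momentsD(1)[OF hm])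
    interpret finite_measure \<rho> by (rule has_momentsD(3)[OF hm])
    have i: "integrable \<rho> (\<lambda>x. x / (x + 1))"
      by (rule integrable_const_bound[where B = 1]) (use \<rho>(2) in \<open>auto elim!: eventually_mono\<close>)
    have "(LINT x|\<rho>. 1 / (x + 1)) = (LINT x|\<rho>. 1 - x / (x + 1))"
    proof (rule integral_cong_AE)
      show "AE x in \<rho>. 1 / (x + 1) = 1 - x / (x + 1)" using \<rho>(2) by eventually_elim (simp add: field_simps)
    qed measurable
    also have "\<dots> = s 0 - (LINT x|\<rho>. x / (x + 1))"
      using i V_moments[OF \<rho>(1)] by (subst Bochner_Integration.integral_diff) (auto simp: moments_def)
    finally show ?thesis .
  qed
  have "(LINT x|mu_K s. x / (x + 1)) \<le> (LINT x|\<nu>. x / (x + 1))"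
  proof (rule field_le_epsilon)
    fix e :: real assume "e > 0"
    then obtain \<pi> where \<pi>: "L ([:0, 1:] * [:1, 1:] * \<pi> * \<pi>) = L ([:0, 1:] * \<pi>)"
      "\<bar>(LINT x|mu_K s. x / (x + 1)) - L ([:0, 1:] * \<pi>)\<bar> < e"
      using mu_K_approximants by blast
    have ae': "AE x in \<nu>. x + 1 \<ge> 1 \<and> poly [:0, 1:] x \<ge> 0" using \<nu>(2) by eventually_elim simp
    have "0 \<le> (LINT x|\<nu>. poly [:0, 1:] x * (x + 1) * (1 / (x + 1) - poly \<pi> x)\<^sup>2)"
      by (rule integral_nonneg_AE) (use \<nu>(2) in \<open>auto elim!: eventually_mono\<close>)
    also have "\<dots> = (LINT x|\<nu>. x / (x + 1)) - L ([:0, 1:] * \<pi>)"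
      using integral_approximant_square(3)[OF \<nu>(1) ae' _ \<pi>(1)] by simp
    finally show "(LINT x|mu_K s. x / (x + 1)) \<le> (LINT x|\<nu>. x / (x + 1)) + e"
      using \<pi>(2) unfolding abs_less_iff by linarith
  qed
  hence "(LINT x|\<nu>. 1 / (x + 1)) \<le> (LINT x|mu_F s. 1 / (x + 1))"
    using part[OF \<nu>] part[OF mu_F_V mu_F_nonneg] by (simp add: KF)
  hence "(LINT x|mu_F s. 1 / (x + 1)) = (LINT x|\<nu>. 1 / (x + 1))"
    using mu_F_minimal(1)[OF \<nu>(1) _ _ ae] by simp
  thus ?thesis using mu_F_minimal_unique[OF \<nu>(1) _ _ ae] by simp
qed

lemma mu_ext_neq_mu_F:
  assumes "t \<noteq> - \<infinity>" "t \<noteq> Friedrichs s"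
  shows "mu_ext s t \<noteq> mu_F s"
proof
  assume eq: "mu_ext s t = mu_F s"
  obtain f where "extremal_at (mu_F s) 0 (par_eps (Friedrichs s)) (par_tau (Friedrichs s)) f"
    using mu_F_extremal by blast
  moreover have "extremal_at (mu_F s) 0 (par_eps t) (par_tau t) (kfun 0 (par_eps t) (par_tau t))"
    using mu_ext_structure[OF assms(1)] eq by auto
  ultimately show False
    using parameter_unique[OF V_has_moments[OF mu_F_V]] assms Friedrichs_neq_MInf by metis
qed

section \<open>The weighted solutions\<close>

lemma weighted_mu_ext_indeterminate:
  assumes t: "t \<noteq> - \<infinity>" "t \<noteq> Friedrichs s"
  shows "weighted (1/2) (mu_ext s t) \<in> M_indet" "N_extremal (weighted (1/2) (mu_ext s t))"
proof -
  obtain \<mu> c where \<mu>_eq: "mu_ext s t = \<mu>" and \<mu>: "\<mu> \<in> V s" and c: "AE x in \<mu>. x \<ge> c"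
    and ext: "extremal_at \<mu> 0 (par_eps t) (par_tau t) (kfun 0 (par_eps t) (par_tau t))"
    using mu_ext_structure[OF t(1)] by blast
  \<comment> \<open>Puts -a at distance at least 1 below both the support of \<mu> and the half-line
    of \<open>mu_F\<close>, also when \<mu> charges a negative point.\<close>
  define a where "a = \<bar>c\<bar> + 1"
  have a: "a > 0" by (simp add: a_def)
  have ae: "AE x in \<mu>. x + a \<ge> 1" using c by eventually_elim (simp add: a_def)
  have ne: "\<mu> \<noteq> mu_F s" using mu_ext_neq_mu_F[OF t] by (simp add: \<mu>_eq)
  have less: "(LINT x|mu_F s. 1 / (x + a)) < (LINT x|\<mu>. 1 / (x + a))"
    using mu_F_minimal(1)[OF \<mu> a _ ae] mu_F_minimal_unique[OF \<mu> a _ ae] ne by fastforce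
  have aeF: "AE x in mu_F s. x + a > 0" using mu_F_nonneg by eventually_elim (use a in simp)
  have intF: "integrable (mu_F s) (\<lambda>x. 1 / (x + a))"
  proof -
    have "AE x in mu_F s. x + a \<ge> a \<and> poly 1 x \<ge> 0" using mu_F_nonneg by eventually_elim simp
    from integral_approximant_square(1)[OF mu_F_V this a, of 0] show ?thesis by simp
  qed
  obtain \<kappa> where \<kappa>: "has_moments \<kappa>" "moments \<kappa> = moments (weighted (1/2) \<mu>)" "\<kappa> \<noteq> weighted (1/2) \<mu>"
    using competitor_measure[OF \<mu> mu_F_V less_imp_le[OF a] zero_less_one ae aeF intF less] by metis
  have "weighted (1/2) \<mu> \<in> Mstar" by (rule weighted_Mstar) (use \<mu> in \<open>auto simp: V_def\<close>)
  thus ind: "weighted (1/2) (mu_ext s t) \<in> M_indet"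
    using \<kappa> unfolding \<mu>_eq by (rule indeterminate_measureI)
  show "N_extremal (weighted (1/2) (mu_ext s t))"
    using extremal_at_weighted[OF V_has_moments[OF \<mu>] ext, of "1/2"] N_extremalI[OF ind] by (auto simp: \<mu>_eq)
qed

text \<open>The competitor must itself live on the half-line, so its atom is placed at 0, that is a
  = 0. This requires a gap of \<mu> at 0, which follows from x \<open>kfun\<close> (x) = 1 and the
  boundedness of \<open>kfun\<close> near 0. The integrals of 1/x to be compared are the parameters
  t and F.\<close>

lemma weighted_mu_ext_indet_S:
  assumes t: "Friedrichs s < t" "t < \<infinity>"
  shows "indet_S_measure (weighted (1/2) (mu_ext s t))"
proof -
  have t1: "t \<noteq> - \<infinity>" using t by auto
  obtain t' where t': "t = ereal t'" using t by (cases t) auto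
  obtain F where F: "Friedrichs s = ereal F" using t Friedrichs_neq_MInf by (cases "Friedrichs s") auto
  obtain \<mu> where \<mu>_eq: "mu_ext s t = \<mu>" and \<mu>: "\<mu> \<in> V s" and nn: "AE x in \<mu>. x \<ge> 0"
    and ext': "extremal_at \<mu> 0 (par_eps t) (par_tau t) (kfun 0 (par_eps t) (par_tau t))"
    using mu_ext_structure[OF t1] t by blast
  have ext: "extremal_at \<mu> 0 1 t' (kfun 0 1 t')" using ext' by (simp add: t' par_eps_def par_tau_def)
  note hm = V_has_moments[OF \<mu>]
  have [measurable_cong]: "sets \<mu> = sets borel" "sets (mu_F s) = sets borel"
    using has_momentsD(1)[OF hm] has_momentsD(1)[OF V_has_moments[OF mu_F_V]] by auto
  have "compact ((kfun 0 1 t' :: real \<Rightarrow> real) ` cball 0 1)"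
    by (intro compact_continuous_image continuous_on_subset[OF continuous_kfun]) auto
  then obtain B where B: "\<And>x. x \<in> cball 0 1 \<Longrightarrow> \<bar>kfun 0 1 t' x\<bar> \<le> (B::real)"
    using compact_imp_bounded bounded_iff by (metis imageI real_norm_def)
  \<comment> \<open>Below this \<delta> the product of x with a value bounded by \<bar>B\<bar> + 1
    cannot reach 1.\<close>
  define \<delta> where "\<delta> = 1 / (\<bar>B\<bar> + 1)"
  have \<delta>: "\<delta> > 0" "\<delta> \<le> 1" by (auto simp: \<delta>_def)
  have eqx: "AE x in \<mu>. (x - 0) * kfun 0 1 t' x = 1" using ext by (simp add: extremal_at_def)
  have ae: "AE x in \<mu>. x + 0 \<ge> \<delta>"
    using eqx nn
  proof eventually_elim
    case (elim x)
    show ?case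
    proof (rule ccontr)
      assume "\<not> x + 0 \<ge> \<delta>"
      hence x: "x < \<delta>" by simp
      hence k: "\<bar>kfun 0 1 t' x\<bar> < \<bar>B\<bar> + 1" using B[of x] elim(2) \<delta> by auto
      have "1 = x * \<bar>kfun 0 1 t' x\<bar>" using elim by (metis abs_mult abs_of_nonneg abs_one diff_zero)
      also have "\<dots> \<le> x * (\<bar>B\<bar> + 1)" using k elim(2) by (intro mult_left_mono) auto
      also have "\<dots> < \<delta> * (\<bar>B\<bar> + 1)" using x by (intro mult_strict_right_mono) auto
      also have "\<dots> = 1" by (simp add: \<delta>_def)
      finally show False by simp
    qed
  qed
  have inv: "integrable \<rho> (\<lambda>x. 1 / (x + 0))" "(LINT x|\<rho>. 1 / (x + 0)) = \<tau>" "AE x in \<rho>. x \<noteq> 0"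
    if \<rho>: "\<rho> \<in> V s" "extremal_at \<rho> 0 1 \<tau> f" for \<rho> \<tau> f
  proof -
    have sq: "sq_integrable \<rho> f" and e: "AE x in \<rho>. (x - 0) * f x = 1" and \<tau>: "(LINT x|\<rho>. f x) = \<tau>"
      using \<rho>(2) by (auto simp: extremal_at_def poly_approximable_def)
    have [measurable_cong]: "sets \<rho> = sets borel" by (rule has_momentsD(1)[OF V_has_moments[OF \<rho>(1)]])
    have [measurable]: "f \<in> borel_measurable \<rho>" using sq by (simp add: sq_integrable_def)
    have fi: "integrable \<rho> f"
      using sq_integrable_mult[OF sq sq_integrable_poly[OF V_has_moments[OF \<rho>(1)], of 1]] by simp
    have eq: "AE x in \<rho>. 1 / (x + 0) = f x"
      using e
    proof eventually_elim
      case (elim x)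
      hence "x \<noteq> 0" by auto
      thus ?case using elim by (simp add: field_simps)
    qed
    show "integrable \<rho> (\<lambda>x. 1 / (x + 0))" by (subst integrable_cong_AE[OF _ _ eq]) (use fi in auto)
    show "(LINT x|\<rho>. 1 / (x + 0)) = \<tau>" unfolding \<tau>[symmetric] by (rule integral_cong_AE[OF _ _ eq]) measurable
    show "AE x in \<rho>. x \<noteq> 0" using e by eventually_elim auto
  qed
  obtain f where f: "extremal_at (mu_F s) 0 1 F f" using mu_F_extremal by (auto simp: F par_eps_def par_tau_def)
  have aeF: "AE x in mu_F s. x + 0 > 0" using inv(3)[OF mu_F_V f] mu_F_nonneg by eventually_elim simp
  have less: "(LINT x|mu_F s. 1 / (x + 0)) < (LINT x|\<mu>. 1 / (x + 0))"
    unfolding inv(2)[OF mu_F_V f] inv(2)[OF \<mu> ext] using t by (simp add: F t')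
  obtain \<kappa> where \<kappa>: "has_moments \<kappa>" "moments \<kappa> = moments (weighted (1/2) \<mu>)" "\<kappa> \<noteq> weighted (1/2) \<mu>"
    "(AE x in \<mu>. x \<ge> 0) \<Longrightarrow> (AE x in mu_F s. x \<ge> 0) \<Longrightarrow> (0::real) = 0 \<Longrightarrow> (AE x in \<kappa>. x \<ge> 0)"
    using competitor_measure[OF \<mu> mu_F_V order_refl \<delta>(1) ae aeF inv(1)[OF mu_F_V f] less] by metis
  define W where "W = weighted (1/2) \<mu>"
  have WM: "W \<in> Mstar" unfolding W_def by (rule weighted_Mstar) (use \<mu> in \<open>auto simp: V_def\<close>)
  have W: "W \<in> V (moments W)" using WM by (simp add: V_def)
  have Wnn: "AE x in W. x \<ge> 0" unfolding W_def by (rule AE_weighted[OF has_momentsD(1)[OF hm] nn])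
  have VW: "W \<in> V_Stieltjes (moments W)" using W Wnn by (simp add: V_Stieltjes_iff)
  have V\<kappa>: "\<kappa> \<in> V_Stieltjes (moments W)"
    using \<kappa> nn mu_F_nonneg V_same_moments[OF W] by (simp add: V_Stieltjes_iff W_def)
  have "W \<in> M_indet" using \<kappa> by (intro indeterminate_measureI[OF WM]) (auto simp: W_def)
  hence "indet_S (moments W)"
    unfolding indet_S_def using indeterminate_measureD(3) VW V\<kappa> \<kappa>(3) by (metis W_def)
  moreover have "msupport W \<subseteq> {0..}" using VW by (simp add: V_Stieltjes_def)
  ultimately show ?thesis using WM by (simp add: indet_S_measure_def W_def \<mu>_eq)
qed

text \<open>The Krein approximants make \<open>X W\<close>, the measure W multiplied by x,
  determinate. Two Stieltjes solutions with the moments of W agree after this multiplication, hence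
  off 0, and the common total mass settles the atom at 0.\<close>

lemma weighted_mu_K_det_S:
  assumes F: "Friedrichs s < \<infinity>"
  shows "det_S_measure (weighted (1/2) (mu_K s))"
proof -
  define W where "W = weighted (1/2) (mu_K s)"
  have ind: "W \<in> M_indet" unfolding W_def mu_K_def by (rule weighted_mu_ext_indeterminate) (use F in auto)
  have W: "W \<in> V (moments W)" by (rule indeterminate_measureD(2)[OF ind])
  note hmW = V_has_moments[OF W]
  have Wnn: "AE x in W. x \<ge> 0"
    unfolding W_def by (rule AE_weighted[OF has_momentsD(1)[OF V_has_moments[OF mu_K_V]] mu_K_nonneg])
  have VW: "W \<in> V_Stieltjes (moments W)" using W Wnn by (simp add: V_Stieltjes_iff)
  define X where "X \<rho> = density \<rho> (\<lambda>x. ennreal \<bar>x\<bar>)" for \<rho> :: "real measure"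
  have "density (mu_K s) (\<lambda>x. ennreal (wt (1/2) x * \<bar>poly [:0, 1:] x\<bar>)) \<in> M_det"
  proof (rule determinate_if_approximants[OF mu_K_V mu_K_nonneg])
    have le: "x \<le> 1 + x\<^sup>2" for x :: real using sum_squares_bound[of 1 "\<bar>x\<bar>"] by simp
    show "AE x in mu_K s. 0 \<le> poly [:0, 1:] x \<and> poly [:0, 1:] x \<le> 1 + x\<^sup>2"
      using mu_K_nonneg by eventually_elim (use le in simp)
  qed (use mu_K_approximants in auto)
  moreover have "X W = density (mu_K s) (\<lambda>x. ennreal (wt (1/2) x * \<bar>poly [:0, 1:] x\<bar>))"
  proof -
    have [measurable_cong]: "sets (mu_K s) = sets borel" by (rule has_momentsD(1)[OF V_has_moments[OF mu_K_V]])
    show ?thesis unfolding X_def W_def weighted_eq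
      by (subst density_density_eq) (auto simp: ennreal_mult wt_pos less_imp_le)
  qed
  ultimately have det: "X W \<in> M_det" by simp
  have "\<sigma> = W" if \<sigma>: "\<sigma> \<in> V_Stieltjes (moments W)" for \<sigma>
  proof -
    have \<sigma>V: "\<sigma> \<in> V (moments W)" and \<sigma>nn: "AE x in \<sigma>. x \<ge> 0" using \<sigma> by (auto simp: V_Stieltjes_iff)
    note hm\<sigma> = V_has_moments[OF \<sigma>V]
    have bd: "AE x in \<rho>. \<bar>x\<bar> \<le> 1 * (1 + x\<^sup>2)" for \<rho> :: "real measure"
    proof -
      have "\<bar>x\<bar> \<le> 1 * (1 + x\<^sup>2)" for x :: real using sum_squares_bound[of 1 "\<bar>x\<bar>"] by simp
      thus ?thesis by simp
    qed
    have XM: "X \<rho> \<in> Mstar" "moments (X \<rho>) n = moments W (Suc n)"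
      if \<rho>: "\<rho> \<in> V (moments W)" "AE x in \<rho>. x \<ge> 0" for \<rho> n
    proof -
      show "X \<rho> \<in> Mstar" unfolding X_def
        by (rule Mstar_density[where C = 1 and q = "[:0, 1:]"]) (use \<rho> bd in \<open>auto simp: V_def\<close>)
      have "moments (X \<rho>) n = moment_functional (moments (X \<rho>)) (monom 1 n)" by (simp add: moment_functional_monom)
      also have "\<dots> = (LINT x|\<rho>. \<bar>x\<bar> * poly (monom 1 n) x)"
        unfolding X_def by (rule has_moments_density(3)[OF V_has_moments[OF \<rho>(1)] _ _ bd]) auto
      also have "\<dots> = (LINT x|\<rho>. x ^ Suc n)"
      proof (rule integral_cong_AE)
        have [measurable_cong]: "sets \<rho> = sets borel" by (rule has_momentsD(1)[OF V_has_moments[OF \<rho>(1)]])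
        show "(\<lambda>x. \<bar>x\<bar> * poly (monom 1 n) x) \<in> borel_measurable \<rho>" "(\<lambda>x. x ^ Suc n) \<in> borel_measurable \<rho>"
          by measurable
        show "AE x in \<rho>. \<bar>x\<bar> * poly (monom 1 n) x = x ^ Suc n"
          using \<rho>(2) by eventually_elim (simp add: poly_monom)
      qed
      also have "\<dots> = moments \<rho> (Suc n)" by (simp only: moments_def)
      finally show "moments (X \<rho>) n = moments W (Suc n)" using V_moments[OF \<rho>(1)] by simp
    qed
    have "moments (X \<sigma>) = moments (X W)" using XM(2)[OF \<sigma>V \<sigma>nn] XM(2)[OF W Wnn] by auto
    hence XX: "X \<sigma> = X W" using det XM(1)[OF \<sigma>V \<sigma>nn] by (auto simp: M_det_def)
    \<comment> \<open>Off 0 the factor \<bar>x\<bar> can be undone by 1 / \<bar>x\<bar>; at 0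
      multiplication by \<bar>x\<bar> has destroyed the mass, so it must be added
      separately.\<close>
    have split: "emeasure \<rho> A = (\<integral>\<^sup>+x. ennreal (1 / \<bar>x\<bar>) * indicator A x \<partial>X \<rho>) + (if 0 \<in> A then emeasure \<rho> {0} else 0)"
      if sets: "sets \<rho> = sets borel" and A: "A \<in> sets borel" for \<rho> A
    proof -
      have [measurable_cong]: "sets \<rho> = sets borel" by fact
      have [measurable]: "A \<in> sets borel" by fact
      have "(\<integral>\<^sup>+x. ennreal (1 / \<bar>x\<bar>) * indicator A x \<partial>X \<rho>) = (\<integral>\<^sup>+x. ennreal \<bar>x\<bar> * (ennreal (1 / \<bar>x\<bar>) * indicator A x) \<partial>\<rho>)"
        unfolding X_def by (subst nn_integral_density) auto
      also have "\<dots> = (\<integral>\<^sup>+x. indicator (A - {0}) x \<partial>\<rho>)"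
      proof (intro nn_integral_cong)
        fix x
        have "ennreal \<bar>x\<bar> * ennreal (1 / \<bar>x\<bar>) = 1" if "x \<noteq> 0"
          using that by (simp add: ennreal_mult[symmetric])
        thus "ennreal \<bar>x\<bar> * (ennreal (1 / \<bar>x\<bar>) * indicator A x) = indicator (A - {0}) x"
          by (cases "x = 0") (auto simp: mult.assoc[symmetric] indicator_def)
      qed
      also have "\<dots> = emeasure \<rho> (A - {0})" using sets by simp
      finally have 1: "(\<integral>\<^sup>+x. ennreal (1 / \<bar>x\<bar>) * indicator A x \<partial>X \<rho>) = emeasure \<rho> (A - {0})" .
      show ?thesis
      proof (cases "0 \<in> A")
        case True
        have "emeasure \<rho> A = emeasure \<rho> ((A - {0}) \<union> {0})" using True by (simp add: insert_absorb)
        also have "\<dots> = emeasure \<rho> (A - {0}) + emeasure \<rho> {0}"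
          by (rule plus_emeasure[symmetric]) (use sets A in auto)
        finally show ?thesis using 1 True by simp
      next
        case False
        thus ?thesis using 1 by simp
      qed
    qed
    have mass: "emeasure \<rho> UNIV = ennreal (moments W 0)" if "\<rho> \<in> V (moments W)" for \<rho>
    proof -
      note h = V_has_moments[OF that]
      interpret finite_measure \<rho> by (rule has_momentsD(3)[OF h])
      have "moments W 0 = moments \<rho> 0" using V_moments[OF that] by simp
      also have "\<dots> = measure \<rho> UNIV" using has_momentsD(2)[OF h] by (simp add: moments_def)
      finally show ?thesis by (simp add: emeasure_eq_measure)
    qed
    \<comment> \<open>J is common to both measures because \<open>X \<sigma>\<close> equals
      \<open>X W\<close>, and it is finite as a part of the total mass, so it can be
      cancelled.\<close>
    have zero: "emeasure \<sigma> {0} = emeasure W {0}"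
    proof -
      define J where "J = (\<integral>\<^sup>+x. ennreal (1 / \<bar>x\<bar>) * indicator UNIV x \<partial>X W)"
      have "ennreal (moments W 0) = J + emeasure \<sigma> {0}"
        using split[OF has_momentsD(1)[OF hm\<sigma>], of UNIV] mass[OF \<sigma>V] by (simp add: J_def XX)
      moreover have "ennreal (moments W 0) = J + emeasure W {0}"
        using split[OF has_momentsD(1)[OF hmW], of UNIV] mass[OF W] by (simp add: J_def)
      moreover have "J \<noteq> \<top>"
        using calculation(1) by auto
      ultimately show ?thesis by (metis ennreal_add_left_cancel infinity_ennreal_def)
    qed
    show ?thesis
    proof (rule measure_eqI)
      show "sets \<sigma> = sets W" using has_momentsD(1)[OF hm\<sigma>] has_momentsD(1)[OF hmW] by simp
      fix A assume "A \<in> sets \<sigma>"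
      hence A: "A \<in> sets borel" using has_momentsD(1)[OF hm\<sigma>] by simp
      show "emeasure \<sigma> A = emeasure W A"
        using split[OF has_momentsD(1)[OF hm\<sigma>] A] split[OF has_momentsD(1)[OF hmW] A] by (simp add: XX zero)
    qed
  qed
  hence "det_S (moments W)"
    unfolding det_S_def using indeterminate_measureD(3)[OF ind] VW by blast
  moreover have "msupport W \<subseteq> {0..}" using VW by (simp add: V_Stieltjes_def)
  moreover have "W \<in> Mstar" using W by (simp add: V_def)
  ultimately show ?thesis by (simp add: det_S_measure_def W_def)
qed

lemma V_M_indet: "\<mu> \<in> V s \<Longrightarrow> \<mu> \<in> M_indet"
  using not_unique by (auto simp: M_indet_def M_det_def V_def)

end

section \<open>Assembling the theorem\<close>

lemma weighted_0: "weighted 0 \<mu> = \<mu>"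
proof -
  have "1 + x\<^sup>2 \<noteq> 0" for x :: real using zero_le_power2[of x] by linarith
  thus ?thesis by (simp add: weighted_def density_1)
qed

theorem theorem3p8:
  fixes s :: "nat \<Rightarrow> real"
  assumes "indeterminate_seq s" and "s 0 = 1" and "Stieltjes_seq s"
  shows
    "(indet_S s \<longrightarrow>
        weighted (1/2) (mu_F s) \<in> M_det \<and>
        (\<forall>t. Friedrichs s < t \<and> t < \<infinity> \<longrightarrow>
           indet_S_measure (weighted (1/2) (mu_ext s t)) \<and>
           N_extremal (weighted (1/2) (mu_ext s t))) \<and>
        weighted (1/2) (mu_K s) \<in> M_indet \<and>
        N_extremal (weighted (1/2) (mu_K s)) \<and>
        det_S_measure (weighted (1/2) (mu_K s))) \<and>
     (det_S s \<longrightarrow>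
        Friedrichs s = \<infinity> \<and> V_Stieltjes s = {mu_F s} \<and>
        weighted (1/2) (mu_F s) \<in> M_det) \<and>
     (\<forall>t. -\<infinity> < t \<and> t < Friedrichs s \<longrightarrow>
        weighted (1/2) (mu_ext s t) \<in> M_indet \<and>
        N_extremal (weighted (1/2) (mu_ext s t))) \<and>
     (mu_F s \<in> B_class (1/2) \<and> a_index (mu_F s) \<le> 1/2) \<and>
     (\<forall>t. t \<noteq> -\<infinity> \<and> t \<noteq> Friedrichs s \<longrightarrow>
        mu_ext s t \<in> A_class (1/2) \<and> a_index (mu_ext s t) \<ge> 1/2)"
proof -
  have "\<exists>\<mu>\<in>V s. \<exists>\<nu>\<in>V s. \<mu> \<noteq> \<nu>" "V s \<noteq> {}" "V_Stieltjes s \<noteq> {}"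
    using assms by (auto simp: indeterminate_seq_def Stieltjes_seq_def)
  then interpret stieltjes_sequence s by unfold_locales auto
  have FS: "mu_F s \<in> V_Stieltjes s" using mu_F_V mu_F_nonneg by (simp add: V_Stieltjes_iff)
  have KS: "mu_K s \<in> V_Stieltjes s" using mu_K_V mu_K_nonneg by (simp add: V_Stieltjes_iff)
  have fin: "Friedrichs s < \<infinity>" if indet: "indet_S s"
  proof (rule ccontr)
    assume "\<not> Friedrichs s < \<infinity>"
    hence "Friedrichs s = \<infinity>" by simp
    hence "\<nu> = mu_F s" if "\<nu> \<in> V_Stieltjes s" for \<nu> using Stieltjes_unique_if_Friedrichs_infinite that by blast
    thus False using indet unfolding indet_S_def by metis
  qed
  \<comment> \<open>With finite F the Krein solution would be a second Stieltjes solution beside the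
    Friedrichs solution.\<close>
  have inf: "Friedrichs s = \<infinity>" if det: "det_S s"
  proof (rule ccontr)
    assume "Friedrichs s \<noteq> \<infinity>"
    hence "mu_K s \<noteq> mu_F s" unfolding mu_K_def by (intro mu_ext_neq_mu_F) auto
    thus False using det FS KS unfolding det_S_def by metis
  qed
  have V: "mu_ext s t \<in> V s" if "t \<noteq> - \<infinity>" for t using mu_ext_structure[OF that] by auto
  have bdd: "bdd_above {\<alpha> \<in> {0..1}. \<mu> \<in> A_class \<alpha>}" for \<mu> by (rule bdd_aboveI[of _ 1]) auto
  have 1: "a_index (mu_F s) \<le> 1/2"
    unfolding a_index_def
  proof (rule cSup_least)
    \<comment> \<open>Exponent 0 leaves the measure unchanged, so the set whose supremum is taken is
      nonempty.\<close>
    have "mu_F s \<in> A_class 0" using V_M_indet[OF mu_F_V] by (simp add: A_class_def weighted_0)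
    thus "{\<alpha> \<in> {0..1}. mu_F s \<in> A_class \<alpha>} \<noteq> {}" by force
    fix \<alpha> assume \<alpha>: "\<alpha> \<in> {\<alpha> \<in> {0..1}. mu_F s \<in> A_class \<alpha>}"
    show "\<alpha> \<le> 1/2"
    proof (rule ccontr)
      assume "\<not> \<alpha> \<le> 1/2"
      hence "weighted \<alpha> (mu_F s) \<in> M_det" by (intro weighted_mu_F_determinate) simp
      thus False using \<alpha> by (simp add: A_class_def M_indet_def)
    qed
  qed
  have 2: "mu_ext s t \<in> A_class (1/2)" "a_index (mu_ext s t) \<ge> 1/2" if "t \<noteq> - \<infinity>" "t \<noteq> Friedrichs s" for t
  proof -
    show A: "mu_ext s t \<in> A_class (1/2)"
      using weighted_mu_ext_indeterminate(1)[OF that] V_M_indet[OF V[OF that(1)]] by (simp add: A_class_def)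
    show "a_index (mu_ext s t) \<ge> 1/2" unfolding a_index_def using A by (intro cSup_upper bdd) simp
  qed
  have K: "weighted (1/2) (mu_K s) \<in> M_indet" "N_extremal (weighted (1/2) (mu_K s))" if "Friedrichs s < \<infinity>"
    unfolding mu_K_def using that by (auto intro!: weighted_mu_ext_indeterminate)
  have t1: "weighted (1/2) (mu_ext s t) \<in> M_indet" "N_extremal (weighted (1/2) (mu_ext s t))"
    if "Friedrichs s < t \<or> - \<infinity> < t \<and> t < Friedrichs s" for t
    using that by (auto intro!: weighted_mu_ext_indeterminate)
  have uniq: "V_Stieltjes s = {mu_F s}" if "det_S s"
    using FS Stieltjes_unique_if_Friedrichs_infinite[OF inf[OF that]] by blast
  have B: "mu_F s \<in> B_class (1/2)"
    using V_M_indet[OF mu_F_V] weighted_mu_F_determinate[of "1/2"] by (simp add: B_class_def)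
  show ?thesis
    using fin inf uniq B 1 2 K t1 weighted_mu_F_determinate[of "1/2"] weighted_mu_ext_indet_S weighted_mu_K_det_S
    by simp
qed

end
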